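(* Let $\mathbb{k}$ be an algebraically closed field of characteristic $p>3$, let $\ell\geq 1$ be an integer, and let $\chi\in W_\ell^*$ be a linear form of height $r(\chi)=0$ with $\chi(e_{-1}t^{\ell})\neq 0$. Then $\mathcal{Z}_\chi(\lambda)\cong\mathcal{Z}_\chi(\mu)$ as $U_\chi(W_\ell)$-modules for all $\lambda,\mu\in\Lambda(\chi)$. In particular, $U_\chi(W_\ell)$ has only one simple module up to isomorphism.
   Context: The Witt algebra $W$ is the Lie algebra of derivations of $\mathbb{k}[X]/(X^p)$, with basis $e_i=x^{i+1}\partial$, $-1\le i\le p-2$, and bracket $[e_i,e_j]=(j-i)e_{i+j}$, where $e_{i+j}:=0$ if $i+j\notin\{-1,\dots,p-2\}$. For an integer $\ell\ge 0$, the truncated current Lie algebra is $W_\ell:=W\otimes\mathbb{k}[t]/(t^{\ell+1})$, with basis $e_it^j:=e_i\otimes t^j$ ($-1\le i\le p-2$, $0\le j\le\ell$) and bracket $[e_it^k,e_jt^l]=(j-i)e_{i+j}t^{k+l}$. It is a restricted Lie algebra with $p$-map determined by $(e_it^k)^{[p]}=\delta_{i,0}\,e_it^{kp}$ (with $t^m=0$ for $m>\ell$). Set $W_{\ell,[i]}:=\mathbb{k}e_i\otimes\mathbb{k}[t]/(t^{\ell+1})$ and $W_{\ell,(i)}:=\sum_{j\ge i}W_{\ell,[j]}$ for $i\geq -1$. For $\chi\in W_\ell^*$, the height $r(\chi)$ is the smallest integer $i\ge -1$ with $\chi(W_{\ell,(i)})=(0)$. For a restricted Lie algebra $L$ and $\chi\in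 L^*$, the reduced enveloping algebra is $U_\chi(L):=U(L)/(x^p-x^{[p]}-\chi(x)^p\cdot 1:\ x\in L)$; for a restricted subalgebra $L'\subseteq L$, $U_\chi(L')$ is formed with $\chi|_{L'}$. Suppose $r(\chi)\le 1$. Put $\Lambda(\chi):=\{\lambda\in\mathbb{k}:\lambda^p-\lambda=\chi(e_0)^p\}$. For $\lambda\in\Lambda(\chi)$, let $\mathbb{k}_\lambda=\mathbb{k}v_\lambda$ be the one-dimensional $U_\chi(W_{\ell,(0)})$-module with $e_0.v_\lambda=\lambda v_\lambda$, $W_{\ell,(1)}.v_\lambda=0$, and $e_0t^i.v_\lambda=\chi_iv_\lambda$ for $1\le i\le\ell$, where the scalars $\chi_i$ are uniquely determined by $\chi$ through $\chi_i^p-\chi_{ip}=\chi(e_0t^i)^p$ (with $\chi_m:=0$ for $m>\ell$). The $\chi$-reduced Verma module is $\mathcal{Z}_\chi(\lambda):=U_\chi(W_\ell)\otimes_{U_\chi(W_{\ell,(0)})}\mathbb{k}_\lambda$. *)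

theory Defs
  imports
    "HOL-Algebra.Module"
    "HOL-Algebra.QuotRing"
    "HOL-Algebra.Free_Abelian_Groups"
    "HOL-Computational_Algebra.Polynomial"
begin

section \<open>Left modules over not necessarily commutative rings\<close>

text \<open>The record of \<^locale>\<open>module\<close> is reused for left modules over a noncommutative ring; its
  fields \<^const>\<open>monoid.mult\<close> and \<^const>\<open>monoid.one\<close> play no role. The locale
  \<^locale>\<open>submodule\<close> does not involve commutativity and is used as it stands.\<close>

locale left_module = R?: ring R + M?: abelian_group M
  for R :: "('a, 'c) ring_scheme" (structure) and M :: "('a, 'b, 'd) module_scheme" (structure) +
  assumes smult_closed:
      "\<lbrakk>a \<in> carrier R; x \<in> carrier M\<rbrakk> \<Longrightarrow> a \<odot>\<^bsub>M\<^esub> x \<in> carrier M"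
    and smult_l_distr:
      "\<lbrakk>a \<in> carrier R; b \<in> carrier R; x \<in> carrier M\<rbrakk> \<Longrightarrow>
        (a \<oplus>\<^bsub>R\<^esub> b) \<odot>\<^bsub>M\<^esub> x = (a \<odot>\<^bsub>M\<^esub> x) \<oplus>\<^bsub>M\<^esub> (b \<odot>\<^bsub>M\<^esub> x)"
    and smult_r_distr:
      "\<lbrakk>a \<in> carrier R; x \<in> carrier M; y \<in> carrier M\<rbrakk> \<Longrightarrow>
        a \<odot>\<^bsub>M\<^esub> (x \<oplus>\<^bsub>M\<^esub> y) = (a \<odot>\<^bsub>M\<^esub> x) \<oplus>\<^bsub>M\<^esub> (a \<odot>\<^bsub>M\<^esub> y)"
    and smult_assoc:
      "\<lbrakk>a \<in> carrier R; b \<in> carrier R; x \<in> carrier M\<rbrakk> \<Longrightarrow>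
        (a \<otimes>\<^bsub>R\<^esub> b) \<odot>\<^bsub>M\<^esub> x = a \<odot>\<^bsub>M\<^esub> (b \<odot>\<^bsub>M\<^esub> x)"
    and smult_one:
      "x \<in> carrier M \<Longrightarrow> \<one>\<^bsub>R\<^esub> \<odot>\<^bsub>M\<^esub> x = x"

definition left_module_iso ::
  "'a ring \<Rightarrow> ('a, 'm) module \<Rightarrow> ('a, 'n) module \<Rightarrow> bool" where
  "left_module_iso R M N \<longleftrightarrow> left_module R M \<and> left_module R N \<and>
     (\<exists>f. bij_betw f (carrier M) (carrier N) \<and>
          (\<forall>x\<in>carrier M. \<forall>y\<in>carrier M. f (x \<oplus>\<^bsub>M\<^esub> y) = f x \<oplus>\<^bsub>N\<^esub> f y) \<and>
          (\<forall>a\<in>carrier R. \<forall>x\<in>carrier M. f (a \<odot>\<^bsub>M\<^esub> x) = a \<odot>\<^bsub>N\<^esub> f x))"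

definition simple_left_module :: "'a ring \<Rightarrow> ('a, 'm) module \<Rightarrow> bool" where
  "simple_left_module R M \<longleftrightarrow> left_module R M \<and> carrier M \<noteq> {\<zero>\<^bsub>M\<^esub>} \<and>
     (\<forall>H. submodule H R M \<longrightarrow> H = {\<zero>\<^bsub>M\<^esub>} \<or> H = carrier M)"

text \<open>The left \<open>A\<close>-module \<open>A \<otimes>\<^sub>B N\<close>, where \<open>A\<close> is a right \<open>B\<close>-module via \<open>\<phi> : B \<rightarrow> A\<close>: the free
  abelian group on the pairs modulo the usual relations, so that its elements are cosets.\<close>

definition tensor_rels ::
  "'a ring \<Rightarrow> ('b \<Rightarrow> 'a) \<Rightarrow> 'b ring \<Rightarrow> ('b, 'n) module \<Rightarrow> (('a \<times> 'n) \<Rightarrow>\<^sub>0 int) set" where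
  "tensor_rels A \<phi> B N =
     {frag_of (a \<oplus>\<^bsub>A\<^esub> a', n) - frag_of (a, n) - frag_of (a', n) | a a' n.
        a \<in> carrier A \<and> a' \<in> carrier A \<and> n \<in> carrier N} \<union>
     {frag_of (a, n \<oplus>\<^bsub>N\<^esub> n') - frag_of (a, n) - frag_of (a, n') | a n n'.
        a \<in> carrier A \<and> n \<in> carrier N \<and> n' \<in> carrier N} \<union>
     {frag_of (a \<otimes>\<^bsub>A\<^esub> \<phi> b, n) - frag_of (a, b \<odot>\<^bsub>N\<^esub> n) | a b n.
        a \<in> carrier A \<and> b \<in> carrier B \<and> n \<in> carrier N}"

definition tensor_module ::
  "'a ring \<Rightarrow> ('b \<Rightarrow> 'a) \<Rightarrow> 'b ring \<Rightarrow> ('b, 'n) module \<Rightarrow> ('a, (('a \<times> 'n) \<Rightarrow>\<^sub>0 int) set) module" where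
  "tensor_module A \<phi> B N =
     (let F = free_Abelian_group (carrier A \<times> carrier N);
          H = generate F (tensor_rels A \<phi> B N);
          Q = F Mod H
      in \<lparr>carrier = carrier Q, monoid.mult = (\<lambda>_ _. undefined), one = undefined,
          ring.zero = \<one>\<^bsub>Q\<^esub>, add = (\<lambda>X Y. X \<otimes>\<^bsub>Q\<^esub> Y),
          module.smult = (\<lambda>a X. H <#>\<^bsub>F\<^esub> (frag_extend (\<lambda>(a', n). frag_of (a \<otimes>\<^bsub>A\<^esub> a', n)) ` X))\<rparr>)"


section \<open>Restricted Lie algebras and their (reduced) enveloping algebras\<close>

text \<open>A Lie algebra lives on a carrier inside an additive group, so that a subalgebra is obtained
  by shrinking the carrier.\<close>

record ('k, 'l) restricted_lie =
  lcarrier :: "'l set"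
  lscale :: "'k \<Rightarrow> 'l \<Rightarrow> 'l"
  lbracket :: "'l \<Rightarrow> 'l \<Rightarrow> 'l"
  pmap :: "'l \<Rightarrow> 'l"

definition linear_form :: "('k::field, 'l::ab_group_add) restricted_lie \<Rightarrow> ('l \<Rightarrow> 'k) \<Rightarrow> bool" where
  "linear_form L \<chi> \<longleftrightarrow>
     (\<forall>x\<in>lcarrier L. \<forall>y\<in>lcarrier L. \<chi> (x + y) = \<chi> x + \<chi> y) \<and>
     (\<forall>c. \<forall>x\<in>lcarrier L. \<chi> (lscale L c x) = c * \<chi> x)"

text \<open>\<open>ad_coeff L x y n i\<close> is the coefficient of \<open>T ^ i\<close> in \<open>(ad (T x + y)) ^ n (x)\<close>.\<close>

fun ad_coeff ::
  "('k::field, 'l::ab_group_add) restricted_lie \<Rightarrow> 'l \<Rightarrow> 'l \<Rightarrow> nat \<Rightarrow> nat \<Rightarrow> 'l" where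
  "ad_coeff L x y 0 i = (if i = 0 then x else 0)"
| "ad_coeff L x y (Suc n) i =
     (if i = 0 then 0 else lbracket L x (ad_coeff L x y n (i - 1))) +
     lbracket L y (ad_coeff L x y n i)"

text \<open>Jacobson's axioms for a \<open>p\<close>-map. The polynomials \<open>s\<^sub>i\<close> are given by
  \<open>(ad (T x + y)) ^ (p - 1) (x) = (\<Sum>i = 1..p - 1. i s\<^sub>i(x, y) T ^ (i - 1))\<close>.\<close>

definition jacobson_s ::
  "nat \<Rightarrow> ('k::field, 'l::ab_group_add) restricted_lie \<Rightarrow> nat \<Rightarrow> 'l \<Rightarrow> 'l \<Rightarrow> 'l" where
  "jacobson_s p L i x y = lscale L (inverse (of_nat i)) (ad_coeff L x y (p - 1) (i - 1))"

definition is_p_map :: "nat \<Rightarrow> ('k::field, 'l::ab_group_add) restricted_lie \<Rightarrow> bool" where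
  "is_p_map p L \<longleftrightarrow>
     (\<forall>x\<in>lcarrier L. pmap L x \<in> lcarrier L) \<and>
     (\<forall>x\<in>lcarrier L. \<forall>y\<in>lcarrier L. lbracket L (pmap L x) y = (lbracket L x ^^ p) y) \<and>
     (\<forall>c. \<forall>x\<in>lcarrier L. pmap L (lscale L c x) = lscale L (c ^ p) (pmap L x)) \<and>
     (\<forall>x\<in>lcarrier L. \<forall>y\<in>lcarrier L.
        pmap L (x + y) = pmap L x + pmap L y + (\<Sum>i = 1..p - 1. jacobson_s p L i x y))"

text \<open>Words form the free monoid (written additively, to fit \<^type>\<open>poly_mapping\<close>), so that
  finitely supported functions on words form the free associative algebra.\<close>

datatype 'a fmonoid = Fmonoid (letters: "'a list")

instantiation fmonoid :: (type) monoid_add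
begin

definition zero_fmonoid :: "'a fmonoid" where
  "zero_fmonoid = Fmonoid []"

definition plus_fmonoid :: "'a fmonoid \<Rightarrow> 'a fmonoid \<Rightarrow> 'a fmonoid" where
  "plus_fmonoid v w = Fmonoid (letters v @ letters w)"

instance
  by standard (simp_all add: zero_fmonoid_def plus_fmonoid_def)

end

type_synonym ('k, 'l) free_alg = "'l fmonoid \<Rightarrow>\<^sub>0 'k"
type_synonym ('k, 'l) env = "('k, 'l) free_alg set"
type_synonym ('k, 'l) red_env = "('k, 'l) env set"

definition free_algebra ::
  "('k::field, 'l::ab_group_add) restricted_lie \<Rightarrow> ('k, 'l) free_alg ring" where
  "free_algebra L =
     \<lparr>carrier = {f. \<forall>w\<in>Poly_Mapping.keys f. set (letters w) \<subseteq> lcarrier L},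
      monoid.mult = (*), one = 1, ring.zero = 0, add = (+)\<rparr>"

definition fgen :: "'l \<Rightarrow> ('k::field, 'l) free_alg" where
  "fgen x = Poly_Mapping.single (Fmonoid [x]) 1"

definition fconst :: "'k \<Rightarrow> ('k::field, 'l) free_alg" where
  "fconst c = Poly_Mapping.single 0 c"

definition env_rels ::
  "('k::field, 'l::ab_group_add) restricted_lie \<Rightarrow> ('k, 'l) free_alg set" where
  "env_rels L =
     {fgen (x + y) - fgen x - fgen y | x y. x \<in> lcarrier L \<and> y \<in> lcarrier L} \<union>
     {fgen (lscale L c x) - fconst c * fgen x | c x. x \<in> lcarrier L} \<union>
     {fgen x * fgen y - fgen y * fgen x - fgen (lbracket L x y) | x y.
        x \<in> lcarrier L \<and> y \<in> lcarrier L}"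

definition env_ideal ::
  "('k::field, 'l::ab_group_add) restricted_lie \<Rightarrow> ('k, 'l) free_alg set" where
  "env_ideal L = Idl\<^bsub>free_algebra L\<^esub> (env_rels L)"

definition env_algebra ::
  "('k::field, 'l::ab_group_add) restricted_lie \<Rightarrow> ('k, 'l) env ring" where
  "env_algebra L = free_algebra L Quot env_ideal L"

definition env_class ::
  "('k::field, 'l::ab_group_add) restricted_lie \<Rightarrow> ('k, 'l) free_alg \<Rightarrow> ('k, 'l) env" where
  "env_class L f = env_ideal L +>\<^bsub>free_algebra L\<^esub> f"

definition red_ideal ::
  "nat \<Rightarrow> ('k::field, 'l::ab_group_add) restricted_lie \<Rightarrow> ('l \<Rightarrow> 'k) \<Rightarrow> ('k, 'l) env set" where
  "red_ideal p L \<chi> = Idl\<^bsub>env_algebra L\<^esub>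
     {env_class L (fgen x) [^]\<^bsub>env_algebra L\<^esub> p
        \<ominus>\<^bsub>env_algebra L\<^esub> env_class L (fgen (pmap L x))
        \<ominus>\<^bsub>env_algebra L\<^esub> env_class L (fconst (\<chi> x ^ p)) | x. x \<in> lcarrier L}"

definition red_env_algebra ::
  "nat \<Rightarrow> ('k::field, 'l::ab_group_add) restricted_lie \<Rightarrow> ('l \<Rightarrow> 'k) \<Rightarrow> ('k, 'l) red_env ring" where
  "red_env_algebra p L \<chi> = env_algebra L Quot red_ideal p L \<chi>"

text \<open>The canonical map \<open>U\<^sub>\<chi>(L') \<rightarrow> U\<^sub>\<chi>(L)\<close> for a restricted subalgebra \<open>L'\<close> of \<open>L\<close>. At both levels
  a coset \<open>I' + u\<close> is sent to \<open>I + \<phi>(u)\<close>, where \<open>\<phi>\<close> is the map one level below and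
  \<open>\<phi>(I') \<subseteq> I\<close>.\<close>

definition env_incl ::
  "('k::field, 'l::ab_group_add) restricted_lie \<Rightarrow> ('k, 'l) env \<Rightarrow> ('k, 'l) env" where
  "env_incl L X = env_ideal L <+>\<^bsub>free_algebra L\<^esub> X"

definition red_env_incl ::
  "nat \<Rightarrow> ('k::field, 'l::ab_group_add) restricted_lie \<Rightarrow> ('l \<Rightarrow> 'k)
    \<Rightarrow> ('k, 'l) red_env \<Rightarrow> ('k, 'l) red_env" where
  "red_env_incl p L \<chi> Y = red_ideal p L \<chi> <+>\<^bsub>env_algebra L\<^esub> (env_incl L ` Y)"

text \<open>The one-dimensional module on which \<open>x \<in> L\<close> acts by the scalar \<open>\<theta> x\<close>. If \<open>\<theta>\<close> does define a
  \<open>U\<^sub>\<chi>(L)\<close>-module, then the character of the free algebra extending \<open>\<theta>\<close> is constant on cosets, so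
  that the images below are singletons.\<close>

definition free_char :: "('l \<Rightarrow> 'k) \<Rightarrow> ('k::field, 'l) free_alg \<Rightarrow> 'k" where
  "free_char \<theta> f = (\<Sum>w\<in>Poly_Mapping.keys f. Poly_Mapping.lookup f w * prod_list (map \<theta> (letters w)))"

definition red_env_char :: "('l \<Rightarrow> 'k) \<Rightarrow> ('k::field, 'l) red_env \<Rightarrow> 'k" where
  "red_env_char \<theta> Y = the_elem ((\<lambda>X. the_elem (free_char \<theta> ` X)) ` Y)"

definition one_dim_module :: "('l \<Rightarrow> 'k) \<Rightarrow> (('k::field, 'l) red_env, 'k) module" where
  "one_dim_module \<theta> =
     \<lparr>carrier = UNIV, monoid.mult = (\<lambda>_ _. undefined), one = undefined, ring.zero = 0, add = (+),
      module.smult = (\<lambda>Y c. red_env_char \<theta> Y * c)\<rparr>"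


section \<open>The truncated current Lie algebra of the Witt algebra\<close>

text \<open>An element of \<open>W\<^sub>\<ell>\<close> is a finitely supported function; its value at \<open>(i, k)\<close> is the
  coefficient of \<open>e\<^sub>i t\<^sup>k\<close>.\<close>

type_synonym 'k current = "(int \<times> nat) \<Rightarrow>\<^sub>0 'k"

definition witt_index :: "nat \<Rightarrow> nat \<Rightarrow> (int \<times> nat) set" where
  "witt_index p ell = {-1..int p - 2} \<times> {0..ell}"

text \<open>The element \<open>e\<^sub>i t\<^sup>k\<close>, which is zero if \<open>(i, k)\<close> is out of range.\<close>

definition witt_e :: "nat \<Rightarrow> nat \<Rightarrow> int \<Rightarrow> nat \<Rightarrow> 'k::field current" where
  "witt_e p ell i k = (if (i, k) \<in> witt_index p ell then Poly_Mapping.single (i, k) 1 else 0)"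

definition witt_scale :: "'k::field \<Rightarrow> 'k current \<Rightarrow> 'k current" where
  "witt_scale c x = Poly_Mapping.map ((*) c) x"

definition witt_bracket :: "nat \<Rightarrow> nat \<Rightarrow> 'k::field current \<Rightarrow> 'k current \<Rightarrow> 'k current" where
  "witt_bracket p ell x y =
     (\<Sum>(i, k)\<in>Poly_Mapping.keys x. \<Sum>(j, l)\<in>Poly_Mapping.keys y.
        witt_scale (Poly_Mapping.lookup x (i, k) * Poly_Mapping.lookup y (j, l) * of_int (j - i))
          (witt_e p ell (i + j) (k + l)))"

text \<open>\<open>W\<^sub>\<ell>\<close> with a map \<open>pm\<close> in the place of its \<open>p\<close>-map.\<close>

definition witt :: "nat \<Rightarrow> nat \<Rightarrow> ('k::field current \<Rightarrow> 'k current) \<Rightarrow> ('k, 'k current) restricted_lie" where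
  "witt p ell pm =
     \<lparr>lcarrier = {x. Poly_Mapping.keys x \<subseteq> witt_index p ell}, lscale = witt_scale,
      lbracket = witt_bracket p ell, pmap = pm\<rparr>"

text \<open>The \<open>p\<close>-map of \<open>W\<^sub>\<ell>\<close>; by Jacobson's formula it is unique on the carrier.\<close>

definition is_witt_p_map :: "nat \<Rightarrow> nat \<Rightarrow> ('k::field current \<Rightarrow> 'k current) \<Rightarrow> bool" where
  "is_witt_p_map p ell pm \<longleftrightarrow> is_p_map p (witt p ell pm) \<and>
     (\<forall>(i, k)\<in>witt_index p ell.
        pm (witt_e p ell i k) = (if i = 0 then witt_e p ell i (k * p) else 0))"

text \<open>The subspace \<open>W\<^bsub>\<ell>,(i)\<^esub>\<close> spanned by the \<open>e\<^sub>j t\<^sup>k\<close> with \<open>j \<ge> i\<close>.\<close>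

definition witt_filt :: "nat \<Rightarrow> nat \<Rightarrow> int \<Rightarrow> 'k::field current set" where
  "witt_filt p ell i = {x. Poly_Mapping.keys x \<subseteq> {(j, k) \<in> witt_index p ell. j \<ge> i}}"

definition witt0 :: "nat \<Rightarrow> nat \<Rightarrow> ('k::field current \<Rightarrow> 'k current) \<Rightarrow> ('k, 'k current) restricted_lie" where
  "witt0 p ell pm = (witt p ell pm)\<lparr>lcarrier := witt_filt p ell 0\<rparr>"

definition height :: "nat \<Rightarrow> nat \<Rightarrow> ('k::field current \<Rightarrow> 'k) \<Rightarrow> int" where
  "height p ell \<chi> = (LEAST i. i \<ge> -1 \<and> (\<forall>x\<in>witt_filt p ell i. \<chi> x = 0))"

definition Lambda :: "nat \<Rightarrow> nat \<Rightarrow> ('k::field current \<Rightarrow> 'k) \<Rightarrow> 'k set" where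
  "Lambda p ell \<chi> = {lam. lam ^ p - lam = \<chi> (witt_e p ell 0 0) ^ p}"

text \<open>The scalars \<open>\<chi>\<^sub>i\<close>, \<open>1 \<le> i \<le> \<ell>\<close>. The value at \<open>0\<close> is never used; it is fixed to be \<open>0\<close> only
  for the sake of uniqueness.\<close>

definition chi_scalars :: "nat \<Rightarrow> nat \<Rightarrow> ('k::field current \<Rightarrow> 'k) \<Rightarrow> nat \<Rightarrow> 'k" where
  "chi_scalars p ell \<chi> = (THE c. c 0 = 0 \<and> (\<forall>m>ell. c m = 0) \<and>
     (\<forall>i\<in>{1..ell}. c i ^ p - c (i * p) = \<chi> (witt_e p ell 0 i) ^ p))"

definition verma_weight :: "nat \<Rightarrow> nat \<Rightarrow> ('k::field current \<Rightarrow> 'k) \<Rightarrow> 'k \<Rightarrow> 'k current \<Rightarrow> 'k" where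
  "verma_weight p ell \<chi> lam x =
     lam * Poly_Mapping.lookup x (0, 0) +
     (\<Sum>i = 1..ell. chi_scalars p ell \<chi> i * Poly_Mapping.lookup x (0, i))"

definition verma ::
  "nat \<Rightarrow> nat \<Rightarrow> ('k::field current \<Rightarrow> 'k current) \<Rightarrow> ('k current \<Rightarrow> 'k) \<Rightarrow> 'k \<Rightarrow>
    (('k, 'k current) red_env, ((('k, 'k current) red_env \<times> 'k) \<Rightarrow>\<^sub>0 int) set) module" where
  "verma p ell pm \<chi> lam =
     tensor_module (red_env_algebra p (witt p ell pm) \<chi>) (red_env_incl p (witt p ell pm) \<chi>)
       (red_env_algebra p (witt0 p ell pm) \<chi>) (one_dim_module (verma_weight p ell \<chi> lam))"

end

theory Submission
  imports Defs "HOL-Computational_Algebra.Formal_Power_Series"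
begin

text \<open>Put \<open>y\<^sub>k = e\<^sub>-\<^sub>1t\<^sup>k\<close> and \<open>l = ell\<close>. As \<open>\<chi>\<close> has height \<open>0\<close>, \<open>\<Lambda>(\<chi>)\<close> is the prime field, and \<open>y\<^sub>l\<close> lowers the
  weight of a highest weight vector by \<open>1\<close> while \<open>y\<^sub>l\<^sup>p = \<chi>(y\<^sub>l)\<^sup>p \<noteq> 0\<close>; so only the weight \<open>0\<close> matters.
  A module generated by a vector \<open>v\<close> of weight \<open>0\<close> is a quotient of \<open>k[y\<^sub>0, \<dots>, y\<^sub>l]/(y\<^sub>k\<^sup>p - \<chi>(y\<^sub>k)\<^sup>p)\<close>, on
  which \<open>e\<^sub>0t\<^sup>i\<close> acts as the derivation \<open>- \<Sum>\<^sub>k y\<^sub>i\<^sub>+\<^sub>k \<partial>\<^sub>k\<close>. In a suitable order, the coefficients form a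
  triangular matrix with the unit \<open>y\<^sub>l\<close> on the diagonal, so a vector killed by all \<open>e\<^sub>0t\<^sup>i\<close> is a multiple
  of \<open>v\<close>. Every nonzero module contains a vector of weight \<open>0\<close>; hence these modules are simple, and
  the annihilators of any two such vectors agree (compare them in the product of the two modules).
  That \<open>U\<^sub>\<chi>(W\<^sub>\<ell>) \<noteq> 0\<close> is seen by letting \<open>W\<^sub>\<ell>\<close> act by vector fields on the \<open>l\<close>-jets of the
  truncated line, twisted by \<open>exp(\<Sum>\<^sub>k \<chi>(y\<^sub>k) x\<^sub>k)\<close>.\<close>

section \<open>Polynomials over a field of characteristic p\<close>

text \<open>Two obstacles shape the proof. The reduced enveloping algebra imposes its relation for
  every x, not only for the basis, and off the basis \<open>pm\<close> is controlled through ad (pm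
  x) = (ad x)^p; so p-th powers are compared for arbitrary x by Leibniz arguments. Moreover no basis
  of the algebra is computed and no dimension is counted: the Verma modules are compared through
  their simplicity, which requires them to be nonzero, and this is traced back to a single nonzero
  module over the algebra. Weight 0 is singled out because all of e_0 t^0, ..., e_0 t^l then kill v,
  one operator for each of y_0, ..., y_l; in any other weight, e_0 t^0 acts on v by a nonzero
  scalar. The triangular shape comes from the truncation: bracketing with e_0 t^(l-k) takes y_k to
  -y_l and y_j to 0 for j > k. Untwisted vector fields realise only the p-character 0. The
  exponential supplies the missing term \<chi>(x)^p, and the formula for its p-th derivative rests
  on the scarcity of additive polynomials over an infinite field.\<close>

lemma alg_closed_infinite: "infinite (UNIV :: 'k::alg_closed_field set)"
proof
  assume fin: "finite (UNIV :: 'k set)"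
  define q :: "'k poly" where "q = (\<Prod>a\<in>UNIV. [:-a, 1:]) + 1"
  have nz: "(\<Prod>a\<in>(UNIV::'k set). [:-a, 1:]) \<noteq> (0 :: 'k poly)"
    using fin by simp
  have deg: "degree (\<Prod>a\<in>(UNIV::'k set). [:-a, 1:]) = card (UNIV :: 'k set)"
    by (subst degree_prod_eq_sum_degree) auto
  have "card (UNIV :: 'k set) > 0"
    using fin by (simp add: card_gt_0_iff)
  hence "degree q > 0"
    unfolding q_def using deg by (subst degree_add_eq_left) auto
  then obtain x where "poly q x = 0"
    using alg_closed_imp_poly_has_root by blast
  moreover have "poly q x = 1"
    using fin by (auto simp: q_def poly_prod)
  ultimately show False by simp
qed

text \<open>Both sides are monic of degree p and vanish at the p distinct elements of the prime
  field, so their difference has more roots than its degree allows.\<close>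

lemma prod_linear_factors_prime_field:
  fixes p :: nat
  assumes "prime p" "CHAR('k::field) = p"
  shows "(\<Prod>i<p. [:- of_nat i, 1:]) = monom (1::'k) p - monom 1 1"
proof -
  let ?P = "(\<Prod>i<p. [:- of_nat i, 1:]) :: 'k poly"
  let ?Q = "monom (1::'k) p - monom 1 1"
  have p1: "p > 1" using assms(1) by (rule prime_gt_1_nat)
  have deg: "degree ?P = p"
    by (subst degree_prod_eq_sum_degree) auto
  have lcP: "coeff ?P p = 1"
    using lead_coeff_prod[of "\<lambda>i. [:- of_nat i, 1:] :: 'k poly" "{..<p}"] deg by simp
  have "degree ?Q \<le> p"
    using p1 by (intro degree_diff_le) (auto intro: order_trans[OF degree_monom_le])
  hence le: "degree (?P - ?Q) \<le> p"
    using deg by (simp add: degree_diff_le)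
  have c0: "coeff (?P - ?Q) p = 0"
    using lcP p1 by simp
  have inj: "inj_on (of_nat :: nat \<Rightarrow> 'k) {..<p}"
  proof (rule inj_onI)
    have *: "a = b" if "a \<le> b" "b < p" "of_nat a = (of_nat b :: 'k)" for a b :: nat
    proof -
      have "of_nat (b - a) = (0::'k)" using that by (simp add: of_nat_diff)
      hence "p dvd b - a" using assms(2) by (simp add: of_nat_eq_0_iff_char_dvd)
      moreover have "b - a < p" using that by linarith
      ultimately have "b - a = 0" using nat_dvd_not_less by blast
      thus ?thesis using that by simp
    qed
    show "a = b" if "a \<in> {..<p}" "b \<in> {..<p}" "of_nat a = (of_nat b :: 'k)" for a b :: nat
      using *[of a b] *[of b a] that by (metis lessThan_iff nat_le_linear)
  qed
  have roots: "poly (?P - ?Q) (of_nat i) = 0" if "i < p" for i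
  proof -
    have "(of_nat i :: 'k) ^ p = of_nat i"
    proof (induction i)
      case 0 show ?case using p1 by (simp add: power_0_left)
    next
      case (Suc i)
      have "((of_nat i :: 'k) + 1) ^ p = of_nat i ^ p + 1 ^ p"
        using assms by (intro freshmans_dream) auto
      thus ?case using Suc by (simp add: add_ac)
    qed
    moreover have "poly ?P (of_nat i) = 0"
      using that by (auto simp: poly_prod)
    ultimately show ?thesis by (simp add: poly_monom)
  qed
  have "?P - ?Q = 0"
  proof (rule ccontr)
    assume nz: "?P - ?Q \<noteq> 0"
    have "degree (?P - ?Q) < p"
      using le c0 nz by (metis leading_coeff_0_iff order_le_less)
    moreover have "of_nat ` {..<p} \<subseteq> {x. poly (?P - ?Q) x = 0}"
      using roots by blast
    hence "card (of_nat ` {..<p} :: 'k set) \<le> card {x. poly (?P - ?Q) x = 0}"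
      by (intro card_mono poly_roots_finite nz)
    moreover have "card (of_nat ` {..<p} :: 'k set) = p"
      using inj by (simp add: card_image)
    moreover have "card {x. poly (?P - ?Q) x = 0} \<le> degree (?P - ?Q)"
      using nz by (rule card_poly_roots_bound)
    ultimately show False by linarith
  qed
  thus ?thesis by simp
qed

lemma frobenius_fixed_imp_of_nat:
  fixes a :: "'k::field"
  assumes "prime p" "CHAR('k) = p" "a ^ p = a"
  obtains m where "m < p" "a = of_nat m"
proof -
  have "(\<Prod>i<p. poly [:- of_nat i, 1:] a) = poly (monom 1 p - monom 1 1) a"
    by (simp only: prod_linear_factors_prime_field[OF assms(1,2), symmetric] poly_prod)
  also have "\<dots> = 0"
    using assms(3) by (simp add: poly_monom)
  finally obtain m where "m < p" "a - of_nat m = 0"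
    by auto
  thus ?thesis using that by simp
qed

lemma linear_power_char:
  fixes a :: "'k::field"
  assumes "prime p" "CHAR('k) = p"
  shows "[:- a, 1:] ^ p = monom 1 p - [:a ^ p:]"
proof -
  have "(monom 1 1 + [:- a:]) ^ p = monom 1 1 ^ p + [:- a:] ^ p"
    by (rule freshmans_dream) (simp_all add: assms)
  moreover have "[:- a, 1:] = monom 1 1 + [:- a:]"
    by (simp add: monom_altdef)
  ultimately have "[:- a, 1:] ^ p = monom 1 1 ^ p + [:- a:] ^ p"
    by simp
  \<comment> \<open>The freshman's dream gives this without a case split on the parity of p.\<close>
  moreover have "(- a) ^ p = - (a ^ p)"
  proof -
    have "(- a + a) ^ p = (- a) ^ p + a ^ p"
      using assms by (intro freshmans_dream) auto
    moreover have "(- a + a) ^ p = 0" 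
      using prime_gt_1_nat[OF assms(1)] by (simp add: power_0_left)
    ultimately show ?thesis by (simp add: eq_neg_iff_add_eq_0)
  qed
  ultimately show ?thesis
    by (simp add: monom_power poly_const_pow)
qed

text \<open>Differentiating q(s + t) = q(s) + q(t) in t at t = 0 gives q'(s) = q'(0) for all s. Over
  an infinite field q' is therefore constant, and its coefficient n c_n at s^(n-1) vanishes.\<close>

lemma additive_poly_coeff:
  fixes q :: "'k::field poly"
  assumes "infinite (UNIV :: 'k set)" "\<And>s t. poly q (s + t) = poly q s + poly q t"
    and "n \<ge> 2" "of_nat n \<noteq> (0::'k)"
  shows "coeff q n = 0"
proof -
  have "poly (pderiv q) s = poly (pderiv q) 0" for s
  proof -
    define r where "r = pcompose q [:s, 1:] - [:poly q s:] - q"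
    have "poly r t = 0" for t
      using assms(2)[of s t] by (simp add: r_def poly_pcompose)
    hence "r = 0"
      using assms(1) poly_roots_finite[of r] by auto
    hence "poly (pderiv r) 0 = 0" by simp
    thus ?thesis
      by (simp add: r_def pderiv_diff pderiv_pcompose poly_pcompose pderiv_pCons)
  qed
  hence "poly (pderiv q - [:poly (pderiv q) 0:]) s = 0" for s
    by simp
  hence "pderiv q - [:poly (pderiv q) 0:] = 0"
    using assms(1) poly_roots_finite[of "pderiv q - [:poly (pderiv q) 0:]"] by fastforce
  hence eq: "pderiv q = [:poly (pderiv q) 0:]"
    by simp
  have "coeff (pderiv q) (n - 1) = coeff [:poly (pderiv q) 0:] (n - 1)"
    by (rule arg_cong[OF eq])
  also have "\<dots> = 0"
    using assms(3) by (simp add: coeff_pCons split: nat.split)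
  finally have "of_nat n * coeff q n = 0"
    using assms(3) by (simp add: coeff_pderiv)
  thus ?thesis using assms(4) by simp
qed

section \<open>The truncated current algebra\<close>

abbreviation "lookup \<equiv> Poly_Mapping.lookup"
abbreviation "keys \<equiv> Poly_Mapping.keys"
abbreviation "single \<equiv> Poly_Mapping.single"

lemma lookup_witt_scale [simp]:
  "lookup (witt_scale c x) i = c * lookup x i"
  by (simp add: witt_scale_def Poly_Mapping.map.rep_eq when_def)

lemma keys_witt_scale: "keys (witt_scale c x) \<subseteq> keys x"
  by (auto simp: in_keys_iff)

lemma witt_scale_simps [simp]:
  "witt_scale 0 x = 0" "witt_scale 1 x = x" "witt_scale c 0 = 0"
  "witt_scale c (witt_scale d x) = witt_scale (c * d) x"
  "witt_scale c (single a d) = single a (c * d)"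
  by (auto intro!: poly_mapping_eqI simp: lookup_single when_def)

lemma current_sum_single:
  "x = (\<Sum>a\<in>keys x. witt_scale (lookup x a) (single a 1))"
  by (rule poly_mapping_eqI)
    (auto simp: lookup_sum lookup_single when_def in_keys_iff)

lemma current_induct [consumes 1, case_names single add]:
  fixes x :: "'k::field current"
  assumes "keys x \<subseteq> A"
    and "\<And>a c. a \<in> A \<Longrightarrow> P (witt_scale c (single a 1))"
    and "\<And>x y. keys x \<subseteq> A \<Longrightarrow> keys y \<subseteq> A \<Longrightarrow> P x \<Longrightarrow> P y \<Longrightarrow> P (x + y)"
    and "P 0"
  shows "P x"
proof -
  have "keys (\<Sum>a\<in>B. witt_scale (lookup x a) (single a 1)) \<subseteq> A \<and>
     P (\<Sum>a\<in>B. witt_scale (lookup x a) (single a 1))"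
    if "finite B" "B \<subseteq> A" for B
    using that
  proof (induction B rule: finite_induct)
    case empty thus ?case using assms(4) by simp
  next
    case (insert a B)
    let ?s = "witt_scale (lookup x a) (single a 1)"
    have "keys ?s \<subseteq> A"
      using insert.prems by (auto simp: in_keys_iff lookup_single when_def split: if_splits)
    moreover have "P ?s"
      using insert.prems by (intro assms(2)) auto
    moreover have IH: "keys (\<Sum>a\<in>B. witt_scale (lookup x a) (single a 1)) \<subseteq> A"
      "P (\<Sum>a\<in>B. witt_scale (lookup x a) (single a 1))"
      using insert.IH insert.prems by auto
    ultimately have "P (?s + (\<Sum>a\<in>B. witt_scale (lookup x a) (single a 1)))"
      and "keys (?s + (\<Sum>a\<in>B. witt_scale (lookup x a) (single a 1))) \<subseteq> A"
      by (blast intro: assms(3), blast dest: subsetD[OF keys_add])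
    thus ?case
      by (simp only: sum.insert[OF insert.hyps])
  qed
  from this[of "keys x"] show ?thesis
    using assms(1) current_sum_single[of x] by simp
qed

lemma lookup_witt_e:
  "lookup (witt_e p ell i k) m = (if m = (i, k) \<and> m \<in> witt_index p ell then 1 else 0)"
  by (auto simp: witt_e_def lookup_single when_def)

lemma witt_e_in: "(i, k) \<in> witt_index p ell \<Longrightarrow> witt_e p ell i k = single (i, k) 1"
  by (simp add: witt_e_def)

lemma keys_witt_e: "keys (witt_e p ell i k :: 'k::field current) \<subseteq> {(i, k)} \<inter> witt_index p ell"
  by (auto simp: in_keys_iff lookup_witt_e split: if_splits)

lemma linear_witt_bracket:
  assumes "f 0 = 0" "\<And>x y. f (x + y) = f x + f y" "\<And>c x. f (witt_scale c x) = c * (f x :: 'k::field)"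
  shows "f (witt_bracket p ell x y) =
    (\<Sum>a\<in>keys x. \<Sum>b\<in>keys y.
       lookup x a * lookup y b * of_int (fst b - fst a) *
       f (witt_e p ell (fst a + fst b) (snd a + snd b)))"
proof -
  have sum: "f (sum g B) = (\<Sum>b\<in>B. f (g b))" for g :: "int \<times> nat \<Rightarrow> 'k current" and B
    by (induction B rule: infinite_finite_induct) (auto simp: assms)
  show ?thesis
    unfolding witt_bracket_def case_prod_beta by (simp add: sum assms(3))
qed

lemma lookup_witt_bracket:
  fixes x y :: "'k::field current"
  shows "lookup (witt_bracket p ell x y) m =
    (\<Sum>a\<in>keys x. \<Sum>b\<in>keys y.
       lookup x a * lookup y b * of_int (fst b - fst a) *
       lookup (witt_e p ell (fst a + fst b) (snd a + snd b)) m)"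
  by (rule linear_witt_bracket[of "\<lambda>z. lookup z m"]) (auto simp: lookup_add)

lemma keys_witt_bracket:
  fixes x y :: "'k::field current"
  shows "keys (witt_bracket p ell x y) \<subseteq> witt_index p ell \<inter>
    {(fst a + fst b, snd a + snd b) | a b. a \<in> keys x \<and> b \<in> keys y}"
proof
  fix m assume "m \<in> keys (witt_bracket p ell x y)"
  hence "lookup (witt_bracket p ell x y) m \<noteq> 0" by (simp add: in_keys_iff)
  then obtain a b where "a \<in> keys x" "b \<in> keys y"
    "lookup (witt_e p ell (fst a + fst b) (snd a + snd b) :: 'k current) m \<noteq> 0"
    unfolding lookup_witt_bracket
    by (auto elim!: sum.not_neutral_contains_not_neutral)
  thus "m \<in> witt_index p ell \<inter>
    {(fst a + fst b, snd a + snd b) | a b. a \<in> keys x \<and> b \<in> keys y}"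
    by (intro IntI CollectI exI[of _ a] exI[of _ b]) (auto simp: lookup_witt_e split: if_splits)
qed

lemma witt_bracket_e:
  assumes "(i, k) \<in> witt_index p ell" "(j, l) \<in> witt_index p ell"
  shows "witt_bracket p ell (witt_e p ell i k) (witt_e p ell j l) =
    witt_scale (of_int (j - i)) (witt_e p ell (i + j) (k + l) :: 'k::field current)"
  using assms by (simp add: witt_bracket_def witt_e_in)

lemma witt_filt_mono: "i \<le> j \<Longrightarrow> witt_filt p ell j \<subseteq> witt_filt p ell i"
  by (auto simp: witt_filt_def)

lemma witt_filt_bracket:
  assumes "x \<in> witt_filt p ell i" "y \<in> witt_filt p ell j"
  shows "witt_bracket p ell x y \<in> witt_filt p ell (i + j)"
proof -
  have "i + j \<le> fst m" if m: "m \<in> keys (witt_bracket p ell x y)" for m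
  proof -
    obtain a b where "a \<in> keys x" "b \<in> keys y" "m = (fst a + fst b, snd a + snd b)"
      using subsetD[OF keys_witt_bracket m] by blast
    moreover from this assms have "i \<le> fst a" "j \<le> fst b"
      by (auto simp: witt_filt_def)
    ultimately show ?thesis by simp
  qed
  thus ?thesis
    using keys_witt_bracket[of p ell x y] by (auto simp: witt_filt_def)
qed

text \<open>For degree reasons only e_0 t^0 and e_1 t^0 contribute, with factor 1 - 0. Thus repeated
  brackets of x with e_1 t^0 record the powers of the e_0-coefficient of x.\<close>

lemma witt_filt_bracket_1_0:
  assumes "p > 3" "x \<in> witt_filt p ell 0" "y \<in> witt_filt p ell 1"
  shows "lookup (witt_bracket p ell x y) (1, 0) =
    lookup x (0, 0) * lookup y (1, 0)"
proof -
  have "lookup x a * lookup y b * of_int (fst b - fst a) *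
       lookup (witt_e p ell (fst a + fst b) (snd a + snd b)) (1, 0) =
     (if b = (1, 0) then if a = (0, 0) then lookup x (0, 0) * lookup y (1, 0) else 0 else 0)"
    if "a \<in> keys x" "b \<in> keys y" for a b
  proof -
    have "fst a \<ge> 0" "fst b \<ge> 1" using that assms by (auto simp: witt_filt_def)
    thus ?thesis using assms(1)
      by (cases a; cases b) (auto simp: lookup_witt_e witt_index_def)
  qed
  hence "lookup (witt_bracket p ell x y) (1, 0) =
    (\<Sum>a\<in>keys x. \<Sum>b\<in>keys y.
     (if b = (1, 0) then if a = (0, 0) then lookup x (0, 0) * lookup y (1, 0) else 0 else 0))"
    unfolding lookup_witt_bracket by simp
  also have "\<dots> = lookup x (0, 0) * lookup y (1, 0)"
    by (cases "lookup y (1, 0) = 0") (auto simp: in_keys_iff)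
  finally show ?thesis .
qed

text \<open>Two nonnegative degrees with sum 0 are both 0, and then the factor j - i vanishes. Hence
  the e_0-coefficient is a character of \<open>witt_filt p ell 0\<close>.\<close>

lemma witt_filt_bracket_0_0:
  assumes "x \<in> witt_filt p ell 0" "y \<in> witt_filt p ell 0"
  shows "lookup (witt_bracket p ell x y) (0, 0) = 0"
  unfolding lookup_witt_bracket
proof (intro sum.neutral ballI)
  fix a b assume "a \<in> keys x" "b \<in> keys y"
  hence "fst a \<ge> 0" "fst b \<ge> 0" using assms by (auto simp: witt_filt_def)
  hence "fst a + fst b = 0 \<Longrightarrow> fst b = fst a" by linarith
  thus "lookup x a * lookup y b * of_int (fst b - fst a) *
       lookup (witt_e p ell (fst a + fst b) (snd a + snd b)) (0, 0) = 0"
    by (auto simp: lookup_witt_e)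
qed

lemma lookup_witt_bracket_e_0_0:
  assumes "p > 3" "keys y \<subseteq> witt_index p ell"
  shows "lookup (witt_bracket p ell y (witt_e p ell 0 0)) m =
    - of_int (fst m) * lookup y m"
proof -
  have 1: "keys (witt_e p ell 0 0) = {(0, 0)}"
    using assms(1) by (auto simp: witt_e_def witt_index_def)
  have "lookup (witt_bracket p ell y (witt_e p ell 0 0)) m =
    (\<Sum>a\<in>keys y. if m = a then - of_int (fst m) * lookup y m else 0)"
    unfolding lookup_witt_bracket 1 using assms
    by (intro sum.cong refl) (auto simp: lookup_witt_e witt_index_def)
  thus ?thesis by (simp add: in_keys_iff)
qed

lemma height_eq_0_imp:
  fixes \<chi> :: "'k::field current \<Rightarrow> 'k"
  assumes "height p ell \<chi> = 0" "\<chi> 0 = 0" "x \<in> witt_filt p ell 0"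
  shows "\<chi> x = 0"
proof -
  define P where "P i \<longleftrightarrow> i \<ge> -1 \<and> (\<forall>x\<in>witt_filt p ell i. \<chi> x = 0)" for i
  \<comment> \<open>At level p the filtration is zero, so some level does satisfy the condition
    defining the height.\<close>
  have "{(j, k) \<in> witt_index p ell. j \<ge> int p} = {}"
    by (auto simp: witt_index_def)
  hence "witt_filt p ell (int p) = ({0} :: 'k current set)"
    unfolding witt_filt_def by (simp only: subset_empty) auto
  hence "P (int p)" using assms(2) by (auto simp: P_def)
  hence ex: "P (int (nat (int p + 1)) - 1)" by (simp add: algebra_simps)
  \<comment> \<open>The integers are not well-ordered; the shift by 1 moves the range i \<ge> -1
    onto the natural numbers.\<close>
  define n where "n = (LEAST n. P (int n - 1))"
  have "P (int n - 1)" unfolding n_def by (rule LeastI[of "\<lambda>n. P (int n - 1)", OF ex])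
  moreover have "int n - 1 \<le> i" if "P i" for i
  proof -
    have "P (int (nat (i + 1)) - 1)" using that by (auto simp: P_def)
    hence "n \<le> nat (i + 1)" unfolding n_def by (rule Least_le)
    thus ?thesis using that by (auto simp: P_def)
  qed
  ultimately have "(LEAST i. P i) = int n - 1" by (rule Least_equality)
  hence "P 0" using assms(1) \<open>P (int n - 1)\<close> by (simp add: height_def P_def)
  thus ?thesis using assms(3) by (simp add: P_def)
qed

text \<open>The equations become c_i^p = c_(ip). As ip > i, the indices run past \<open>ell\<close>,
  where c vanishes, so a downward induction leaves only the zero solution.\<close>

lemma chi_scalars_eq_0:
  assumes "p > 1" "\<And>i. \<chi> (witt_e p ell 0 i) = 0"
  shows "chi_scalars p ell \<chi> = (\<lambda>_. 0)"
  unfolding chi_scalars_def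
proof (rule the_equality)
  show "0 = 0 \<and> (\<forall>m>ell. 0 = 0) \<and> (\<forall>i\<in>{1..ell}. 0 ^ p - 0 = \<chi> (witt_e p ell 0 i) ^ p)"
    using assms by (simp add: power_0_left)
next
  fix c :: "nat \<Rightarrow> 'a"
  assume c: "c 0 = 0 \<and> (\<forall>m>ell. c m = 0) \<and>
     (\<forall>i\<in>{1..ell}. c i ^ p - c (i * p) = \<chi> (witt_e p ell 0 i) ^ p)"
  have "i + d > ell \<Longrightarrow> c i = 0" for d i
  proof (induction d arbitrary: i)
    case 0 thus ?case using c by simp
  next
    case (Suc d)
    show ?case
    proof (cases "i \<in> {1..ell}")
      case True
      hence "i * 2 \<le> i * p" using assms(1) by (intro mult_le_mono) auto
      moreover have "i + Suc d \<le> i * 2 + d" using True by auto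
      ultimately have "i * p + d > ell" using Suc.prems by linarith
      hence "c (i * p) = 0" by (rule Suc.IH)
      hence "c i ^ p = 0" using c True assms by (auto simp: power_0_left)
      thus ?thesis by simp
    next
      case False thus ?thesis using c by (cases "i = 0") auto
    qed
  qed
  from this[of _ "Suc ell"] show "c = (\<lambda>_. 0)" by auto
qed

locale witt_height_0 =
  fixes p ell :: nat
    and \<chi> :: "'k::alg_closed_field current \<Rightarrow> 'k"
    and pm :: "'k current \<Rightarrow> 'k current"
  assumes char: "CHAR('k) = p" and p_gt_3: "p > 3" and ell_ge_1: "ell \<ge> 1"
    and p_map: "is_witt_p_map p ell pm"
    and linear: "linear_form (witt p ell pm) \<chi>"
    and height_0: "height p ell \<chi> = 0"
    and chi_ell: "\<chi> (witt_e p ell (-1) ell) \<noteq> 0"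
begin

abbreviation e :: "int \<Rightarrow> nat \<Rightarrow> 'k current" where "e \<equiv> witt_e p ell"
abbreviation br :: "'k current \<Rightarrow> 'k current \<Rightarrow> 'k current" where "br \<equiv> witt_bracket p ell"
abbreviation W :: "'k current set" where "W \<equiv> witt_filt p ell (-1)"
abbreviation W0 :: "'k current set" where "W0 \<equiv> witt_filt p ell 0"

lemma prime_p: "prime p"
  using char p_gt_3 CHAR_pos_iff prime_CHAR_semidom by (metis gr_implies_not0 not_gr0)

lemma W_eq: "W = {x. keys x \<subseteq> witt_index p ell}"
  by (auto simp: witt_filt_def witt_index_def)

lemma W0_subset: "W0 \<subseteq> W"
  by (rule witt_filt_mono) simp

lemma witt_simps [simp]:
  "lcarrier (witt p ell pm) = W" "lscale (witt p ell pm) = witt_scale"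
  "lbracket (witt p ell pm) = br" "pmap (witt p ell pm) = pm"
  "lcarrier (witt0 p ell pm) = W0" "lscale (witt0 p ell pm) = witt_scale"
  "lbracket (witt0 p ell pm) = br" "pmap (witt0 p ell pm) = pm"
  by (auto simp: witt_def witt0_def W_eq)

lemma filt_closed [simp]:
  "0 \<in> witt_filt p ell i"
  "x \<in> witt_filt p ell i \<Longrightarrow> y \<in> witt_filt p ell i \<Longrightarrow> x + y \<in> witt_filt p ell i"
  "x \<in> witt_filt p ell i \<Longrightarrow> witt_scale c x \<in> witt_filt p ell i"
  unfolding witt_filt_def using keys_add[of x y] keys_witt_scale[of c x] by (simp, blast, blast)

lemma e_in_filt [simp]: "i \<le> j \<Longrightarrow> e j k \<in> witt_filt p ell i"
  unfolding witt_filt_def using keys_witt_e[of p ell j k] by auto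

lemma e_in_W [simp]: "e j k \<in> W"
  unfolding W_eq using keys_witt_e[of p ell j k] by auto

lemma br_in_W [simp]: "br x y \<in> W"
  unfolding W_eq using keys_witt_bracket[of p ell x y] by auto

lemma e_out: "(i, k) \<notin> witt_index p ell \<Longrightarrow> e i k = 0"
  by (simp add: witt_e_def)

lemma chi_add: "x \<in> W \<Longrightarrow> y \<in> W \<Longrightarrow> \<chi> (x + y) = \<chi> x + \<chi> y"
  and chi_scale: "x \<in> W \<Longrightarrow> \<chi> (witt_scale c x) = c * \<chi> x"
  using linear by (auto simp: linear_form_def)

lemma chi_0: "\<chi> 0 = 0"
  using chi_scale[of 0 0] by simp

lemma chi_W0: "x \<in> W0 \<Longrightarrow> \<chi> x = 0"
  using height_eq_0_imp[OF height_0 chi_0] .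

lemma pm_in_W [simp]: "x \<in> W \<Longrightarrow> pm x \<in> W"
  using p_map by (auto simp: is_witt_p_map_def is_p_map_def)

lemma br_pm: "x \<in> W \<Longrightarrow> y \<in> W \<Longrightarrow> br (pm x) y = (br x ^^ p) y"
  using p_map by (auto simp: is_witt_p_map_def is_p_map_def)

lemma pm_e: "(i, k) \<in> witt_index p ell \<Longrightarrow> pm (e i k) = (if i = 0 then e 0 (k * p) else 0)"
  using p_map by (auto simp: is_witt_p_map_def split: if_splits)

text \<open>For a general x the p-map is visible only through ad (pm x) = (ad x)^p. Bracketing with
  e_0 detects the components e_(-1) t^k of \<open>pm x\<close>, and bracketing with e_1 detects its
  e_0-coefficient.\<close>

lemma pm_W0:
  assumes "x \<in> W0"
  shows pm_in_W0: "pm x \<in> W0"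
    and pm_lookup_0_0: "lookup (pm x) (0, 0) = lookup x (0, 0) ^ p"
proof -
  have xW: "x \<in> W" using assms W0_subset by auto
  have iter: "(br x ^^ n) z \<in> W0" if "z \<in> W0" for n z
    using that assms witt_filt_bracket[of x p ell 0 _ 0] by (induction n) auto
  have "br (pm x) (e 0 0) \<in> W0"
    using br_pm[OF xW, of "e 0 0"] iter[of "e 0 0" p] by simp
  hence "lookup (br (pm x) (e 0 0)) (-1, k) = 0" for k
    by (auto simp: witt_filt_def in_keys_iff)
  hence "lookup (pm x) (-1, k) = 0" for k
    using lookup_witt_bracket_e_0_0[OF p_gt_3, of "pm x" ell "(-1, k)"] pm_in_W[OF xW] W_eq by auto
  hence "j \<ge> 0" if "(j, k) \<in> keys (pm x)" for j k
    using that pm_in_W[OF xW] unfolding W_eq witt_index_def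
    by (cases "j = -1") (auto simp: in_keys_iff)
  thus W0: "pm x \<in> W0"
    using pm_in_W[OF xW] unfolding W_eq witt_filt_def by auto
  have iter1: "(br x ^^ n) (e 1 0) \<in> witt_filt p ell 1 \<and>
     lookup ((br x ^^ n) (e 1 0)) (1, 0) = lookup x (0, 0) ^ n" for n
  proof (induction n)
    case 0 thus ?case using p_gt_3 by (simp add: lookup_witt_e witt_index_def)
  next
    case (Suc n)
    thus ?case using assms witt_filt_bracket[of x p ell 0 _ 1] witt_filt_bracket_1_0[OF p_gt_3, of x ell]
      by simp
  qed
  have "lookup (pm x) (0, 0) = lookup (br (pm x) (e 1 0)) (1, 0)"
    using witt_filt_bracket_1_0[OF p_gt_3 W0, of "e 1 0"] p_gt_3
    by (simp add: lookup_witt_e witt_index_def)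
  thus "lookup (pm x) (0, 0) = lookup x (0, 0) ^ p"
    using iter1[of p] br_pm[OF xW, of "e 1 0"] by simp
qed

lemma Lambda_eq: "Lambda p ell \<chi> = {lam. lam ^ p = lam}"
  using chi_W0[of "e 0 0"] p_gt_3 by (simp add: Lambda_def power_0_left)

lemma verma_weight_eq: "verma_weight p ell \<chi> lam x = lam * lookup x (0, 0)"
  using chi_scalars_eq_0[of p \<chi> ell] chi_W0 p_gt_3 by (simp add: verma_weight_def)

end

section \<open>Modules with height-zero p-character\<close>

text \<open>The scalars act through a parameter of their own: on a module over the reduced
  enveloping algebra they act through the classes of constants.\<close>

locale vector_operators = abelian_group M for M :: "('m, 'r) ring_scheme" (structure) +
  fixes sc :: "'k::field \<Rightarrow> 'm \<Rightarrow> 'm"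
  assumes sc_closed [simp]: "w \<in> carrier M \<Longrightarrow> sc a w \<in> carrier M"
    and sc_l_distr: "w \<in> carrier M \<Longrightarrow> sc (a + b) w = sc a w \<oplus> sc b w"
    and sc_r_distr: "w \<in> carrier M \<Longrightarrow> w' \<in> carrier M \<Longrightarrow> sc a (w \<oplus> w') = sc a w \<oplus> sc a w'"
    and sc_sc [simp]: "w \<in> carrier M \<Longrightarrow> sc a (sc b w) = sc (a * b) w"
    and sc_1 [simp]: "w \<in> carrier M \<Longrightarrow> sc 1 w = w"
begin

lemma idem_imp_zero: "w \<in> carrier M \<Longrightarrow> w \<oplus> w = w \<Longrightarrow> w = \<zero>"
  using add.l_cancel_one by blast

lemma sc_0 [simp]: "w \<in> carrier M \<Longrightarrow> sc 0 w = \<zero>"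
  using sc_l_distr[of w 0 0] by (auto intro: idem_imp_zero)

lemma sc_zero [simp]: "sc a \<zero> = \<zero>"
  using sc_r_distr[of \<zero> \<zero> a] by (auto intro: idem_imp_zero)

lemma sc_minus_add [simp]:
  "w \<in> carrier M \<Longrightarrow> sc (- a) w \<oplus> sc a w = \<zero>"
  "w \<in> carrier M \<Longrightarrow> sc a w \<oplus> sc (- a) w = \<zero>"
  by (simp_all flip: sc_l_distr)

lemma add_sc_minus_eq_0_iff:
  assumes "w \<in> carrier M" "w' \<in> carrier M"
  shows "w \<oplus> sc (- a) w' = \<zero> \<longleftrightarrow> w = sc a w'"
proof
  assume "w \<oplus> sc (- a) w' = \<zero>"
  hence "(w \<oplus> sc (- a) w') \<oplus> sc a w' = sc a w'" using assms by simp
  thus "w = sc a w'" using assms by (simp add: a_assoc)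
qed (use assms in simp)

lemma sc_eq_0_iff: "w \<in> carrier M \<Longrightarrow> sc a w = \<zero> \<longleftrightarrow> a = 0 \<or> w = \<zero>"
proof
  assume w: "w \<in> carrier M" "sc a w = \<zero>"
  show "a = 0 \<or> w = \<zero>"
  proof (rule disjCI)
    assume "w \<noteq> \<zero>"
    have "sc (inverse a * a) w = \<zero>" using w by (simp flip: sc_sc)
    thus "a = 0" using w \<open>w \<noteq> \<zero>\<close> by (cases "a = 0") auto
  qed
qed auto

definition lin :: "('m \<Rightarrow> 'm) \<Rightarrow> bool" where
  "lin T \<longleftrightarrow> (\<forall>w\<in>carrier M. T w \<in> carrier M) \<and>
     (\<forall>w\<in>carrier M. \<forall>w'\<in>carrier M. T (w \<oplus> w') = T w \<oplus> T w') \<and>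
     (\<forall>c. \<forall>w\<in>carrier M. T (sc c w) = sc c (T w))"

lemma lin_closed: "lin T \<Longrightarrow> w \<in> carrier M \<Longrightarrow> T w \<in> carrier M"
  and lin_add: "lin T \<Longrightarrow> w \<in> carrier M \<Longrightarrow> w' \<in> carrier M \<Longrightarrow> T (w \<oplus> w') = T w \<oplus> T w'"
  and lin_sc: "lin T \<Longrightarrow> w \<in> carrier M \<Longrightarrow> T (sc c w) = sc c (T w)"
  by (auto simp: lin_def)

lemma lin_zero: "lin T \<Longrightarrow> T \<zero> = \<zero>"
  using lin_add[of T \<zero> \<zero>] lin_closed[of T \<zero>] by (auto intro: idem_imp_zero)

lemma lin_comp: "lin S \<Longrightarrow> lin T \<Longrightarrow> lin (\<lambda>w. S (T w))"
  by (auto simp: lin_def)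

lemma lin_sc_op: "lin T \<Longrightarrow> lin (\<lambda>w. sc c (T w))"
  by (auto simp: lin_def sc_r_distr mult.commute)

lemma lin_add_op:
  assumes "lin S" "lin T"
  shows "lin (\<lambda>w. S w \<oplus> T w)"
  using assms by (auto simp: lin_def sc_r_distr a_ac)

lemma lin_funpow: "lin T \<Longrightarrow> lin (T ^^ n)"
  by (induction n) (auto simp: lin_def)

lemma lin_id: "lin (\<lambda>w. w)"
  by (auto simp: lin_def)

lemma funpow_closed: "lin T \<Longrightarrow> w \<in> carrier M \<Longrightarrow> (T ^^ n) w \<in> carrier M"
  by (rule lin_closed[OF lin_funpow])

lemma funpow_commute:
  assumes "lin S" "\<And>w. w \<in> carrier M \<Longrightarrow> T (S w) = S (T w)" "w \<in> carrier M"
  shows "T ((S ^^ n) w) = (S ^^ n) (T w)"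
  by (induction n) (auto simp: assms funpow_closed)

text \<open>The vector q(T) w in Horner form. It carries the polynomial identities of characteristic
  p over to operators.\<close>

definition ev :: "('m \<Rightarrow> 'm) \<Rightarrow> 'k poly \<Rightarrow> 'm \<Rightarrow> 'm" where
  "ev T q w = fold_coeffs (\<lambda>a r. sc a w \<oplus> T r) q \<zero>"

lemma ev_0 [simp]: "ev T 0 w = \<zero>"
  by (simp add: ev_def)

lemma ev_pCons:
  assumes "lin T" "w \<in> carrier M"
  shows "ev T (pCons a q) w = sc a w \<oplus> T (ev T q w)"
  using assms lin_zero[OF assms(1)]
  by (cases "q = 0"; cases "a = 0")
    (auto simp: ev_def fold_coeffs_pCons_coeff_not_0_eq fold_coeffs_pCons_not_0_0_eq)

lemma ev_closed [simp]: "lin T \<Longrightarrow> w \<in> carrier M \<Longrightarrow> ev T q w \<in> carrier M"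
  by (induction q) (auto simp: ev_pCons lin_closed)

lemma ev_add:
  assumes "lin T" "w \<in> carrier M"
  shows "ev T (q + r) w = ev T q w \<oplus> ev T r w"
proof (induction q r rule: poly_induct2)
  case (pCons a q b r)
  thus ?case
    using assms by (simp add: ev_pCons lin_add lin_closed sc_l_distr a_ac)
qed simp

lemma ev_smult:
  assumes "lin T" "w \<in> carrier M"
  shows "ev T (smult c q) w = sc c (ev T q w)"
  by (induction q) (simp_all add: assms ev_pCons lin_closed lin_sc sc_r_distr)

lemma ev_linear_factor:
  assumes "lin T" "w \<in> carrier M"
  shows "ev T ([:- c, 1:] * q) w = T (ev T q w) \<oplus> sc (- c) (ev T q w)"
proof -
  have "ev T ([:- c, 1:] * q) w = ev T (smult (- c) q + pCons 0 q) w"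
    by simp
  thus ?thesis
    using assms by (simp only: ev_add ev_smult ev_pCons) (simp add: lin_closed a_comm)
qed

lemma ev_monom:
  assumes "lin T" "w \<in> carrier M"
  shows "ev T (monom a n) w = sc a ((T ^^ n) w)"
  by (induction n) (auto simp: assms ev_pCons monom_0 monom_Suc lin_zero lin_closed lin_sc funpow_closed)

lemma shift_funpow:
  assumes "lin T" "w \<in> carrier M"
  shows "((\<lambda>w. T w \<oplus> sc (- a) w) ^^ n) w = ev T ([:- a, 1:] ^ n) w"
proof (induction n)
  case 0
  show ?case using assms lin_zero[OF assms(1)] by (simp add: one_pCons ev_pCons)
next
  case (Suc n)
  thus ?case by (simp only: power_Suc ev_linear_factor[OF assms] funpow.simps o_apply)
qed

text \<open>The falling factorial T(T - 1)...(T - n + 1) applied to w. At n = p it is T^p w - T w;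
  the last nonzero member before a zero is an eigenvector with eigenvalue in the prime
  field.\<close>

fun falling :: "('m \<Rightarrow> 'm) \<Rightarrow> nat \<Rightarrow> 'm \<Rightarrow> 'm" where
  "falling T 0 w = w"
| "falling T (Suc n) w = T (falling T n w) \<oplus> sc (- of_nat n) (falling T n w)"

lemma falling_eq_ev:
  assumes "lin T" "w \<in> carrier M"
  shows "falling T n w = ev T (\<Prod>i<n. [:- of_nat i, 1:]) w"
proof (induction n)
  case 0
  show ?case using assms lin_zero[OF assms(1)] by (simp add: one_pCons ev_pCons)
next
  case (Suc n)
  thus ?case
    by (simp only: prod.lessThan_Suc mult.commute[of _ "[:- of_nat n, 1:]"]
        ev_linear_factor[OF assms] falling.simps)
qed

context
  fixes p :: nat
  assumes prime: "prime p" and CHAR_eq: "CHAR('k) = p"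
begin

lemma shift_funpow_char:
  assumes "lin T" "w \<in> carrier M"
  shows "((\<lambda>w. T w \<oplus> sc (- a) w) ^^ p) w = (T ^^ p) w \<oplus> sc (- (a ^ p)) w"
proof -
  have "[:- a, 1:] ^ p = monom 1 p + [:- (a ^ p):]"
    using linear_power_char[OF prime CHAR_eq, of a] by simp
  thus ?thesis
    using assms lin_zero[OF assms(1)]
    by (simp add: shift_funpow ev_add ev_monom ev_pCons funpow_closed)
qed

lemma falling_char:
  assumes "lin T" "w \<in> carrier M"
  shows "falling T p w = (T ^^ p) w \<oplus> sc (- 1) (T w)"
proof -
  have "(\<Prod>i<p. [:- of_nat i, 1:]) = monom (1 :: 'k) p + monom (- 1) 1"
    using prod_linear_factors_prime_field[OF prime CHAR_eq] by (simp add: minus_monom)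
  thus ?thesis
    using assms by (simp add: falling_eq_ev ev_add ev_monom funpow_closed)
qed

end

end

locale chi_module = witt_height_0 p ell \<chi> pm + vector_operators M sc
  for p ell and \<chi> :: "'k::alg_closed_field current \<Rightarrow> 'k" and pm
    and M :: "('m, 'r) ring_scheme" (structure) and sc :: "'k \<Rightarrow> 'm \<Rightarrow> 'm" +
  fixes act :: "'k current \<Rightarrow> 'm \<Rightarrow> 'm"
  assumes act_lin: "x \<in> W \<Longrightarrow> lin (act x)"
    and act_add: "x \<in> W \<Longrightarrow> y \<in> W \<Longrightarrow> w \<in> carrier M \<Longrightarrow> act (x + y) w = act x w \<oplus> act y w"
    and act_scale: "x \<in> W \<Longrightarrow> w \<in> carrier M \<Longrightarrow> act (witt_scale c x) w = sc c (act x w)"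
    and act_br: "x \<in> W \<Longrightarrow> y \<in> W \<Longrightarrow> w \<in> carrier M \<Longrightarrow>
      act x (act y w) = act y (act x w) \<oplus> act (br x y) w"
    and act_p: "x \<in> W \<Longrightarrow> w \<in> carrier M \<Longrightarrow>
      (act x ^^ p) w = act (pm x) w \<oplus> sc (\<chi> x ^ p) w"
begin

lemma act_closed [simp]: "x \<in> W \<Longrightarrow> w \<in> carrier M \<Longrightarrow> act x w \<in> carrier M"
  by (rule lin_closed[OF act_lin])

lemma act_zero [simp]: "x \<in> W \<Longrightarrow> act x \<zero> = \<zero>"
  by (rule lin_zero[OF act_lin])

lemma act_0 [simp]: "w \<in> carrier M \<Longrightarrow> act 0 w = \<zero>"
  using act_scale[of "e 0 0" w 0] by simp

lemma act_sc: "x \<in> W \<Longrightarrow> w \<in> carrier M \<Longrightarrow> act x (sc c w) = sc c (act x w)"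
  by (rule lin_sc[OF act_lin])

lemma act_e:
  assumes "(i, k) \<in> witt_index p ell" "(j, l) \<in> witt_index p ell" "w \<in> carrier M"
  shows "act (e i k) (act (e j l) w) =
    act (e j l) (act (e i k) w) \<oplus> sc (of_int (j - i)) (act (e (i + j) (k + l)) w)"
  using assms by (subst act_br) (simp_all add: witt_bracket_e act_scale)

definition stable :: "'m set \<Rightarrow> bool" where
  "stable N \<longleftrightarrow> N \<subseteq> carrier M \<and> \<zero> \<in> N \<and> (\<forall>w\<in>N. \<forall>w'\<in>N. w \<oplus> w' \<in> N) \<and>
     (\<forall>c. \<forall>w\<in>N. sc c w \<in> N) \<and> (\<forall>x\<in>W. \<forall>w\<in>N. act x w \<in> N)"

lemma stable_funpow: "stable N \<Longrightarrow> x \<in> W \<Longrightarrow> w \<in> N \<Longrightarrow> (act x ^^ n) w \<in> N"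
  by (induction n) (auto simp: stable_def)

lemma act_in_span:
  assumes "N \<subseteq> carrier M" "\<zero> \<in> N" "\<And>w w'. w \<in> N \<Longrightarrow> w' \<in> N \<Longrightarrow> w \<oplus> w' \<in> N"
    and "\<And>c w. w \<in> N \<Longrightarrow> sc c w \<in> N" "w \<in> carrier M"
    and "\<And>i k. (i, k) \<in> witt_index p ell \<Longrightarrow> act (e i k) w \<in> N" "x \<in> W"
  shows "act x w \<in> N"
proof -
  have "x \<in> W \<and> act x w \<in> N" if "keys x \<subseteq> witt_index p ell" for x
    using that
  proof (induction x rule: current_induct)
    case (single a c)
    then obtain i k where a: "a = (i, k)" "(i, k) \<in> witt_index p ell" by (cases a) auto
    have "single a 1 = e i k" using a by (simp add: witt_e_in)
    thus ?case using assms(4,5) assms(6)[OF a(2)] by (simp add: act_scale del: witt_scale_simps)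
  next
    case (add x y)
    thus ?case using assms(3,5) by (simp add: act_add)
  qed (use assms(2,5) in simp)
  thus ?thesis using assms by (auto simp: W_eq)
qed

definition weight_vector :: "'k \<Rightarrow> 'm \<Rightarrow> bool" where
  "weight_vector lam v \<longleftrightarrow> v \<in> carrier M \<and>
     (\<forall>x\<in>W0. act x v = sc (lam * lookup x (0, 0)) v)"

lemma weight_vectorI:
  assumes "v \<in> carrier M"
    and "\<And>i k. (i, k) \<in> witt_index p ell \<Longrightarrow> i \<ge> 0 \<Longrightarrow> (i, k) \<noteq> (0, 0) \<Longrightarrow> act (e i k) v = \<zero>"
    and "act (e 0 0) v = sc lam v"
  shows "weight_vector lam v"
proof -
  have "x \<in> W0 \<and> act x v = sc (lam * lookup x (0, 0)) v"
    if "keys x \<subseteq> {(j, k) \<in> witt_index p ell. j \<ge> 0}" for x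
    using that
  proof (induction x rule: current_induct)
    case (single a c)
    then obtain i k where a: "a = (i, k)" "(i, k) \<in> witt_index p ell" "i \<ge> 0" by (cases a) auto
    hence "act (witt_scale c (e i k)) v = sc c (act (e i k) v)"
      using assms by (simp add: act_scale)
    also have "\<dots> = sc (lam * lookup (witt_scale c (e i k)) (0, 0)) v"
      using assms a by (cases "(i, k) = (0, 0)") (auto simp: lookup_witt_e mult.commute)
    finally have "act (witt_scale c (e i k)) v = sc (lam * lookup (witt_scale c (e i k)) (0, 0)) v" .
    moreover have "single a 1 = e i k" using a by (simp add: witt_e_in)
    ultimately show ?case using a(3) by (simp del: witt_scale_simps lookup_witt_scale)
  next
    case (add x y)
    moreover from this have "x \<in> W" "y \<in> W" using W0_subset by auto
    ultimately show ?case using assms(1)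
      by (simp add: act_add lookup_add ring_distribs sc_l_distr)
  qed (use assms(1) in simp)
  thus ?thesis using assms unfolding weight_vector_def witt_filt_def by blast
qed

lemma weight_vector_e:
  assumes "weight_vector lam v"
  shows "(i, k) \<noteq> (0, 0) \<Longrightarrow> i \<ge> 0 \<Longrightarrow> act (e i k) v = \<zero>"
    and "act (e 0 0) v = sc lam v"
proof -
  show "act (e i k) v = \<zero>" if "(i, k) \<noteq> (0, 0)" "i \<ge> 0"
  proof -
    have "lookup (e i k) (0, 0) = 0" using that by (auto simp: lookup_witt_e)
    thus ?thesis using assms e_in_filt[OF that(2)] by (auto simp: weight_vector_def)
  qed
  have "lookup (e 0 0) (0, 0) = 1"
    using p_gt_3 by (simp add: lookup_witt_e witt_index_def)
  thus "act (e 0 0) v = sc lam v"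
    using assms e_in_filt[of 0 0 0] by (auto simp: weight_vector_def)
qed

lemma index_ell: "(-1, k) \<in> witt_index p ell \<longleftrightarrow> k \<le> ell" "(0, k) \<in> witt_index p ell \<longleftrightarrow> k \<le> ell"
  using p_gt_3 by (auto simp: witt_index_def)

text \<open>The bracket of e_i t^k with y_l is a multiple of e_(i-1) t^(k+l). It is truncated away
  for k > 0. For k = 0 < i it kills v, since l \<ge> 1 keeps it away from e_0 t^0. For i = k = 0 it
  is -y_l, which lowers the weight by 1.\<close>

lemma weight_vector_shift:
  assumes "weight_vector lam v"
  shows "weight_vector (lam - 1) (act (e (-1) ell) v)"
proof (rule weight_vectorI)
  have v: "v \<in> carrier M" using assms by (simp add: weight_vector_def)
  show "act (e (-1) ell) v \<in> carrier M" using v by simp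
  show "act (e i k) (act (e (-1) ell) v) = \<zero>"
    if ik: "(i, k) \<in> witt_index p ell" "i \<ge> 0" "(i, k) \<noteq> (0, 0)" for i k
  proof -
    have "act (e (i - 1) (k + ell)) v = \<zero>"
    proof (cases "k = 0")
      case True
      thus ?thesis using ik ell_ge_1 by (intro weight_vector_e(1)[OF assms]) auto
    next
      case False
      hence "e (i - 1) (k + ell) = 0" by (intro e_out) (auto simp: witt_index_def)
      thus ?thesis using v by simp
    qed
    thus ?thesis
      using ik v act_e[of i k "-1" ell v] weight_vector_e(1)[OF assms, of i k] by (simp add: index_ell)
  qed
  have "act (e 0 0) (act (e (-1) ell) v) = sc lam (act (e (-1) ell) v) \<oplus> sc (-1) (act (e (-1) ell) v)"
    using v act_e[of 0 0 "-1" ell v] weight_vector_e(2)[OF assms] by (simp add: index_ell act_sc)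
  also have "\<dots> = sc (lam - 1) (act (e (-1) ell) v)"
    using v by (simp flip: sc_l_distr)
  finally show "act (e 0 0) (act (e (-1) ell) v) = sc (lam - 1) (act (e (-1) ell) v)" .
qed

lemma funpow_e_minus_1:
  assumes "k \<le> ell" "w \<in> carrier M"
  shows "(act (e (-1) k) ^^ p) w = sc (\<chi> (e (-1) k) ^ p) w"
  using assms act_p[of "e (-1) k" w] pm_e[of "-1" k] by (simp add: index_ell)

text \<open>Nothing is lost when lowering: the p-th power of y_l is a nonzero scalar, so y_l acts
  injectively.\<close>

lemma weight_vector_funpow:
  assumes "weight_vector lam v" "v \<noteq> \<zero>"
  shows "weight_vector (lam - of_nat n) ((act (e (-1) ell) ^^ n) v)"
    and "(act (e (-1) ell) ^^ n) v \<noteq> \<zero>"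
proof -
  have v: "v \<in> carrier M" using assms by (simp add: weight_vector_def)
  show "weight_vector (lam - of_nat n) ((act (e (-1) ell) ^^ n) v)"
  proof (induction n)
    case (Suc n)
    from weight_vector_shift[OF this] show ?case by (simp add: algebra_simps)
  qed (use assms in simp)
  let ?E = "act (e (-1) ell)"
  have inj: "?E w \<noteq> \<zero>" if "w \<in> carrier M" "w \<noteq> \<zero>" for w
  proof
    assume "?E w = \<zero>"
    moreover obtain m where "p = Suc m" using p_gt_3 by (cases p) auto
    ultimately have "(?E ^^ p) w = (?E ^^ m) \<zero>" by (simp add: funpow_swap1)
    also have "\<dots> = \<zero>" by (rule lin_zero[OF lin_funpow[OF act_lin]]) simp
    finally show False
      using funpow_e_minus_1[of ell w] that chi_ell by (simp add: sc_eq_0_iff)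
  qed
  show "(?E ^^ n) v \<noteq> \<zero>"
    using v assms(2) by (induction n) (auto simp: inj funpow_closed act_lin)
qed

subsection \<open>Existence of highest weight vectors\<close>

text \<open>If \<open>e i k\<close>, for \<open>i \<ge> 0\<close>, has the number \<open>i * Suc ell + k\<close>, then the elements with numbers \<open>\<ge> n\<close> span
  an ideal of \<open>W0\<close>; so the elements other than \<open>e 0 0\<close> can be killed one after the other.\<close>

definition killed_from :: "nat \<Rightarrow> 'm \<Rightarrow> bool" where
  "killed_from n s \<longleftrightarrow> s \<in> carrier M \<and>
     (\<forall>i k. (i, k) \<in> witt_index p ell \<longrightarrow> i \<ge> 0 \<longrightarrow> n \<le> nat i * Suc ell + k \<longrightarrow> act (e i k) s = \<zero>)"

lemma killed_from_act:
  assumes "killed_from n s" "(i, k) \<in> witt_index p ell" "i \<ge> 0"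
  shows "killed_from n (act (e i k) s)"
  unfolding killed_from_def
proof (intro conjI allI impI)
  have s: "s \<in> carrier M" using assms(1) by (simp add: killed_from_def)
  thus "act (e i k) s \<in> carrier M" by simp
  fix j l assume jl: "(j, l) \<in> witt_index p ell" "j \<ge> 0" "n \<le> nat j * Suc ell + l"
  have "act (e (j + i) (l + k)) s = \<zero>"
  proof (cases "(j + i, l + k) \<in> witt_index p ell")
    case True
    have "nat j * Suc ell + l \<le> nat (j + i) * Suc ell + (l + k)"
      using assms jl by (intro add_mono mult_le_mono) auto
    thus ?thesis using True jl assms by (auto simp: killed_from_def)
  next
    case False
    thus ?thesis using s by (simp add: e_out)
  qed
  moreover have "act (e j l) s = \<zero>" using assms(1) jl by (auto simp: killed_from_def)
  ultimately show "act (e j l) (act (e i k) s) = \<zero>"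
    using act_e[OF jl(1) assms(2) s] by simp
qed

text \<open>The element with number n is nilpotent on s: \<chi> vanishes on \<open>W0\<close>, so
  its p-th power acts as its p-map, which is 0 or some e_0 t^(kp) with kp > k and hence already
  kills s. The last nonzero vector s' = b^m' s is killed by b too. The bound n \<ge> 1 leaves out
  e_0 t^0, which need not be nilpotent.\<close>

lemma killed_from_step:
  assumes N: "stable N" and s: "s \<in> N" "s \<noteq> \<zero>" "killed_from (Suc n) s"
    and n: "n \<ge> 1" "n < (p - 1) * Suc ell"
  shows "\<exists>s\<in>N. s \<noteq> \<zero> \<and> killed_from n s"
proof -
  define i where "i = int (n div Suc ell)"
  define k where "k = n mod Suc ell"
  have nik: "n = nat i * Suc ell + k" by (simp add: i_def k_def del: mult_Suc_right)
  have "n div Suc ell < p - 1" using n(2) by (simp add: less_mult_imp_div_less)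
  moreover have "k \<le> ell" using mod_less_divisor[of "Suc ell" n] by (simp add: k_def)
  ultimately have ik: "(i, k) \<in> witt_index p ell" "i \<ge> 0"
    by (auto simp: witt_index_def i_def)
  have sM: "s \<in> carrier M" using N s by (auto simp: stable_def)
  let ?b = "act (e i k)"
  have "act (pm (e i k)) s = \<zero>"
  proof (cases "i = 0 \<and> (0, k * p) \<in> witt_index p ell")
    case True
    hence "k \<ge> 1" using n(1) nik by simp
    have "k * 2 \<le> k * p" using p_gt_3 by (intro mult_le_mono) auto
    hence "Suc k \<le> k * p" using \<open>k \<ge> 1\<close> by linarith
    hence "Suc n \<le> k * p" using nik True by simp
    thus ?thesis using True ik s(3) pm_e[OF ik(1)] by (simp add: killed_from_def)
  next
    case False
    thus ?thesis using sM pm_e[OF ik(1)] by (auto simp: e_out)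
  qed
  hence "(?b ^^ p) s = \<zero>"
    using act_p[of "e i k" s] sM chi_W0[of "e i k"] ik p_gt_3 by (simp add: power_0_left)
  hence ex: "\<exists>m. (?b ^^ m) s = \<zero>" by blast
  define m where "m = (LEAST m. (?b ^^ m) s = \<zero>)"
  have m: "(?b ^^ m) s = \<zero>" unfolding m_def by (rule LeastI_ex[OF ex])
  hence "m \<noteq> 0" using s(2) by (cases m) auto
  then obtain m' where m': "m = Suc m'" by (cases m) auto
  define s' where "s' = (?b ^^ m') s"
  have s': "s' \<noteq> \<zero>" "s' \<in> N" "?b s' = \<zero>"
    using not_less_Least[of m' "\<lambda>m. (?b ^^ m) s = \<zero>"] m m' stable_funpow[OF N _ s(1)]
    by (auto simp: s'_def m_def)
  have "killed_from (Suc n) ((?b ^^ j) s)" for j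
    by (induction j) (auto simp: s killed_from_act ik)
  hence kill: "killed_from (Suc n) s'" by (simp add: s'_def)
  have "act (e j l) s' = \<zero>" if jl: "(j, l) \<in> witt_index p ell" "j \<ge> 0" "n \<le> nat j * Suc ell + l" for j l
  proof (cases "n = nat j * Suc ell + l")
    case True
    have "l < Suc ell" using jl by (auto simp: witt_index_def)
    hence "n div Suc ell = nat j" "n mod Suc ell = l"
      unfolding True by (simp_all add: div_mult_self1 del: mult_Suc_right)
    hence "i = j" "k = l" using jl by (auto simp: i_def k_def)
    thus ?thesis using s' by simp
  next
    case False
    thus ?thesis using kill jl by (auto simp: killed_from_def)
  qed
  hence "killed_from n s'" using kill by (auto simp: killed_from_def)
  thus ?thesis using s' by blast
qed

lemma ex_killed_from_1:
  assumes N: "stable N" and s: "s \<in> N" "s \<noteq> \<zero>"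
  shows "\<exists>s\<in>N. s \<noteq> \<zero> \<and> killed_from 1 s"
proof -
  \<comment> \<open>The largest number is (p - 2) * Suc ell + ell = T - 1, so being killed from T on
    is no condition.\<close>
  define T where "T = (p - 1) * Suc ell"
  have T1: "T \<ge> 1" using p_gt_3 by (simp add: T_def)
  have "\<exists>s\<in>N. s \<noteq> \<zero> \<and> killed_from (T - d) s" if "d < T" for d
    using that
  proof (induction d)
    case 0
    have "False" if "(i, k) \<in> witt_index p ell" "i \<ge> 0" "T \<le> nat i * Suc ell + k" for i k
    proof -
      have "Suc (nat i) \<le> p - 1" "k < Suc ell" using that by (auto simp: witt_index_def)
      hence "Suc (nat i) * Suc ell \<le> T" "k < Suc ell"
        unfolding T_def by (auto intro: mult_le_mono1 simp del: mult_Suc mult_Suc_right)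
      thus False using that by simp
    qed
    hence "killed_from T s"
      using N s by (auto simp: killed_from_def stable_def)
    thus ?case using s by auto
  next
    case (Suc d)
    then obtain s where s: "s \<in> N" "s \<noteq> \<zero>" "killed_from (T - d) s" by auto
    have "Suc (T - Suc d) = T - d" using Suc.prems by linarith
    hence "killed_from (Suc (T - Suc d)) s" using s(3) by simp
    moreover have "1 \<le> T - Suc d" using Suc.prems by linarith
    moreover have "T - Suc d < (p - 1) * Suc ell" unfolding T_def[symmetric] using T1 by linarith
    ultimately show ?case by (rule killed_from_step[OF N s(1,2)])
  qed
  from this[of "T - 1"] show ?thesis using T1 by simp
qed

text \<open>Once everything in \<open>W0\<close> except e_0 is killed, h = e_0 satisfies h^p = h on
  s, so the falling factorials in h end in an eigenvector whose eigenvalue is some natural number j.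
  Applying y_l exactly j times lowers this weight to 0.\<close>

lemma ex_highest_weight_vector:
  assumes N: "stable N" and "s \<in> N" "s \<noteq> \<zero>"
  obtains v where "v \<in> N" "v \<noteq> \<zero>" "weight_vector 0 v"
proof -
  from ex_killed_from_1[OF assms] obtain s where s: "s \<in> N" "s \<noteq> \<zero>" "killed_from 1 s" by blast
  have sM: "s \<in> carrier M" using N s by (auto simp: stable_def)
  let ?h = "act (e 0 0)"
  have h: "lin ?h" by (simp add: act_lin)
  have "pm (e 0 0) = e 0 0" using pm_e[of 0 0] by (simp add: index_ell)
  hence "(?h ^^ p) s = ?h s"
    using act_p[of "e 0 0" s] sM chi_W0[of "e 0 0"] p_gt_3 by (simp add: power_0_left)
  hence "falling ?h p s = \<zero>"
    using falling_char[OF prime_p char h sM] sc_minus_add(2)[of "?h s" 1] sM by simp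
  hence ex: "\<exists>m. falling ?h m s = \<zero>" by blast
  define m where "m = (LEAST m. falling ?h m s = \<zero>)"
  have m: "falling ?h m s = \<zero>" unfolding m_def by (rule LeastI_ex[OF ex])
  hence "m \<noteq> 0" using s(2) by (cases m) auto
  then obtain j where j: "m = Suc j" by (cases m) auto
  define v where "v = falling ?h j s"
  have inN: "falling ?h n s \<in> N \<and> killed_from 1 (falling ?h n s)" for n
  proof (induction n)
    case (Suc n)
    let ?f = "falling ?h n s"
    have 1: "killed_from 1 (?h ?f)" using Suc by (intro killed_from_act) (auto simp: index_ell)
    have fM: "?f \<in> carrier M" using Suc by (auto simp: killed_from_def)
    have "act (e i k) (?h ?f \<oplus> sc (- of_nat n) ?f) = \<zero>"
      if "(i, k) \<in> witt_index p ell" "i \<ge> 0" "1 \<le> nat i * Suc ell + k" for i k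
    proof -
      have "act (e i k) (?h ?f) = \<zero>" "act (e i k) ?f = \<zero>"
        using that 1 Suc unfolding killed_from_def by blast+
      thus ?thesis using fM by (simp add: lin_add[OF act_lin] act_sc)
    qed
    thus ?case using Suc N fM by (auto simp: stable_def killed_from_def)
  qed (use s in simp)
  have v: "v \<noteq> \<zero>" "v \<in> N" "killed_from 1 v"
    using inN[of j] not_less_Least[of j "\<lambda>m. falling ?h m s = \<zero>"] j by (auto simp: v_def m_def)
  have vM: "v \<in> carrier M" using v by (simp add: killed_from_def)
  have "?h v \<oplus> sc (- of_nat j) v = \<zero>" using m j by (simp add: v_def)
  hence hv: "?h v = sc (of_nat j) v" using vM by (simp add: add_sc_minus_eq_0_iff)
  have "weight_vector (of_nat j) v"
  proof (rule weight_vectorI[OF vM _ hv])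
    fix i k assume "(i, k) \<in> witt_index p ell" "i \<ge> 0" "(i, k) \<noteq> (0, 0)"
    moreover from this have "1 \<le> nat i * Suc ell + k" by (cases "i = 0") auto
    ultimately show "act (e i k) v = \<zero>" using v(3) by (auto simp: killed_from_def)
  qed
  from weight_vector_funpow[OF this v(1), of j] stable_funpow[OF N _ v(2)] show thesis
    by (intro that) auto
qed

end

context chi_module
begin

subsection \<open>Highest weight vectors in a highest weight module\<close>

abbreviation Y :: "nat \<Rightarrow> 'm \<Rightarrow> 'm" where "Y k \<equiv> act (e (-1) k)"

text \<open>This is k[y_k, ..., y_l] v. The chain descends in k and ends, at k =
  \<open>Suc ell\<close>, with the multiples of v.\<close>

inductive_set yspan :: "'m \<Rightarrow> nat \<Rightarrow> 'm set" for v k where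
  scalar: "sc c v \<in> yspan v k"
| Y: "k \<le> j \<Longrightarrow> j \<le> ell \<Longrightarrow> f \<in> yspan v k \<Longrightarrow> Y j f \<in> yspan v k"
| add: "f \<in> yspan v k \<Longrightarrow> g \<in> yspan v k \<Longrightarrow> f \<oplus> g \<in> yspan v k"

lemma yspan_closed:
  assumes "v \<in> carrier M" "f \<in> yspan v k"
  shows "f \<in> carrier M"
  using assms(2) by induction (use assms(1) in auto)

lemma yspan_sc:
  assumes "v \<in> carrier M" "f \<in> yspan v k"
  shows "sc c f \<in> yspan v k"
  using assms(2)
proof (induction f rule: yspan.induct)
  case (scalar d)
  thus ?case using assms yspan.scalar[of "c * d" v k] by simp
next
  case (Y j f)
  thus ?case using yspan.Y[of k j "sc c f" v] yspan_closed[OF assms(1) Y(3)] by (simp add: act_sc)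
next
  case (add f g)
  thus ?case using yspan.add[of "sc c f" v k "sc c g"] yspan_closed[OF assms(1)] by (simp add: sc_r_distr)
qed

lemma zero_in_yspan: "v \<in> carrier M \<Longrightarrow> \<zero> \<in> yspan v k"
  using yspan.scalar[of 0 v k] by simp

text \<open>Moving e_i t^k past y_j costs a multiple of e_(i-1) t^(k+j), so the induction must treat
  all basis elements at once. At the end \<open>W0\<close> acts on v by scalars.\<close>

lemma stable_yspan:
  assumes v: "weight_vector lam v"
  shows "stable (yspan v 0)"
proof -
  have vM: "v \<in> carrier M" using v by (simp add: weight_vector_def)
  note closed = yspan_closed[OF vM]
  have "\<forall>i k. (i, k) \<in> witt_index p ell \<longrightarrow> act (e i k) f \<in> yspan v 0" if "f \<in> yspan v 0" for f
    using that
  proof (induction f rule: yspan.induct)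
    case (scalar c)
    show ?case
    proof (intro allI impI)
      fix i k assume ik: "(i, k) \<in> witt_index p ell"
      hence "i = -1 \<or> i \<ge> 0" by (auto simp: witt_index_def)
      thus "act (e i k) (sc c v) \<in> yspan v 0"
      proof
        assume "i = -1"
        thus ?thesis using ik yspan.Y[of 0 k "sc c v" v] by (auto simp: index_ell intro: yspan.scalar)
      next
        assume "i \<ge> 0"
        hence "act (e i k) (sc c v) = sc (c * (lam * lookup (e i k) (0, 0))) v"
          using v by (simp add: act_sc weight_vector_def)
        thus ?thesis by (simp only: yspan.scalar)
      qed
    qed
  next
    case (Y j f)
    show ?case
    proof (intro allI impI)
      fix i k assume ik: "(i, k) \<in> witt_index p ell"
      have "act (e (i - 1) (k + j)) f \<in> yspan v 0"
        using Y.IH zero_in_yspan[OF vM] closed[OF Y(3)]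
        by (cases "(i - 1, k + j) \<in> witt_index p ell") (auto simp: e_out)
      hence "sc (of_int (- 1 - i)) (act (e (i + - 1) (k + j)) f) \<in> yspan v 0"
        by (intro yspan_sc vM) simp
      moreover have "Y j (act (e i k) f) \<in> yspan v 0"
        using Y ik by (intro yspan.Y) auto
      ultimately show "act (e i k) (Y j f) \<in> yspan v 0"
        using act_e[OF ik, of "-1" j f] Y(2) closed[OF Y(3)] by (simp add: index_ell yspan.add)
    qed
  next
    case (add f g)
    thus ?case using closed[OF add(1)] closed[OF add(2)] by (simp add: lin_add[OF act_lin] yspan.add)
  qed
  hence "act x f \<in> yspan v 0" if "f \<in> yspan v 0" "x \<in> W" for x f
    using that subsetI[OF closed] closed[OF that(1)] zero_in_yspan[OF vM] yspan_sc[OF vM]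
    by - (rule act_in_span, simp_all add: yspan.add)
  thus ?thesis
    using subsetI[OF closed] zero_in_yspan[OF vM] yspan_sc[OF vM] by (simp add: stable_def yspan.add)
qed

section \<open>Partial derivatives and the elimination of variables\<close>

abbreviation c_ell :: 'k where "c_ell \<equiv> \<chi> (e (-1) ell) ^ p"

text \<open>In the polynomial model, \<open>dop k\<close> acts on \<open>yspan v k\<close> as the derivative by the \<open>k\<close>-th
  variable; the factor in front of \<open>e 0 (ell - k)\<close> is the inverse of \<open>- Y ell\<close>.\<close>

definition dop :: "nat \<Rightarrow> 'm \<Rightarrow> 'm" where
  "dop k w = sc (- (1 / c_ell)) ((Y ell ^^ (p - 1)) (act (e 0 (ell - k)) w))"

text \<open>The variable recentred at \<chi>(y_k), which makes it nilpotent: its p-th power is y_k^p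
  - \<chi>(y_k)^p = 0.\<close>

definition zop :: "nat \<Rightarrow> 'm \<Rightarrow> 'm" where
  "zop k w = Y k w \<oplus> sc (- \<chi> (e (-1) k)) w"

lemma lin_dop: "lin (dop k)"
  unfolding dop_def by (intro lin_sc_op lin_comp[OF lin_funpow] act_lin) auto

lemma lin_zop: "lin (zop k)"
  unfolding zop_def by (intro lin_add_op act_lin lin_sc_op lin_id) auto

lemma Y_commute:
  assumes "j \<le> ell" "k \<le> ell" "w \<in> carrier M"
  shows "Y j (Y k w) = Y k (Y j w)"
  using act_e[of "-1" j "-1" k w] assms by (simp add: index_ell)

lemma zop_Y:
  assumes "j \<le> ell" "k \<le> ell" "w \<in> carrier M"
  shows "zop k (Y j w) = Y j (zop k w)"
  using assms Y_commute[of k j w] by (simp add: zop_def lin_add[OF act_lin] act_sc)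

text \<open>The triangularity: the commutator of e_0 t^(l-k) and y_j is a multiple of e_(-1)
  t^(l-k+j), which is truncated for j > k.\<close>

lemma dop_Y_gt:
  assumes "k < j" "j \<le> ell" "w \<in> carrier M"
  shows "dop k (Y j w) = Y j (dop k w)"
proof -
  have "e (-1) (ell - k + j) = 0" using assms by (intro e_out) (auto simp: witt_index_def)
  hence "act (e 0 (ell - k)) (Y j w) = Y j (act (e 0 (ell - k)) w)"
    using act_e[of 0 "ell - k" "-1" j w] assms by (simp add: index_ell)
  moreover have "Y j ((Y ell ^^ (p - 1)) w') = (Y ell ^^ (p - 1)) (Y j w')" if "w' \<in> carrier M" for w'
    using that assms by (intro funpow_commute act_lin Y_commute) auto
  ultimately show ?thesis
    using assms by (simp add: dop_def act_sc funpow_closed act_lin)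
qed

lemma dop_Y_same:
  assumes "k \<le> ell" "w \<in> carrier M"
  shows "dop k (Y k w) = Y k (dop k w) \<oplus> w"
proof -
  define P where "P = Y ell ^^ (p - 1)"
  have P: "lin P" unfolding P_def by (intro lin_funpow act_lin) simp
  have "act (e 0 (ell - k)) (Y k w) = Y k (act (e 0 (ell - k)) w) \<oplus> sc (-1) (Y ell w)"
    using act_e[of 0 "ell - k" "-1" k w] assms by (simp add: index_ell)
  moreover have "P (Y k w') = Y k (P w')" if "w' \<in> carrier M" for w'
    unfolding P_def using that assms by (intro funpow_commute[symmetric] act_lin Y_commute) auto
  moreover have "P (Y ell w) = sc c_ell w"
  proof -
    have "P (Y ell w) = (Y ell ^^ Suc (p - 1)) w" by (simp only: P_def funpow_Suc_right o_apply)
    also have "Suc (p - 1) = p" using p_gt_3 by simp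
    finally show ?thesis using funpow_e_minus_1[of ell w] assms by simp
  qed
  ultimately show ?thesis
    using assms chi_ell
    by (simp only: dop_def flip: P_def) (simp add: lin_add[OF P] lin_sc[OF P] lin_closed[OF P] act_sc sc_r_distr)
qed

lemma dop_zop:
  assumes "k \<le> ell" "w \<in> carrier M"
  shows "dop k (zop k w) = zop k (dop k w) \<oplus> w"
  using assms lin_closed[OF lin_dop, of w k]
  by (simp add: zop_def lin_add[OF lin_dop] lin_sc[OF lin_dop] dop_Y_same a_ac)

lemma zop_funpow_p:
  assumes "k \<le> ell" "w \<in> carrier M"
  shows "(zop k ^^ p) w = \<zero>"
proof -
  have "zop k = (\<lambda>w. Y k w \<oplus> sc (- \<chi> (e (-1) k)) w)" by (rule ext) (simp add: zop_def)
  thus ?thesis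
    using assms shift_funpow_char[OF prime_p char act_lin[of "e (-1) k"], of w "\<chi> (e (-1) k)"]
      funpow_e_minus_1[of k w] by simp
qed

text \<open>Up to the factor (p - 1)!, this takes the constant term in z_k = \<open>zop k\<close>:
  multiplication by z_k^(p-1) kills every other term, and differentiating p - 1 times removes that
  factor again.\<close>

definition proj :: "nat \<Rightarrow> 'm \<Rightarrow> 'm" where
  "proj k w = (dop k ^^ (p - 1)) ((zop k ^^ (p - 1)) w)"

lemma lin_proj: "lin (proj k)"
  unfolding proj_def by (intro lin_comp[OF lin_funpow lin_funpow] lin_dop lin_zop)

lemma proj_zop:
  assumes "k \<le> ell" "w \<in> carrier M"
  shows "proj k (zop k w) = \<zero>"
proof -
  have "(zop k ^^ (p - 1)) (zop k w) = (zop k ^^ Suc (p - 1)) w"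
    by (simp only: funpow_Suc_right o_apply)
  also have "Suc (p - 1) = p" using p_gt_3 by simp
  finally show ?thesis
    using zop_funpow_p[OF assms] by (simp add: proj_def lin_zero[OF lin_funpow[OF lin_dop]])
qed

lemma proj_Y:
  assumes "k < j" "j \<le> ell" "w \<in> carrier M"
  shows "proj k (Y j w) = Y j (proj k w)"
proof -
  have "Y j ((dop k ^^ (p - 1)) w') = (dop k ^^ (p - 1)) (Y j w')" if "w' \<in> carrier M" for w'
    using that assms by (intro funpow_commute lin_dop dop_Y_gt[symmetric])
  moreover have "Y j ((zop k ^^ (p - 1)) w) = (zop k ^^ (p - 1)) (Y j w)"
    using assms by (intro funpow_commute lin_zop zop_Y[symmetric]) auto
  ultimately show ?thesis using assms by (simp add: proj_def funpow_closed lin_zop)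
qed

text \<open>The Weyl relation between \<open>dop k\<close> and \<open>zop k\<close> makes the former
  differentiate powers of the latter.\<close>

lemma dop_zop_funpow:
  assumes "k \<le> ell" "w \<in> carrier M" "dop k w = \<zero>"
  shows "dop k ((zop k ^^ Suc n) w) = sc (of_nat (Suc n)) ((zop k ^^ n) w)"
proof (induction n)
  case 0
  show ?case using assms by (simp add: dop_zop lin_zero[OF lin_zop])
next
  case (Suc n)
  let ?w = "(zop k ^^ Suc n) w"
  have wM: "?w \<in> carrier M" using assms by (intro funpow_closed lin_zop)
  have "dop k (zop k ?w) = zop k (dop k ?w) \<oplus> ?w" using assms wM by (intro dop_zop)
  also have "zop k (dop k ?w) = sc (of_nat (Suc n)) ?w"
    using assms by (simp only: Suc) (simp add: lin_sc[OF lin_zop] funpow_closed lin_zop)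
  also have "sc (of_nat (Suc n)) ?w \<oplus> ?w = sc (of_nat (Suc (Suc n))) ?w"
    using sc_l_distr[OF wM, of "of_nat (Suc n)" 1] wM by (simp add: add_ac)
  finally show ?case by simp
qed

lemma dop_funpow_zop_funpow:
  assumes "k \<le> ell" "w \<in> carrier M" "dop k w = \<zero>"
  shows "(dop k ^^ n) ((zop k ^^ n) w) = sc (of_nat (fact n)) w"
proof (induction n)
  case (Suc n)
  have "(dop k ^^ Suc n) ((zop k ^^ Suc n) w) = (dop k ^^ n) (dop k ((zop k ^^ Suc n) w))"
    by (simp only: funpow_Suc_right o_apply)
  also have "\<dots> = sc (of_nat (Suc n)) ((dop k ^^ n) ((zop k ^^ n) w))"
    by (simp only: dop_zop_funpow[OF assms])
      (intro lin_sc[OF lin_funpow[OF lin_dop]] funpow_closed lin_zop assms)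
  also have "\<dots> = sc (of_nat (fact (Suc n))) w"
    using assms by (simp only: Suc) (simp add: algebra_simps)
  finally show ?case .
qed (use assms in simp)

text \<open>Modulo z_k, which \<open>proj k\<close> kills, y_k is the scalar \<chi>(y_k); the y_j
  with j > k commute with \<open>proj k\<close>. So the variable y_k disappears.\<close>

lemma proj_yspan:
  assumes v: "weight_vector 0 v" and "k \<le> ell" "f \<in> yspan v k"
  shows "proj k f \<in> yspan v (Suc k)"
proof -
  have vM: "v \<in> carrier M" using v by (simp add: weight_vector_def)
  \<comment> \<open>For k = \<open>ell\<close> this is where weight 0 enters: e_0 t^0 itself must
    kill v.\<close>
  have dv: "dop k v = \<zero>"
    using v by (simp add: dop_def weight_vector_def lin_zero[OF lin_funpow[OF act_lin]])
  show ?thesis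
    using assms(3)
  proof (induction f rule: yspan.induct)
    case (scalar c)
    have "proj k (sc c v) = sc (c * of_nat (fact (p - 1))) v"
      using dop_funpow_zop_funpow[OF assms(2) vM dv, of "p - 1"] vM
      by (simp add: lin_sc[OF lin_proj]) (simp add: proj_def)
    thus ?case by (simp only: yspan.scalar)
  next
    case (Y j f)
    have fM: "f \<in> carrier M" using yspan_closed[OF vM Y(3)] .
    show ?case
    proof (cases "j = k")
      case True
      have "Y k f = zop k f \<oplus> sc (\<chi> (e (-1) k)) f"
        using fM by (simp add: zop_def a_assoc)
      hence "proj k (Y k f) = sc (\<chi> (e (-1) k)) (proj k f)"
        using fM assms(2) lin_closed[OF lin_proj, of f k] lin_closed[OF lin_zop, of f k]
        by (simp add: lin_add[OF lin_proj] lin_sc[OF lin_proj] proj_zop)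
      thus ?thesis using True yspan_sc[OF vM Y.IH] by simp
    next
      case False
      thus ?thesis using Y fM by (simp add: proj_Y yspan.Y)
    qed
  next
    case (add f g)
    thus ?case using yspan_closed[OF vM add(1)] yspan_closed[OF vM add(2)]
      by (simp add: lin_add[OF lin_proj] yspan.add)
  qed
qed

text \<open>All derivatives of f vanish, so \<open>proj k\<close> multiplies f by (p - 1)!, a unit
  modulo p. Each projection therefore moves f itself one step down the chain of the
  \<open>yspan v k\<close>, until only multiples of v are left.\<close>

lemma highest_weight_vector_unique:
  assumes v: "weight_vector 0 v" and f: "f \<in> yspan v 0" "weight_vector 0 f"
  shows "\<exists>c. f = sc c v"
proof -
  have vM: "v \<in> carrier M" using v by (simp add: weight_vector_def)
  have fM: "f \<in> carrier M" using f by (simp add: weight_vector_def)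
  have "k \<le> Suc ell \<Longrightarrow> f \<in> yspan v k" for k
  proof (induction k)
    case (Suc k)
    have "act (e 0 (ell - k)) f = \<zero>" using f(2) by (simp add: weight_vector_def)
    hence "dop k f = \<zero>"
      by (simp add: dop_def lin_zero[OF lin_funpow[OF act_lin]])
    hence "proj k f = sc (of_nat (fact (p - 1))) f"
      using Suc.prems fM by (simp add: proj_def dop_funpow_zop_funpow)
    hence "sc (of_nat (fact (p - 1))) f \<in> yspan v (Suc k)"
      using proj_yspan[OF v, of k f] Suc by simp
    moreover have "of_nat (fact (p - 1)) \<noteq> (0 :: 'k)"
    proof
      assume "of_nat (fact (p - 1)) = (0 :: 'k)"
      hence "p dvd fact (p - 1)" unfolding of_nat_eq_0_iff_char_dvd char .
      thus False using prime_dvd_fact_iff[OF prime_p, of "p - 1"] p_gt_3 by simp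
    qed
    ultimately show ?case
      using yspan_sc[OF vM, of "sc (of_nat (fact (p - 1))) f" "Suc k" "inverse (of_nat (fact (p - 1)))"] fM by simp
  qed (use f in simp)
  hence "f \<in> yspan v (Suc ell)" by simp
  thus ?thesis
  proof (induction f rule: yspan.induct)
    case (add f g)
    then obtain c d where "f = sc c v" "g = sc d v" by blast
    hence "f \<oplus> g = sc (c + d) v" using vM by (simp add: sc_l_distr)
    thus ?case ..
  qed auto
qed

end

section \<open>Derivations in characteristic p\<close>

definition derivation :: "('b::comm_ring_1 \<Rightarrow> 'b) \<Rightarrow> bool" where
  "derivation T \<longleftrightarrow> (\<forall>a b. T (a + b) = T a + T b) \<and> (\<forall>a b. T (a * b) = T a * b + a * T b)"

lemma derivation_add: "derivation T \<Longrightarrow> T (a + b) = T a + T b"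
  and derivation_mult: "derivation T \<Longrightarrow> T (a * b) = T a * b + a * T b"
  by (auto simp: derivation_def)

lemma derivation_0: "derivation T \<Longrightarrow> T 0 = 0"
  using derivation_add[of T 0 0] by simp

lemma derivation_1: "derivation T \<Longrightarrow> T 1 = 0"
  using derivation_mult[of T 1 1] by simp

lemma derivation_uminus: "derivation T \<Longrightarrow> T (- a) = - T a"
  using derivation_add[of T a "- a"] derivation_0[of T] by (simp add: eq_neg_iff_add_eq_0 add.commute)

lemma derivation_diff: "derivation T \<Longrightarrow> T (a - b) = T a - T b"
  using derivation_add[of T a "- b"] derivation_uminus[of T b] by simp

lemma derivation_sum: "derivation T \<Longrightarrow> T (sum f A) = (\<Sum>a\<in>A. T (f a))"
  by (induction A rule: infinite_finite_induct) (auto simp: derivation_0 derivation_add)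

lemma derivation_power: "derivation T \<Longrightarrow> T (a ^ n) = of_nat n * a ^ (n - 1) * T a"
proof (induction n)
  case (Suc n)
  thus ?case by (cases n) (auto simp: derivation_mult algebra_simps)
qed (simp add: derivation_1)

lemma derivation_scaled: "derivation T \<Longrightarrow> derivation (\<lambda>b. f * T b)"
  by (simp add: derivation_def algebra_simps)

lemma derivation_sum_op: "(\<And>k. k \<in> A \<Longrightarrow> derivation (T k)) \<Longrightarrow> derivation (\<lambda>b. \<Sum>k\<in>A. T k b)"
  by (induction A rule: infinite_finite_induct) (auto simp: derivation_def algebra_simps)

lemma derivation_add_op: "derivation S \<Longrightarrow> derivation T \<Longrightarrow> derivation (\<lambda>b. S b + T b)"
  by (simp add: derivation_def algebra_simps)

lemma derivation_diff_op: "derivation S \<Longrightarrow> derivation T \<Longrightarrow> derivation (\<lambda>b. S b - T b)"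
  by (simp add: derivation_def algebra_simps)

lemma derivation_commutator: "derivation S \<Longrightarrow> derivation T \<Longrightarrow> derivation (\<lambda>b. S (T b) - T (S b))"
  by (simp add: derivation_def algebra_simps)

text \<open>The pairing \<beta> with three separate operators covers two cases: multiplication in a
  ring, and the pairing of a Lie algebra element a with a function b by the vector field of a, where
  S is ad x. There the Leibniz rule is the bracket relation, which holds on given subsets; hence A
  and B.\<close>

lemma Leibniz_funpow:
  fixes \<beta> :: "'a \<Rightarrow> 'b \<Rightarrow> 'c::comm_ring_1"
  assumes T_add: "\<And>x y. T (x + y) = T x + T y"
    and S: "\<And>a. a \<in> A \<Longrightarrow> S a \<in> A" and S': "\<And>b. b \<in> B \<Longrightarrow> S' b \<in> B"
    and Leibniz: "\<And>a b. a \<in> A \<Longrightarrow> b \<in> B \<Longrightarrow> T (\<beta> a b) = \<beta> (S a) b + \<beta> a (S' b)"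
    and ab: "a \<in> A" "b \<in> B"
  shows "(T ^^ n) (\<beta> a b) = (\<Sum>i\<le>n. of_nat (n choose i) * \<beta> ((S ^^ i) a) ((S' ^^ (n - i)) b))"
proof (induction n)
  case (Suc n)
  have T0: "T 0 = 0" using T_add[of 0 0] by simp
  have T_of_nat: "T (of_nat m * x) = of_nat m * T x" for m x
    by (induction m) (auto simp: T_add T0 ring_distribs)
  have T_sum: "T (sum f I) = (\<Sum>i\<in>I. T (f i))" for f :: "nat \<Rightarrow> 'c" and I
    by (induction I rule: infinite_finite_induct) (auto simp: T_add T0)
  have inA: "(S ^^ i) a \<in> A" for i by (induction i) (auto simp: ab S)
  have inB: "(S' ^^ i) b \<in> B" for i by (induction i) (auto simp: ab S')
  define g where "g i j = \<beta> ((S ^^ i) a) ((S' ^^ j) b)" for i j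
  have Tg: "T (g i j) = g (Suc i) j + g i (Suc j)" for i j
    unfolding g_def using Leibniz[OF inA inB, of i j] by simp
  have "(T ^^ Suc n) (\<beta> a b) = (\<Sum>i\<le>n. of_nat (n choose i) * g (Suc i) (n - i)) +
      (\<Sum>i\<le>n. of_nat (n choose i) * g i (Suc n - i))"
    using Suc by (simp add: T_sum T_of_nat Tg ring_distribs sum.distrib Suc_diff_le flip: g_def)
  also have "(\<Sum>i\<le>n. of_nat (n choose i) * g i (Suc n - i)) =
      (\<Sum>i\<le>Suc n. of_nat (n choose i) * g i (Suc n - i))"
    by (simp add: binomial_eq_0)
  also have "\<dots> = g 0 (Suc n) + (\<Sum>i\<le>n. of_nat (n choose Suc i) * g (Suc i) (n - i))"
    by (subst sum.atMost_Suc_shift) simp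
  also have "(\<Sum>i\<le>n. of_nat (n choose i) * g (Suc i) (n - i)) +
      (g 0 (Suc n) + (\<Sum>i\<le>n. of_nat (n choose Suc i) * g (Suc i) (n - i))) =
      g 0 (Suc n) + (\<Sum>i\<le>n. of_nat (Suc n choose Suc i) * g (Suc i) (n - i))"
    by (simp add: ring_distribs sum.distrib add_ac)
  also have "\<dots> = (\<Sum>i\<le>Suc n. of_nat (Suc n choose i) * g i (Suc n - i))"
    by (subst sum.atMost_Suc_shift) simp
  finally show ?case by (simp only: g_def)
qed simp

lemma Leibniz_funpow_prime:
  fixes \<beta> :: "'a \<Rightarrow> 'b \<Rightarrow> 'c::comm_ring_1"
  assumes p: "prime p" "CHAR('c) = p"
    and T_add: "\<And>x y. T (x + y) = T x + T y"
    and S: "\<And>a. a \<in> A \<Longrightarrow> S a \<in> A" and S': "\<And>b. b \<in> B \<Longrightarrow> S' b \<in> B"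
    and Leibniz: "\<And>a b. a \<in> A \<Longrightarrow> b \<in> B \<Longrightarrow> T (\<beta> a b) = \<beta> (S a) b + \<beta> a (S' b)"
    and ab: "a \<in> A" "b \<in> B"
  shows "(T ^^ p) (\<beta> a b) = \<beta> ((S ^^ p) a) b + \<beta> a ((S' ^^ p) b)"
proof -
  let ?f = "\<lambda>i. of_nat (p choose i) * \<beta> ((S ^^ i) a) ((S' ^^ (p - i)) b)"
  have p0: "p > 0" using p(1) by (rule prime_gt_0_nat)
  have "(T ^^ p) (\<beta> a b) = (\<Sum>i\<le>p. ?f i)"
    by (rule Leibniz_funpow[where A = A and B = B]) fact+
  also have "\<dots> = (\<Sum>i\<in>{0, p}. ?f i)"
  proof (rule sum.mono_neutral_right)
    show "\<forall>i\<in>{..p} - {0, p}. ?f i = 0"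
    proof
      fix i assume "i \<in> {..p} - {0, p}"
      hence "p dvd (p choose i)" using p(1) p0 by (intro dvd_choose_prime) auto
      hence "of_nat (p choose i) = (0::'c)" using p(2) by (simp add: of_nat_eq_0_iff_char_dvd)
      thus "?f i = 0" by simp
    qed
  qed auto
  also have "\<dots> = \<beta> ((S ^^ p) a) b + \<beta> a ((S' ^^ p) b)"
    using p0 by (simp add: add.commute)
  finally show ?thesis .
qed

lemma derivation_funpow_prime:
  fixes T :: "'b::comm_ring_1 \<Rightarrow> 'b"
  assumes "prime p" "CHAR('b) = p" "derivation T"
  shows "derivation (T ^^ p)"
proof -
  have "(T ^^ n) (a + b) = (T ^^ n) a + (T ^^ n) b" for n a b
    by (induction n) (auto simp: derivation_add[OF assms(3)])
  moreover have "(T ^^ p) (a * b) = (T ^^ p) a * b + a * (T ^^ p) b" for a b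
    by (rule Leibniz_funpow_prime[where A = UNIV and B = UNIV])
      (use assms in \<open>auto simp: derivation_add derivation_mult\<close>)
  ultimately show ?thesis by (simp add: derivation_def)
qed

text \<open>Extends a derivation of the coefficients to power series, with the variable treated as a
  constant.\<close>

definition fps_map :: "('b \<Rightarrow> 'b) \<Rightarrow> 'b fps \<Rightarrow> 'b::comm_ring_1 fps" where
  "fps_map T A = Abs_fps (\<lambda>n. T (fps_nth A n))"

lemma fps_nth_map [simp]: "fps_nth (fps_map T A) n = T (fps_nth A n)"
  by (simp add: fps_map_def)

lemma derivation_fps_map:
  assumes "derivation T"
  shows "derivation (fps_map T)"
  unfolding derivation_def
  by (auto intro!: fps_ext simp: derivation_add[OF assms] fps_mult_nth derivation_sum[OF assms]
      derivation_mult[OF assms] sum.distrib)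

lemma fps_map_X: "derivation T \<Longrightarrow> fps_map T (fps_X ^ n) = 0"
  by (rule fps_ext) (simp add: derivation_0 derivation_1)

section \<open>The group algebra of a direct sum of copies of the ground field\<close>

text \<open>The exponents form a vector space over the ground field: p times any exponent is 0, each
  coordinate is an additive map into the field and thus yields a derivation, and an exponent s may
  be any scalar.\<close>

type_synonym 'k grp_alg = "(nat \<Rightarrow>\<^sub>0 'k) \<Rightarrow>\<^sub>0 'k"

lemma poly_mapping_single_induct [case_names zero single add]:
  fixes f :: "'a \<Rightarrow>\<^sub>0 'b::comm_monoid_add"
  assumes "P 0" "\<And>a c. P (single a c)" "\<And>f g. P f \<Longrightarrow> P g \<Longrightarrow> P (f + g)"
  shows "P f"
proof -
  have "f = (\<Sum>a\<in>keys f. single a (lookup f a))"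
    by (rule poly_mapping_eqI) (auto simp: lookup_sum lookup_single when_def in_keys_iff)
  moreover have "P (\<Sum>a\<in>A. single a (lookup f a))" for A
    by (induction A rule: infinite_finite_induct) (auto simp: assms)
  ultimately show ?thesis by metis
qed

lemma CHAR_poly_mapping: "CHAR('a::monoid_add \<Rightarrow>\<^sub>0 'b::semiring_1) = CHAR('b)"
proof (rule CHAR_eqI)
  have *: "of_nat n = single (0 :: 'a) (of_nat n :: 'b)" for n
    by (simp add: single_of_nat)
  show "of_nat CHAR('b) = (0 :: 'a \<Rightarrow>\<^sub>0 'b)"
    by (simp only: * of_nat_CHAR single_zero)
  show "CHAR('b) dvd n" if "of_nat n = (0 :: 'a \<Rightarrow>\<^sub>0 'b)" for n
  proof -
    have "lookup (of_nat n :: 'a \<Rightarrow>\<^sub>0 'b) 0 = of_nat n"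
      by (simp add: lookup_of_nat)
    thus ?thesis using that by (simp add: of_nat_eq_0_iff_char_dvd)
  qed
qed

definition grading :: "((nat \<Rightarrow>\<^sub>0 'k) \<Rightarrow> 'k) \<Rightarrow> 'k grp_alg \<Rightarrow> 'k::field grp_alg" where
  "grading \<phi> f = Poly_Mapping.mapp (\<lambda>m c. \<phi> m * c) f"

lemma lookup_grading: "lookup (grading \<phi> f) m = \<phi> m * lookup f m"
  by (auto simp: grading_def lookup_mapp when_def in_keys_iff)

lemma grading_single: "grading \<phi> (single m c) = single m (\<phi> m * c)"
  by (rule poly_mapping_eqI) (auto simp: lookup_grading lookup_single when_def)

lemma derivation_grading:
  assumes "\<And>m n. \<phi> (m + n) = \<phi> m + \<phi> n"
  shows "derivation (grading \<phi>)"
proof -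
  have add: "grading \<phi> (f + g) = grading \<phi> f + grading \<phi> g" for f g
    by (rule poly_mapping_eqI) (simp add: lookup_grading lookup_add ring_distribs)
  have 0: "grading \<phi> 0 = 0"
    by (rule poly_mapping_eqI) (simp add: lookup_grading)
  have "grading \<phi> (f * g) = grading \<phi> f * g + f * grading \<phi> g" for f g
  proof (induction f rule: poly_mapping_single_induct)
    case (single m c)
    show ?case
    proof (induction g rule: poly_mapping_single_induct)
      case (single n d)
      show ?case
        by (simp add: mult_single grading_single assms ring_distribs single_add mult_ac add.commute[of n m])
    qed (auto simp: 0 add ring_distribs)
  qed (auto simp: 0 add ring_distribs)
  thus ?thesis using add by (simp add: derivation_def)
qed

definition const_ga :: "'k \<Rightarrow> 'k::field grp_alg" where
  "const_ga c = single 0 c"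

lemma const_ga_simps [simp]:
  "const_ga 0 = 0" "const_ga 1 = 1"
  by (simp_all add: const_ga_def)

lemma const_ga_add: "const_ga (c + d) = const_ga c + const_ga d"
  and const_ga_mult: "const_ga (c * d) = const_ga c * const_ga d"
  and const_ga_uminus: "const_ga (- c) = - const_ga c"
  by (simp_all add: const_ga_def single_add mult_single single_uminus)

lemma const_ga_sum: "const_ga (sum f A) = (\<Sum>a\<in>A. const_ga (f a))"
  by (induction A rule: infinite_finite_induct) (auto simp: const_ga_add)

lemma const_ga_power: "const_ga (c ^ n) = const_ga c ^ n"
  by (induction n) (auto simp: const_ga_mult)

lemma lookup_const_ga_mult: "lookup (const_ga c * f) m = c * lookup f m"
  unfolding const_ga_def by (simp flip: mult_map_scale_conv_mult add: Poly_Mapping.map.rep_eq when_def)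

lemma grading_const: "\<phi> 0 = 0 \<Longrightarrow> grading \<phi> (const_ga c) = 0"
  by (simp add: const_ga_def grading_single)

section \<open>A module realising the p-character\<close>

lemma CHAR_grp_alg: "CHAR('k::field grp_alg) = CHAR('k)"
  by (rule CHAR_poly_mapping)

context witt_height_0
begin

lemma prime_CHAR: "prime CHAR('k)" "prime CHAR('k grp_alg)" "CHAR('k grp_alg) = p" "prime CHAR('k grp_alg fps)" "CHAR('k grp_alg fps) = p"
  using prime_p char by (simp_all add: CHAR_grp_alg)

text \<open>Summing over a fixed index set instead of the supports makes bilinearity
  visible.\<close>

lemma lookup_br_index:
  assumes "x \<in> W" "y \<in> W"
  shows "lookup (br x y) m =
    (\<Sum>a\<in>witt_index p ell. \<Sum>b\<in>witt_index p ell.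
       lookup x a * lookup y b * of_int (fst b - fst a) *
       lookup (e (fst a + fst b) (snd a + snd b)) m)"
proof -
  have fin: "finite (witt_index p ell)" by (simp add: witt_index_def)
  have "(\<Sum>b\<in>keys y. lookup x a * lookup y b * of_int (fst b - fst a) *
       lookup (e (fst a + fst b) (snd a + snd b)) m) =
    (\<Sum>b\<in>witt_index p ell. lookup x a * lookup y b * of_int (fst b - fst a) *
       lookup (e (fst a + fst b) (snd a + snd b)) m)" for a
    using assms(2) fin by (intro sum.mono_neutral_left) (auto simp: W_eq in_keys_iff)
  moreover have "(\<Sum>a\<in>keys x. \<Sum>b\<in>witt_index p ell. lookup x a * lookup y b * of_int (fst b - fst a) *
       lookup (e (fst a + fst b) (snd a + snd b)) m) =
    (\<Sum>a\<in>witt_index p ell. \<Sum>b\<in>witt_index p ell. lookup x a * lookup y b * of_int (fst b - fst a) *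
       lookup (e (fst a + fst b) (snd a + snd b)) m)"
    using assms(1) fin by (intro sum.mono_neutral_left) (auto simp: W_eq in_keys_iff)
  ultimately show ?thesis by (simp only: lookup_witt_bracket)
qed

lemma br_add_left:
  assumes "x \<in> W" "x' \<in> W" "y \<in> W"
  shows "br (x + x') y = br x y + br x' y"
  using assms
  by (intro poly_mapping_eqI)
    (simp add: lookup_br_index lookup_add distrib_left distrib_right sum.distrib)

lemma br_add_right:
  assumes "x \<in> W" "y \<in> W" "y' \<in> W"
  shows "br x (y + y') = br x y + br x y'"
  using assms
  by (intro poly_mapping_eqI)
    (simp add: lookup_br_index lookup_add distrib_left distrib_right sum.distrib)

lemma br_scale:
  assumes "x \<in> W" "y \<in> W"
  shows "br (witt_scale c x) y = witt_scale c (br x y)" "br x (witt_scale c y) = witt_scale c (br x y)"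
  using assms
  by (auto intro!: poly_mapping_eqI simp: lookup_br_index sum_distrib_left mult_ac)

text \<open>With \<open>g\<^sub>k = x\<^sub>k + 1\<close>, the relation \<open>x\<^sub>k\<^sup>p = 0\<close> becomes \<open>g\<^sub>k\<^sup>p = 1\<close>, which holds in the group algebra without
  passing to a quotient; the derivative by \<open>x\<^sub>k\<close> is \<open>g\<^sub>k\<^sup>-\<^sup>1\<close> times the grading by the exponent of \<open>g\<^sub>k\<close>.
  The coordinate \<open>Suc ell\<close> carries the formal exponential \<open>uexp s\<close> of \<open>s (\<Sum>\<^sub>k \<chi>(y\<^sub>k) x\<^sub>k)\<close>.\<close>

definition dvar :: "nat \<Rightarrow> 'k grp_alg \<Rightarrow> 'k grp_alg" where
  "dvar k f = single (- single k 1) 1 * grading (\<lambda>m. lookup m k) f +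
     const_ga (\<chi> (e (-1) k)) * grading (\<lambda>m. lookup m (Suc ell)) f"

definition xvar :: "nat \<Rightarrow> 'k grp_alg" where
  "xvar k = single (single k 1) 1 - 1"

definition uexp :: "'k \<Rightarrow> 'k grp_alg" where
  "uexp s = single (single (Suc ell) s) 1"

lemma derivation_dvar: "derivation (dvar k)"
proof -
  have "derivation (grading (\<lambda>m. lookup m i) :: 'k grp_alg \<Rightarrow> _)" for i
    by (rule derivation_grading) (simp add: lookup_add)
  thus ?thesis
    unfolding dvar_def[abs_def] by (intro derivation_add_op derivation_scaled)
qed

lemma dvar_const [simp]: "dvar k (const_ga c) = 0"
  by (simp add: dvar_def grading_const)

lemma dvar_xvar:
  assumes "j \<le> ell" "k \<le> ell"
  shows "dvar k (xvar j) = (if j = k then 1 else 0)"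
proof -
  have "dvar k (xvar j) = dvar k (single (single j 1) 1)"
    unfolding xvar_def by (simp only: derivation_diff[OF derivation_dvar] derivation_1[OF derivation_dvar]) simp
  also have "\<dots> = (if j = k then 1 else 0)"
    using assms by (auto simp: dvar_def grading_single mult_single lookup_single when_def)
  finally show ?thesis .
qed

lemma dvar_uexp:
  assumes "k \<le> ell"
  shows "dvar k (uexp s) = const_ga (\<chi> (e (-1) k) * s) * uexp s"
  using assms by (simp add: dvar_def uexp_def grading_single lookup_single const_ga_def mult_single)

lemma uexp_add: "uexp (s + t) = uexp s * uexp t"
  by (simp add: uexp_def mult_single single_add)

lemma uexp_inverse: "uexp s * uexp (- s) = 1"
  by (simp flip: uexp_add) (simp add: uexp_def)

lemma xvar_power_p: "xvar k ^ p = 0"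
proof -
  define g :: "'k grp_alg" where "g = single (single k 1) 1"
  have "g ^ n = single (single k (of_nat n)) 1" for n
    by (induction n) (auto simp: g_def mult_single single_add)
  moreover have "of_nat p = (0::'k)" using char by (metis of_nat_CHAR)
  ultimately have "g ^ p = 1" by simp
  moreover have "(xvar k + 1) ^ p = xvar k ^ p + 1 ^ p"
    using prime_CHAR by (intro freshmans_dream) auto
  moreover have "xvar k + 1 = g" by (simp add: xvar_def g_def)
  ultimately show ?thesis by simp
qed

text \<open>The tautological arc \<open>x\<^sub>0 + x\<^sub>1 t + \<dots> + x\<^sub>l t^l\<close>, with \<open>l = ell\<close>. The element \<open>e\<^sub>i t\<^sup>k\<close> acts as the
  derivation that maps the arc to \<open>t^k\<close> times its \<open>(i + 1)\<close>-st power, modulo \<open>t^(l+1)\<close>.\<close>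

definition arc :: "'k grp_alg fps" where
  "arc = Abs_fps (\<lambda>n. if n \<le> ell then xvar n else 0)"

text \<open>By the freshman's dream the p-th power is the sum of the terms x_k^p t^(kp), all zero.
  This matches the convention e_i = 0 for i > p - 2.\<close>

lemma arc_power_ge_p:
  assumes "n \<ge> p"
  shows "arc ^ n = 0"
proof -
  have nth: "fps_nth (fps_const (xvar k) * fps_X ^ k) m = (if k = m then xvar k else 0)" for k m
    by simp
  have arc: "arc = (\<Sum>k\<le>ell. fps_const (xvar k) * fps_X ^ k)"
    by (rule fps_ext) (simp only: arc_def fps_sum_nth nth, simp)
  have "arc ^ p = (\<Sum>k\<le>ell. (fps_const (xvar k) * fps_X ^ k) ^ p)"
    unfolding arc by (rule freshmans_dream_sum) (simp_all only: prime_CHAR prime_p)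
  also have "\<dots> = (\<Sum>k\<le>ell. 0)"
    by (intro sum.cong refl) (simp add: power_mult_distrib fps_const_power xvar_power_p)
  finally have "arc ^ p = 0" by simp
  moreover obtain d where "n = p + d" using assms le_Suc_ex by blast
  ultimately show ?thesis by (simp add: power_add)
qed

definition vfield :: "'k current \<Rightarrow> 'k grp_alg fps" where
  "vfield x = (\<Sum>b\<in>witt_index p ell.
     fps_const (const_ga (lookup x b)) * (fps_X ^ snd b * arc ^ nat (fst b + 1)))"

definition vcoeff :: "'k current \<Rightarrow> nat \<Rightarrow> 'k grp_alg" where
  "vcoeff x k = fps_nth (vfield x) k"

definition D :: "'k current \<Rightarrow> 'k grp_alg \<Rightarrow> 'k grp_alg" where
  "D x f = (\<Sum>k\<le>ell. vcoeff x k * dvar k f)"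

lemma vcoeff_eq: "vcoeff x k = (\<Sum>b\<in>witt_index p ell.
     const_ga (lookup x b) * fps_nth (fps_X ^ snd b * arc ^ nat (fst b + 1)) k)"
  unfolding vcoeff_def vfield_def fps_sum_nth fps_mult_left_const_nth ..

lemma vcoeff_add: "vcoeff (x + y) k = vcoeff x k + vcoeff y k"
  by (simp only: vcoeff_eq lookup_add const_ga_add distrib_right sum.distrib)

lemma vcoeff_scale: "vcoeff (witt_scale c x) k = const_ga c * vcoeff x k"
  by (simp only: vcoeff_eq lookup_witt_scale const_ga_mult sum_distrib_left mult.assoc)

lemma vcoeff_0 [simp]: "vcoeff 0 k = 0"
  by (simp add: vcoeff_eq)

lemma vfield_e:
  "vfield (e i k) = (if (i, k) \<in> witt_index p ell then fps_X ^ k * arc ^ nat (i + 1) else 0)"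
proof -
  have "vfield (e i k) = (\<Sum>b\<in>witt_index p ell. if b = (i, k) then fps_X ^ k * arc ^ nat (i + 1) else 0)"
    unfolding vfield_def by (intro sum.cong) (auto simp: lookup_witt_e)
  thus ?thesis by (simp add: witt_index_def)
qed

lemma derivation_D: "derivation (D x)"
  unfolding D_def[abs_def] by (intro derivation_sum_op derivation_scaled derivation_dvar)

lemma D_const [simp]: "D x (const_ga c) = 0"
  by (simp add: D_def)

lemma D_add: "D (x + y) f = D x f + D y f"
  by (simp add: D_def vcoeff_add distrib_right sum.distrib)

lemma D_scale: "D (witt_scale c x) f = const_ga c * D x f"
  by (simp add: D_def vcoeff_scale sum_distrib_left mult_ac)

lemma D_xvar: "j \<le> ell \<Longrightarrow> D x (xvar j) = vcoeff x j"
  by (simp add: D_def dvar_xvar if_distrib cong: if_cong)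

text \<open>The derivative of the linear function with coefficients \<chi>(y_k) along
  \<open>D x\<close>, that is, the logarithmic derivative of \<open>uexp 1\<close>.\<close>

definition Lfun :: "'k current \<Rightarrow> 'k grp_alg" where
  "Lfun x = (\<Sum>k\<le>ell. vcoeff x k * const_ga (\<chi> (e (-1) k)))"

lemma D_uexp: "D x (uexp s) = const_ga s * Lfun x * uexp s"
  by (simp add: D_def Lfun_def dvar_uexp sum_distrib_left sum_distrib_right const_ga_mult mult_ac)

text \<open>The chain rule for t^l times the (j+1)-st power of the arc, with t a constant.\<close>

lemma D_vcoeff_e:
  assumes "(i, k) \<in> witt_index p ell" "(j, l) \<in> witt_index p ell" "n \<le> ell"
  shows "D (e i k) (vcoeff (e j l) n) =
    of_nat (nat (j + 1)) * fps_nth (fps_X ^ (k + l) * arc ^ (nat (j + 1) - 1 + nat (i + 1))) n"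
proof -
  let ?T = "fps_map (D (e i k))" and ?m = "nat (j + 1)"
  let ?A = "fps_X ^ l * (of_nat ?m * arc ^ (?m - 1)) :: 'k grp_alg fps"
  have T: "derivation ?T" by (intro derivation_fps_map derivation_D)
  have "D (e i k) (vcoeff (e j l) n) = fps_nth (?T (fps_X ^ l * arc ^ ?m)) n"
    using assms by (simp add: vcoeff_def vfield_e)
  also have "?T (fps_X ^ l * arc ^ ?m) = ?A * ?T arc"
    by (simp add: derivation_mult[OF T] derivation_power[OF T] fps_map_X[OF derivation_D] mult_ac)
  also have "fps_nth (?A * ?T arc) n = fps_nth (?A * vfield (e i k)) n"
  proof -
    \<comment> \<open>Only coefficients up to n \<le> \<open>ell\<close> enter, and there the
      derivative of the arc agrees with \<open>vfield\<close>, which is not truncated beyond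
      \<open>ell\<close>.\<close>
    have "fps_nth (?T arc) (n - a) = fps_nth (vfield (e i k)) (n - a)" for a
    proof -
      have "n - a \<le> ell" using assms(3) by simp
      thus ?thesis using D_xvar[of "n - a" "e i k"] by (simp add: arc_def vcoeff_def)
    qed
    thus ?thesis by (simp add: fps_mult_nth)
  qed
  also have "?A * vfield (e i k) = of_nat ?m * (fps_X ^ (k + l) * arc ^ (?m - 1 + nat (i + 1)))"
    using assms(1) by (simp add: vfield_e power_add mult_ac)
  finally show ?thesis by (simp add: fps_of_nat[symmetric])
qed

text \<open>Both terms are multiples of t^(k+l) times the (i+j+1)-st power of the arc, with factors
  j + 1 and i + 1, so the difference has the factor j - i of the bracket. Out of range, one of three
  things vanishes: the coefficient because k + l > n, a power of the arc with exponent at least p,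
  or the factor when i = j = -1.\<close>

lemma vcoeff_br_e:
  assumes "(i, k) \<in> witt_index p ell" "(j, l) \<in> witt_index p ell" "n \<le> ell"
  shows "D (e i k) (vcoeff (e j l) n) - D (e j l) (vcoeff (e i k) n) = vcoeff (br (e i k) (e j l)) n"
proof -
  define m m' where "m = nat (j + 1)" and "m' = nat (i + 1)"
  have mm: "int m = j + 1" "int m' = i + 1"
    using assms by (auto simp: m_def m'_def witt_index_def)
  let ?A = "\<lambda>q. fps_nth (fps_X ^ (k + l) * arc ^ q) n"
  have "D (e i k) (vcoeff (e j l) n) - D (e j l) (vcoeff (e i k) n) =
      of_nat m * ?A (m - 1 + m') - of_nat m' * ?A (m' - 1 + m)"
    using assms by (simp only: D_vcoeff_e m_def m'_def add.commute[of l k])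
  \<comment> \<open>Truncated subtraction spoils an exponent only when m or m' is 0, and then its
    coefficient is 0.\<close>
  also have "\<dots> = (of_nat m - of_nat m') * ?A (m + m' - 1)"
    by (cases m; cases m') (simp_all add: algebra_simps)
  also have "of_nat m - of_nat m' = (const_ga (of_int (j - i)) :: 'k grp_alg)"
  proof -
    have "const_ga (of_int z) = (of_int z :: 'k grp_alg)" for z
      by (simp add: const_ga_def)
    moreover have "of_nat m - of_nat m' = (of_int (int m - int m') :: 'k grp_alg)" by simp
    ultimately show ?thesis by (simp only: mm) simp
  qed
  also have "const_ga (of_int (j - i)) * ?A (m + m' - 1) =
      const_ga (of_int (j - i)) * vcoeff (e (i + j) (k + l)) n"
  proof (cases "m = 0 \<and> m' = 0")
    case True
    hence "i = j" using mm by simp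
    thus ?thesis by simp
  next
    case False
    hence nat: "nat (i + j + 1) = m + m' - 1" "i + j \<ge> -1"
      using mm by auto
    show ?thesis
    proof (cases "(i + j, k + l) \<in> witt_index p ell")
      case True
      thus ?thesis using nat by (simp add: vcoeff_def vfield_e)
    next
      case False
      hence "n < k + l \<or> m + m' - 1 \<ge> p"
        using nat mm assms(3) by (auto simp: witt_index_def)
      hence "?A (m + m' - 1) = 0"
        by (auto simp: fps_X_power_mult_nth arc_power_ge_p)
      thus ?thesis using False by (simp add: vcoeff_def vfield_e)
    qed
  qed
  also have "\<dots> = vcoeff (br (e i k) (e j l)) n"
    using assms by (simp add: witt_bracket_e vcoeff_scale)
  finally show ?thesis .
qed

lemma W_induct [consumes 1, case_names e add]:
  assumes "x \<in> W"
    and "\<And>i k c. (i, k) \<in> witt_index p ell \<Longrightarrow> P (witt_scale c (e i k))"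
    and "\<And>x y. x \<in> W \<Longrightarrow> y \<in> W \<Longrightarrow> P x \<Longrightarrow> P y \<Longrightarrow> P (x + y)"
  shows "P x"
proof -
  have "keys x \<subseteq> witt_index p ell" using assms(1) by (simp add: W_eq)
  thus ?thesis
  proof (induction x rule: current_induct)
    case (single a c)
    obtain i k where a: "a = (i, k)" by (cases a)
    hence "single a 1 = e i k" using single by (simp add: witt_e_in)
    thus ?case using assms(2)[of i k c] single a by (simp del: witt_scale_simps)
  next
    case (add x y)
    thus ?case by (intro assms(3)) (simp_all add: W_eq)
  qed (use assms(2)[of 0 0 0] p_gt_3 in \<open>simp add: witt_index_def\<close>)
qed

lemma D_const_mult: "D x (const_ga c * f) = const_ga c * D x f"
  by (simp add: derivation_mult[OF derivation_D])

lemma vcoeff_br: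
  assumes "x \<in> W" "y \<in> W" "n \<le> ell"
  shows "D x (vcoeff y n) - D y (vcoeff x n) = vcoeff (br x y) n"
  using assms(1)
proof (induction x rule: W_induct)
  case (e i k c)
  show ?case
    using assms(2)
  proof (induction y rule: W_induct)
    case (e j l d)
    have "D (witt_scale c (local.e i k)) (vcoeff (witt_scale d (local.e j l)) n) -
        D (witt_scale d (local.e j l)) (vcoeff (witt_scale c (local.e i k)) n) =
        const_ga c * const_ga d * (D (local.e i k) (vcoeff (local.e j l) n) - D (local.e j l) (vcoeff (local.e i k) n))"
      by (simp add: vcoeff_scale D_scale D_const_mult algebra_simps)
    thus ?case
      using vcoeff_br_e[OF \<open>(i, k) \<in> witt_index p ell\<close> e assms(3)]
      by (simp add: br_scale vcoeff_scale const_ga_mult mult_ac)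
  next
    case (add y z)
    thus ?case
      by (simp add: vcoeff_add D_add derivation_add[OF derivation_D] br_add_right algebra_simps)
  qed
next
  case (add x z)
  thus ?case using assms(2)
    by (simp add: vcoeff_add D_add derivation_add[OF derivation_D] br_add_left algebra_simps)
qed

section \<open>The truncated polynomial ring inside the group algebra and its twisted module\<close>

inductive_set Rring :: "'k grp_alg set" where
  const: "const_ga c \<in> Rring"
| xvar: "j \<le> ell \<Longrightarrow> xvar j \<in> Rring"
| add: "f \<in> Rring \<Longrightarrow> g \<in> Rring \<Longrightarrow> f + g \<in> Rring"
| mult: "f \<in> Rring \<Longrightarrow> g \<in> Rring \<Longrightarrow> f * g \<in> Rring"

lemma Rring_0: "0 \<in> Rring" and Rring_1: "1 \<in> Rring"
  using Rring.const[of 0] Rring.const[of 1] by simp_all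

lemma Rring_sum: "(\<And>a. a \<in> A \<Longrightarrow> f a \<in> Rring) \<Longrightarrow> sum f A \<in> Rring"
  by (induction A rule: infinite_finite_induct) (auto simp: Rring_0 Rring.add)

lemma arc_power_in_Rring: "fps_nth (arc ^ m) n \<in> Rring"
proof (induction m arbitrary: n)
  case (Suc m)
  have "fps_nth arc k \<in> Rring" for k
    by (auto simp: arc_def Rring_0 Rring.xvar)
  thus ?case using Suc by (auto simp: fps_mult_nth intro!: Rring_sum Rring.mult)
qed (auto simp: Rring_0 Rring_1)

lemma vcoeff_in_Rring: "vcoeff x k \<in> Rring"
  by (auto simp: vcoeff_def vfield_def fps_sum_nth fps_X_power_mult_nth Rring_0
      intro!: Rring_sum Rring.mult Rring.const arc_power_in_Rring)

lemma D_in_Rring: "f \<in> Rring \<Longrightarrow> D x f \<in> Rring"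
  by (induction rule: Rring.induct)
    (auto simp: Rring_0 D_xvar vcoeff_in_Rring derivation_add[OF derivation_D]
       derivation_mult[OF derivation_D] intro: Rring.add Rring.mult)

text \<open>On this subring a derivation is determined by generators; on the whole group algebra the
  variables \<open>xvar j\<close> do not determine it. The bracket and p-map relations are checked
  in this way.\<close>

lemma derivation_eq_on_Rring:
  assumes "derivation S" "derivation T" "\<And>c. S (const_ga c) = T (const_ga c)"
    and "\<And>j. j \<le> ell \<Longrightarrow> S (xvar j) = T (xvar j)" "f \<in> Rring"
  shows "S f = T f"
  using assms(5)
  by induction (auto simp: assms derivation_add[OF assms(1)] derivation_add[OF assms(2)]
      derivation_mult[OF assms(1)] derivation_mult[OF assms(2)])

lemma D_br_Rring:
  assumes "x \<in> W" "y \<in> W" "f \<in> Rring"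
  shows "D x (D y f) - D y (D x f) = D (br x y) f"
  by (rule derivation_eq_on_Rring[OF derivation_commutator[OF derivation_D derivation_D] derivation_D _ _ assms(3)])
    (use assms in \<open>auto simp: D_xvar vcoeff_br derivation_0[OF derivation_D]\<close>)

lemma D_Lfun: "D x (Lfun y) = (\<Sum>k\<le>ell. D x (vcoeff y k) * const_ga (\<chi> (e (-1) k)))"
  by (simp add: Lfun_def derivation_sum[OF derivation_D] derivation_mult[OF derivation_D])

text \<open>On logarithmic derivatives the claim is D x (Lfun y) - D y (Lfun x) = Lfun [x, y], which
  is the bracket relation for the coefficients contracted with \<chi>.\<close>

lemma D_br_uexp:
  assumes "x \<in> W" "y \<in> W"
  shows "D x (D y (uexp s)) - D y (D x (uexp s)) = D (br x y) (uexp s)"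
proof -
  have "Lfun (br x y) = D x (Lfun y) - D y (Lfun x)"
    unfolding D_Lfun Lfun_def[of "br x y"] sum_subtractf[symmetric]
    using assms by (intro sum.cong) (simp_all add: left_diff_distrib flip: vcoeff_br)
  hence "D x (Lfun y) = Lfun (br x y) + D y (Lfun x)" by simp
  thus ?thesis
    by (simp add: D_uexp derivation_mult[OF derivation_D] algebra_simps)
qed

text \<open>Multiplication by the unit \<open>uexp 1\<close> identifies this with
  \<open>Rring\<close>, on which x then acts as \<open>D x\<close> plus multiplication by
  \<open>Lfun x\<close>.\<close>

definition modset :: "'k grp_alg set" where
  "modset = {f * uexp 1 | f. f \<in> Rring}"

lemma D_br_modset:
  assumes "x \<in> W" "y \<in> W" "b \<in> modset"
  shows "D x (D y b) - D y (D x b) = D (br x y) b"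
proof -
  from assms(3) obtain f where f: "b = f * uexp 1" "f \<in> Rring" by (auto simp: modset_def)
  show ?thesis unfolding f(1)
    using D_br_Rring[OF assms(1,2) f(2)] D_br_uexp[OF assms(1,2), of 1]
      derivation_mult[OF derivation_commutator[OF derivation_D[of x] derivation_D[of y]], of f "uexp 1"]
    by (simp add: derivation_mult[OF derivation_D])
qed

lemma D_in_modset:
  assumes "b \<in> modset"
  shows "D x b \<in> modset"
proof -
  from assms obtain f where f: "b = f * uexp 1" "f \<in> Rring" by (auto simp: modset_def)
  have "Lfun x \<in> Rring"
    unfolding Lfun_def by (intro Rring_sum Rring.mult Rring.const vcoeff_in_Rring)
  hence "D x f + f * Lfun x \<in> Rring" by (intro Rring.add Rring.mult D_in_Rring f)
  moreover have "D x b = (D x f + f * Lfun x) * uexp 1"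
    by (simp add: f derivation_mult[OF derivation_D] D_uexp algebra_simps)
  ultimately show ?thesis by (auto simp: modset_def)
qed

text \<open>The defect of the \<open>p\<close>-map; it vanishes on \<open>Rring\<close> because it commutes with all
  derivations \<open>D y\<close>.\<close>

definition defect :: "'k current \<Rightarrow> 'k grp_alg \<Rightarrow> 'k grp_alg" where
  "defect x f = (D x ^^ p) f - D (pm x) f"

lemma derivation_Dp: "derivation (D x ^^ p)"
  by (intro derivation_funpow_prime prime_p prime_CHAR derivation_D)

lemma derivation_defect: "derivation (defect x)"
  unfolding defect_def[abs_def] by (intro derivation_diff_op derivation_Dp derivation_D)

lemma funpow_D_const:
  assumes "n > 0"
  shows "(D x ^^ n) (const_ga c) = 0"
proof -
  obtain m where n: "n = Suc m" using assms by (cases n) auto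
  have "(D x ^^ m) 0 = 0" by (induction m) (auto simp: derivation_0[OF derivation_D])
  thus ?thesis by (simp add: n funpow_swap1)
qed

lemma defect_const: "defect x (const_ga c) = 0"
  using p_gt_3 by (simp add: defect_def funpow_D_const)

lemma defect_commute:
  assumes "x \<in> W" "y \<in> W" "f \<in> Rring"
  shows "defect x (D y f) = D y (defect x f)"
proof -
  \<comment> \<open>The Leibniz rule for the pairing of y and f: in characteristic p only the two
    outer terms survive, and the inner operator on y is (ad x)^p = ad (pm x).\<close>
  have "(D x ^^ p) (D y f) = D ((br x ^^ p) y) f + D y ((D x ^^ p) f)"
  proof (rule Leibniz_funpow_prime[where A = W and B = Rring and \<beta> = D])
    show "D x (D a b) = D (br x a) b + D a (D x b)" if "a \<in> W" "b \<in> Rring" for a b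
      using D_br_Rring[OF assms(1) that] by (simp add: algebra_simps)
  qed (use assms prime_p prime_CHAR in \<open>auto simp: derivation_add[OF derivation_D] D_in_Rring\<close>)
  moreover have "D (pm x) (D y f) = D y (D (pm x) f) + D (br (pm x) y) f"
    using D_br_Rring[OF pm_in_W[OF assms(1)] assms(2,3)] by (simp add: algebra_simps)
  ultimately show ?thesis
    using assms by (simp add: defect_def br_pm derivation_diff[OF derivation_D])
qed

lemma Rring_keys: "f \<in> Rring \<Longrightarrow> m \<in> keys f \<Longrightarrow> keys m \<subseteq> {..ell}"
proof (induction arbitrary: m rule: Rring.induct)
  case (const c)
  thus ?case by (auto simp: const_ga_def split: if_splits)
next
  case (xvar j)
  have "m = 0 \<or> m = single j 1"
    using xvar keys_diff[of "single (single j 1) 1" "1 :: 'k grp_alg"]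
    by (auto simp: xvar_def)
  thus ?case using xvar by auto
next
  case (add f g)
  thus ?case using keys_add[of f g] by blast
next
  case (mult f g)
  then obtain a b where "m = a + b" "a \<in> keys f" "b \<in> keys g"
    using keys_mult[of f g] by blast
  thus ?case using mult.IH keys_add[of a b] by blast
qed

text \<open>On \<open>Rring\<close> no exponent reaches the coordinate \<open>Suc ell\<close>, so
  \<open>dvar i\<close> is a unit times the grading by the i-th exponent. If all these vanish, only
  the exponent 0 remains.\<close>

lemma Rring_constant:
  assumes f: "f \<in> Rring" and D0: "\<And>i. i \<le> ell \<Longrightarrow> dvar i f = 0"
  shows "\<exists>c. f = const_ga c"
proof -
  have "m = 0" if m: "m \<in> keys f" for m
  proof (rule poly_mapping_eqI)
    fix i
    show "lookup m i = lookup 0 i"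
    proof (cases "i \<le> ell")
      case True
      have "grading (\<lambda>m. lookup m (Suc ell)) f = 0"
        using Rring_keys[OF f]
        by (intro poly_mapping_eqI) (force simp: lookup_grading in_keys_iff)
      hence "single (- single i 1) 1 * grading (\<lambda>m. lookup m i) f = 0"
        using D0[OF True] by (simp add: dvar_def)
      hence "single (single i 1) 1 *
          (single (- single i 1) 1 * grading (\<lambda>m. lookup m i) f) = 0"
        by simp
      hence "grading (\<lambda>m. lookup m i) f = 0"
        by (simp add: mult_single flip: mult.assoc)
      hence "lookup m i * lookup f m = 0"
        by (metis lookup_grading lookup_zero)
      thus ?thesis using m by (simp add: in_keys_iff)
    next
      case False
      thus ?thesis using Rring_keys[OF f m] by (auto simp: in_keys_iff)
    qed
  qed
  hence "f = const_ga (lookup f 0)"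
    by (intro poly_mapping_eqI) (auto simp: const_ga_def lookup_single when_def in_keys_iff)
  thus ?thesis by blast
qed

lemma D_e_minus_1:
  assumes "i \<le> ell"
  shows "D (e (-1) i) f = dvar i f"
proof -
  have "(-1, i) \<in> witt_index p ell" using assms p_gt_3 by (simp add: witt_index_def)
  hence "vcoeff (e (-1) i) k = (if k = i then 1 else 0)" for k
    by (simp add: vcoeff_def vfield_e)
  hence "D (e (-1) i) f = (\<Sum>k\<le>ell. if k = i then dvar k f else 0)"
    unfolding D_def by (intro sum.cong) simp_all
  thus ?thesis using assms by simp
qed

lemma D_e_0_0:
  assumes "j \<le> ell"
  shows "D (e 0 0) (xvar j) = xvar j"
proof -
  have "(0, 0) \<in> witt_index p ell" using p_gt_3 by (simp add: witt_index_def)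
  thus ?thesis using assms by (simp add: D_xvar vcoeff_def vfield_e arc_def)
qed

text \<open>Partial derivatives of x_j are constants, which the defect kills; so all partial
  derivatives of the defect of x_j vanish and it is a constant c. The Euler field e_0 t^0 fixes x_j
  but kills c, hence c = 0.\<close>

lemma defect_Rring:
  assumes "x \<in> W" "f \<in> Rring"
  shows "defect x f = 0"
proof -
  have "defect x (xvar j) = 0" if j: "j \<le> ell" for j
  proof -
    have Dn: "(D x ^^ n) (xvar j) \<in> Rring" for n
      by (induction n) (auto simp: D_in_Rring Rring.xvar j)
    hence "(D x ^^ p) (xvar j) + const_ga (-1) * D (pm x) (xvar j) \<in> Rring"
      by (intro Rring.add Rring.mult Rring.const D_in_Rring Rring.xvar j)
    hence dR: "defect x (xvar j) \<in> Rring"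
      by (simp add: defect_def const_ga_uminus)
    have "dvar i (defect x (xvar j)) = 0" if i: "i \<le> ell" for i
    proof -
      have "dvar i (defect x (xvar j)) = defect x (dvar i (xvar j))"
        using defect_commute[of x "e (-1) i" "xvar j"] assms i j by (simp add: D_e_minus_1 Rring.xvar)
      also have "\<dots> = 0"
        using defect_const[of x 1] derivation_0[OF derivation_defect] i j by (simp add: dvar_xvar)
      finally show ?thesis .
    qed
    from Rring_constant[OF dR this] obtain c where c: "defect x (xvar j) = const_ga c" by blast
    have "defect x (D (e 0 0) (xvar j)) = D (e 0 0) (defect x (xvar j))"
      using assms j by (intro defect_commute Rring.xvar) auto
    thus ?thesis using c j by (simp add: D_e_0_0)
  qed
  thus ?thesis
    \<comment> \<open>The zero derivation is presented as 0 times the defect.\<close>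
    using derivation_eq_on_Rring[OF derivation_defect[of x] derivation_scaled[OF derivation_defect[of x], of 0] _ _ assms(2)]
    by (simp add: defect_const)
qed

text \<open>\<open>D x ^^ n\<close> multiplies \<open>uexp s\<close> by the value at \<open>s\<close> of the following polynomial. As
  \<open>D x ^^ p\<close> is a derivation and \<open>uexp\<close> turns sums into products, this value is additive in \<open>s\<close> for
  \<open>n = p\<close>, so that only the coefficients at \<open>1\<close> and \<open>p\<close> survive.\<close>

fun iter_poly :: "'k current \<Rightarrow> nat \<Rightarrow> 'k grp_alg poly" where
  "iter_poly x 0 = 1"
| "iter_poly x (Suc n) = map_poly (D x) (iter_poly x n) + pCons 0 (smult (Lfun x) (iter_poly x n))"

lemma poly_map_poly_D: "poly (map_poly (D x) q) (const_ga s) = D x (poly q (const_ga s))"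
  by (induction q)
    (auto simp: map_poly_pCons derivation_0[OF derivation_D] derivation_add[OF derivation_D] D_const_mult)

lemma D_funpow_uexp: "(D x ^^ n) (uexp s) = poly (iter_poly x n) (const_ga s) * uexp s"
proof (induction n)
  case (Suc n)
  thus ?case
    by (simp add: poly_map_poly_D derivation_mult[OF derivation_D] D_uexp algebra_simps)
qed simp

lemma coeff_iter_poly_Suc:
  "coeff (iter_poly x (Suc n)) i =
     D x (coeff (iter_poly x n) i) + (if i = 0 then 0 else Lfun x * coeff (iter_poly x n) (i - 1))"
  by (simp add: coeff_map_poly derivation_0[OF derivation_D] coeff_pCons split: nat.split)

lemma coeff_iter_poly_gt: "n < i \<Longrightarrow> coeff (iter_poly x n) i = 0"
proof (induction n arbitrary: i)
  case (Suc n)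
  thus ?case by (simp only: coeff_iter_poly_Suc) (simp add: derivation_0[OF derivation_D])
qed simp

lemma coeff_iter_poly_diag: "coeff (iter_poly x n) n = Lfun x ^ n"
proof (induction n)
  case (Suc n)
  thus ?case
    by (simp only: coeff_iter_poly_Suc) (simp add: coeff_iter_poly_gt derivation_0[OF derivation_D])
qed simp

lemma coeff_iter_poly_0: "coeff (iter_poly x (Suc n)) 0 = 0"
proof (induction n)
  case (Suc n)
  thus ?case by (simp only: coeff_iter_poly_Suc[of _ "Suc n"]) (simp add: derivation_0[OF derivation_D])
qed (simp only: coeff_iter_poly_Suc, simp add: derivation_1[OF derivation_D])

lemma coeff_iter_poly_1: "coeff (iter_poly x (Suc n)) 1 = (D x ^^ n) (Lfun x)"
proof (induction n)
  case 0
  show ?case by (simp only: coeff_iter_poly_Suc) (simp add: derivation_0[OF derivation_D])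
next
  case (Suc n)
  have "coeff (iter_poly x (Suc (Suc n))) 1 = D x (coeff (iter_poly x (Suc n)) 1)"
    using coeff_iter_poly_0[where x = x and n = n] by (subst coeff_iter_poly_Suc) (simp del: iter_poly.simps)
  thus ?case by (simp only: Suc) simp
qed

lemma iter_poly_additive:
  "poly (iter_poly x p) (const_ga (s + t)) = poly (iter_poly x p) (const_ga s) + poly (iter_poly x p) (const_ga t)"
  (is "?P (s + t) = _")
proof -
  have "?P (s + t) * uexp (s + t) = (D x ^^ p) (uexp s * uexp t)"
    by (simp add: D_funpow_uexp flip: uexp_add)
  also have "\<dots> = (?P s + ?P t) * uexp (s + t)"
    by (simp add: derivation_mult[OF derivation_Dp] D_funpow_uexp uexp_add algebra_simps)
  finally have "?P (s + t) * uexp (s + t) * uexp (- (s + t)) = (?P s + ?P t) * uexp (s + t) * uexp (- (s + t))"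
    by simp
  thus ?thesis by (simp only: mult.assoc uexp_inverse mult_1_right)
qed

lemma coeff_iter_poly_middle:
  assumes "2 \<le> n" "n < p"
  shows "coeff (iter_poly x p) n = 0"
proof (rule poly_mapping_eqI)
  fix m
  \<comment> \<open>Additivity is known at the constants \<open>const_ga s\<close>. Reading off one
    coordinate m gives a polynomial with coefficients in the infinite ground field.\<close>
  define q where "q = map_poly (\<lambda>b. lookup b m) (iter_poly x p)"
  have q: "poly q s = lookup (poly (iter_poly x p) (const_ga s)) m" for s
  proof -
    have "poly (map_poly (\<lambda>b. lookup b m) r) s = lookup (poly r (const_ga s)) m"
      for r :: "'k grp_alg poly"
      by (induction r) (auto simp: map_poly_pCons lookup_add lookup_const_ga_mult)
    thus ?thesis by (simp add: q_def)
  qed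
  have "coeff q n = 0"
  proof (rule additive_poly_coeff[OF alg_closed_infinite _ assms(1)])
    show "poly q (s + t) = poly q s + poly q t" for s t
      by (simp add: q iter_poly_additive lookup_add)
    show "of_nat n \<noteq> (0::'k)"
      using assms char by (auto simp: of_nat_eq_0_iff_char_dvd dest: nat_dvd_not_less)
  qed
  thus "lookup (coeff (iter_poly x p) n) m = lookup 0 m"
    by (simp add: q_def coeff_map_poly)
qed

text \<open>The classical formula (D + L)^p = D^p + D^(p-1)(L) + L^p for a derivation D and
  multiplication by L, evaluated at 1. The two terms are the coefficients at 1 and p, the only ones
  left, summed at s = 1.\<close>

lemma Dp_uexp_1: "(D x ^^ p) (uexp 1) = ((D x ^^ (p - 1)) (Lfun x) + Lfun x ^ p) * uexp 1"
proof -
  have p: "p = Suc (p - 1)" using p_gt_3 by simp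
  have "degree (iter_poly x p) \<le> p" by (intro degree_le allI impI coeff_iter_poly_gt)
  hence "poly (iter_poly x p) 1 = (\<Sum>i\<le>p. coeff (iter_poly x p) i)"
    unfolding poly_altdef by (intro sum.mono_neutral_cong_left) (auto simp: coeff_eq_0)
  also have "\<dots> = (\<Sum>i\<in>{1, p}. coeff (iter_poly x p) i)"
  proof (intro sum.mono_neutral_right ballI)
    fix i assume i: "i \<in> {..p} - {1, p}"
    show "coeff (iter_poly x p) i = 0"
    proof (cases "i = 0")
      case True
      thus ?thesis using coeff_iter_poly_0[where x = x and n = "p - 1"] p by (simp del: iter_poly.simps)
    next
      case False
      thus ?thesis using i by (intro coeff_iter_poly_middle) auto
    qed
  qed (use p_gt_3 in auto)
  also have "\<dots> = (D x ^^ (p - 1)) (Lfun x) + Lfun x ^ p"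
    using p_gt_3 coeff_iter_poly_1[where x = x and n = "p - 1"] coeff_iter_poly_diag[where x = x and n = p] p
    by (simp del: iter_poly.simps)
  finally show ?thesis using D_funpow_uexp[where x = x and n = p and s = 1] by simp
qed

section \<open>The p-character of the twisted module\<close>

lemma chi_eq:
  assumes "x \<in> W"
  shows "\<chi> x = (\<Sum>k\<le>ell. lookup x (-1, k) * \<chi> (e (-1) k))"
  using assms
proof (induction x rule: W_induct)
  case (e i k c)
  have "(\<Sum>j\<le>ell. lookup (local.e i k) (-1, j) * \<chi> (local.e (-1) j)) = \<chi> (local.e i k)"
  proof (cases "i = -1")
    case True
    hence "lookup (local.e i k) (-1, j) = (if j = k then 1 else 0)" for j
      using e by (simp add: lookup_witt_e)
    hence "(\<Sum>j\<le>ell. lookup (local.e i k) (-1, j) * \<chi> (local.e (-1) j)) =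
        (\<Sum>j\<le>ell. if j = k then \<chi> (local.e (-1) j) else 0)"
      by (intro sum.cong) simp_all
    thus ?thesis using True e by (simp add: witt_index_def)
  next
    case False
    hence "\<chi> (local.e i k) = 0" using e by (intro chi_W0 e_in_filt) (simp add: witt_index_def)
    thus ?thesis using False by (simp add: lookup_witt_e)
  qed
  thus ?case using e_in_W[of i k] by (simp add: chi_scale mult.assoc flip: sum_distrib_left)
next
  case (add x y)
  thus ?case by (simp add: chi_add lookup_add distrib_right sum.distrib)
qed

lemma nil_power:
  assumes "m > 0"
  shows "fps_nth (arc ^ m) n ^ p = 0"
proof -
  obtain m' where m: "m = Suc m'" using assms by (cases m) auto
  have "fps_nth arc i ^ p = 0" for i
    using p_gt_3 by (simp add: arc_def xvar_power_p power_0_left)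
  hence "(\<Sum>i=0..n. fps_nth arc i * fps_nth (arc ^ m') (n - i)) ^ p = 0"
    by (simp add: freshmans_dream_sum[where n = p] prime_CHAR prime_p power_mult_distrib)
  thus ?thesis by (simp add: m fps_mult_nth)
qed

text \<open>Taking p-th powers kills the coefficients of every positive power of the arc. What
  survives comes from i = -1, where that power is 1.\<close>

lemma vcoeff_power_p:
  assumes "k \<le> ell"
  shows "vcoeff x k ^ p = const_ga (lookup x (-1, k) ^ p)"
proof -
  have "vcoeff x k ^ p = (\<Sum>b\<in>witt_index p ell.
     (const_ga (lookup x b) * fps_nth (fps_X ^ snd b * arc ^ nat (fst b + 1)) k) ^ p)"
    unfolding vcoeff_eq by (rule freshmans_dream_sum) (simp_all only: prime_CHAR prime_p)
  also have "\<dots> = (\<Sum>b\<in>witt_index p ell. if b = (-1, k) then const_ga (lookup x (-1, k) ^ p) else 0)"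
  proof (intro sum.cong refl)
    fix b assume b: "b \<in> witt_index p ell"
    obtain i j where ij: "b = (i, j)" by (cases b)
    show "(const_ga (lookup x b) * fps_nth (fps_X ^ snd b * arc ^ nat (fst b + 1)) k) ^ p =
      (if b = (-1, k) then const_ga (lookup x (-1, k) ^ p) else 0)"
    proof (cases "i = -1")
      case True
      thus ?thesis using ij p_gt_3 by (auto simp: const_ga_power power_0_left)
    next
      case False
      hence "nat (i + 1) > 0" using b ij by (simp add: witt_index_def)
      hence "fps_nth (fps_X ^ j * arc ^ nat (i + 1)) k ^ p = 0"
        using nil_power p_gt_3 by (simp add: fps_X_power_mult_nth power_0_left)
      thus ?thesis using False ij by (simp add: power_mult_distrib)
    qed
  qed
  also have "\<dots> = const_ga (lookup x (-1, k) ^ p)"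
    using assms p_gt_3 by (simp add: witt_index_def)
  finally show ?thesis .
qed

lemma Lfun_power_p:
  assumes "x \<in> W"
  shows "Lfun x ^ p = const_ga (\<chi> x ^ p)"
proof -
  have "Lfun x ^ p = (\<Sum>k\<le>ell. (vcoeff x k * const_ga (\<chi> (e (-1) k))) ^ p)"
    unfolding Lfun_def by (rule freshmans_dream_sum) (simp_all only: prime_CHAR prime_p)
  also have "\<dots> = (\<Sum>k\<le>ell. const_ga ((lookup x (-1, k) * \<chi> (e (-1) k)) ^ p))"
    by (intro sum.cong refl) (simp add: power_mult_distrib vcoeff_power_p const_ga_mult const_ga_power)
  also have "\<dots> = const_ga (\<chi> x ^ p)"
    unfolding chi_eq[OF assms]
    by (subst freshmans_dream_sum) (simp_all only: prime_CHAR prime_p char const_ga_sum)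
  finally show ?thesis .
qed

text \<open>Let g be the linear function with coefficients \<chi>(y_k), so that
  \<open>Lfun y = D y g\<close>. Then D^(p-1) (Lfun x) = D^p g = D (pm x) g = Lfun (pm x), which is
  the twist belonging to \<open>pm x\<close>, while Lfun x ^ p is the constant \<chi>(x)^p.\<close>

lemma Dp_modset:
  assumes x: "x \<in> W" and b: "b \<in> modset"
  shows "(D x ^^ p) b = D (pm x) b + const_ga (\<chi> x ^ p) * b"
proof -
  from b obtain f where f: "b = f * uexp 1" "f \<in> Rring" by (auto simp: modset_def)
  define g where "g = (\<Sum>k\<le>ell. const_ga (\<chi> (e (-1) k)) * xvar k)"
  have gR: "g \<in> Rring"
    unfolding g_def by (intro Rring_sum Rring.mult Rring.const Rring.xvar) simp
  have L: "Lfun y = D y g" for y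
    unfolding Lfun_def g_def
    by (simp add: derivation_sum[OF derivation_D] derivation_mult[OF derivation_D] D_xvar mult.commute)
  have "(D x ^^ (p - 1)) (Lfun x) = (D x ^^ Suc (p - 1)) g"
    by (simp only: L funpow_Suc_right o_apply)
  also have "Suc (p - 1) = p" using p_gt_3 by simp
  also have "(D x ^^ p) g = Lfun (pm x)"
    using defect_Rring[OF x gR] by (simp add: defect_def L)
  finally have u: "(D x ^^ p) (uexp 1) = (Lfun (pm x) + const_ga (\<chi> x ^ p)) * uexp 1"
    by (simp add: Dp_uexp_1 Lfun_power_p[OF x])
  have "(D x ^^ p) f = D (pm x) f"
    using defect_Rring[OF x f(2)] by (simp add: defect_def)
  thus ?thesis
    by (simp add: f(1) derivation_mult[OF derivation_Dp] derivation_mult[OF derivation_D] u D_uexp algebra_simps)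
qed

end

section \<open>Reduced enveloping algebras\<close>

locale closed_lie =
  fixes p :: nat and L :: "('k::field, 'l::ab_group_add) restricted_lie" and \<chi> :: "'l \<Rightarrow> 'k"
  assumes lie_closed: "x \<in> lcarrier L \<Longrightarrow> y \<in> lcarrier L \<Longrightarrow> x + y \<in> lcarrier L"
    "x \<in> lcarrier L \<Longrightarrow> lscale L c x \<in> lcarrier L"
    "x \<in> lcarrier L \<Longrightarrow> y \<in> lcarrier L \<Longrightarrow> lbracket L x y \<in> lcarrier L"
    "x \<in> lcarrier L \<Longrightarrow> pmap L x \<in> lcarrier L"
begin

abbreviation FA :: "('k, 'l) free_alg ring" where "FA \<equiv> free_algebra L"
abbreviation EA :: "('k, 'l) env ring" where "EA \<equiv> env_algebra L"
abbreviation UA :: "('k, 'l) red_env ring" where "UA \<equiv> red_env_algebra p L \<chi>"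

lemma FA_simps [simp]:
  "f \<otimes>\<^bsub>FA\<^esub> g = f * g" "\<one>\<^bsub>FA\<^esub> = 1" "\<zero>\<^bsub>FA\<^esub> = 0" "f \<oplus>\<^bsub>FA\<^esub> g = f + g"
  by (simp_all add: free_algebra_def)

lemma FA_carrier: "f \<in> carrier FA \<longleftrightarrow> (\<forall>w\<in>keys f. set (letters w) \<subseteq> lcarrier L)"
  by (simp add: free_algebra_def)

lemma FA_add: "f \<in> carrier FA \<Longrightarrow> g \<in> carrier FA \<Longrightarrow> f + g \<in> carrier FA"
  unfolding FA_carrier using keys_add[of f g] by blast

lemma FA_mult: "f \<in> carrier FA \<Longrightarrow> g \<in> carrier FA \<Longrightarrow> f * g \<in> carrier FA"
  unfolding FA_carrier
proof
  fix w assume fg: "\<forall>w\<in>keys f. set (letters w) \<subseteq> lcarrier L"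
    "\<forall>w\<in>keys g. set (letters w) \<subseteq> lcarrier L" and "w \<in> keys (f * g)"
  then obtain a b where "w = a + b" "a \<in> keys f" "b \<in> keys g"
    using keys_mult[of f g] by blast
  thus "set (letters w) \<subseteq> lcarrier L" using fg by (auto simp: plus_fmonoid_def)
qed

lemma FA_uminus: "f \<in> carrier FA \<Longrightarrow> - f \<in> carrier FA"
  by (simp add: FA_carrier)

lemma FA_fgen: "x \<in> lcarrier L \<Longrightarrow> fgen x \<in> carrier FA"
  by (simp add: FA_carrier fgen_def)

lemma FA_fconst: "fconst c \<in> carrier FA"
  by (simp add: FA_carrier fconst_def zero_fmonoid_def)

lemma ring_FA: "ring FA"
proof (rule ringI)
  have 0: "0 \<in> carrier FA" and 1: "1 \<in> carrier FA"
    by (auto simp: FA_carrier zero_fmonoid_def)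
  show "abelian_group FA"
    by (rule abelian_groupI) (auto simp: 0 FA_add add_ac intro!: bexI[of _ "- _"] FA_uminus)
  show "monoid FA"
    by (rule monoidI) (auto simp: 1 FA_mult mult.assoc)
qed (auto simp: ring_distribs)

sublocale FA: ring FA by (rule ring_FA)

lemma FA_a_inv: "f \<in> carrier FA \<Longrightarrow> \<ominus>\<^bsub>FA\<^esub> f = - f"
  by (rule FA.minus_equality) (auto simp: FA_uminus)

lemma FA_minus: "f \<in> carrier FA \<Longrightarrow> g \<in> carrier FA \<Longrightarrow> f \<ominus>\<^bsub>FA\<^esub> g = f - g"
  by (simp add: a_minus_def FA_a_inv)

lemma FA_diff: "f \<in> carrier FA \<Longrightarrow> g \<in> carrier FA \<Longrightarrow> f - g \<in> carrier FA"
  using FA_add[of f "- g"] FA_uminus[of g] by simp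

lemma FA_pow: "f [^]\<^bsub>FA\<^esub> (n::nat) = f ^ n"
  by (induction n) (auto simp: power_Suc2 simp del: power_Suc)

lemma fconst_simps: "fconst (c + d) = fconst c + fconst d" "fconst (c * d) = fconst c * fconst d"
  "fconst 1 = 1" "fconst 0 = 0" "fconst (- c) = - fconst c"
  by (simp_all add: fconst_def single_add mult_single single_uminus)

lemma fconst_commute: "fconst c * f = f * fconst c"
  by (induction f rule: poly_mapping_single_induct)
    (simp_all add: fconst_def mult_single mult.commute ring_distribs)

lemma FA_induct [consumes 1, case_names const gen add mult]:
  assumes "f \<in> carrier FA" "\<And>c. P (fconst c)" "\<And>x. x \<in> lcarrier L \<Longrightarrow> P (fgen x)"
    and "\<And>f g. f \<in> carrier FA \<Longrightarrow> g \<in> carrier FA \<Longrightarrow> P f \<Longrightarrow> P g \<Longrightarrow> P (f + g)"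
    and "\<And>f g. f \<in> carrier FA \<Longrightarrow> g \<in> carrier FA \<Longrightarrow> P f \<Longrightarrow> P g \<Longrightarrow> P (f * g)"
  shows "P f"
proof -
  have word: "P (single (Fmonoid xs) c) \<and> single (Fmonoid xs) c \<in> carrier FA"
    if "set xs \<subseteq> lcarrier L" for xs c
    using that
  proof (induction xs)
    case Nil
    show ?case using assms(2)[of c] FA_fconst[of c] by (simp add: fconst_def zero_fmonoid_def)
  next
    case (Cons x xs)
    have "single (Fmonoid (x # xs)) c = fgen x * single (Fmonoid xs) c"
      by (simp add: fgen_def mult_single plus_fmonoid_def)
    thus ?case using Cons assms(3,5) FA_fgen FA_mult by simp
  qed
  have "P (\<Sum>w\<in>A. single w (lookup f w)) \<and>
      (\<Sum>w\<in>A. single w (lookup f w)) \<in> carrier FA"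
    if "finite A" "A \<subseteq> keys f" for A
    using that
  proof (induction A rule: finite_induct)
    case empty
    show ?case using assms(2)[of 0] FA_fconst[of 0] by (simp add: fconst_simps)
  next
    case (insert w A)
    obtain xs where w: "w = Fmonoid xs" by (cases w)
    have "set xs \<subseteq> lcarrier L"
      using bspec[OF assms(1)[unfolded FA_carrier], of w] insert.prems w by simp
    from word[OF this] show ?case using insert w assms(4) FA_add by simp
  qed
  from this[of "keys f"]
  have "P (\<Sum>w\<in>keys f. single w (lookup f w))" by simp
  also have "(\<Sum>w\<in>keys f. single w (lookup f w)) = f"
    by (rule poly_mapping_eqI) (auto simp: lookup_sum lookup_single when_def in_keys_iff)
  finally show ?thesis .
qed

lemma env_rels_subset: "env_rels L \<subseteq> carrier FA"
  by (auto simp: env_rels_def lie_closed intro!: FA_diff FA_mult FA_fgen FA_fconst)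

lemma ideal_env: "ideal (env_ideal L) FA"
  unfolding env_ideal_def by (rule FA.genideal_ideal[OF env_rels_subset])

lemma ring_EA: "ring EA"
  unfolding env_algebra_def by (rule ideal.quotient_is_ring[OF ideal_env])

sublocale EA: ring EA by (rule ring_EA)

lemma env_class_hom: "env_class L \<in> ring_hom FA EA"
proof -
  have "env_class L = (+>\<^bsub>FA\<^esub>) (env_ideal L)" by (rule ext) (simp add: env_class_def)
  thus ?thesis using ideal.rcos_ring_hom[OF ideal_env] by (simp add: env_algebra_def)
qed

lemma EA_carrier: "carrier EA = env_class L ` carrier FA"
  by (auto simp: env_algebra_def FactRing_def A_RCOSETS_def' env_class_def)

lemma env_class_eq_iff:
  assumes "f \<in> carrier FA" "g \<in> carrier FA"
  shows "env_class L f = env_class L g \<longleftrightarrow> f - g \<in> env_ideal L"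
  using FA.quotient_eq_iff_same_a_r_cos[OF ideal_env assms] assms by (simp add: FA_minus env_class_def)

interpretation env_class: ring_hom_ring FA EA "env_class L"
  using env_class_hom ring_FA ring_EA by (simp add: ring_hom_ring_def ring_hom_ring_axioms_def)

definition prel :: "'l \<Rightarrow> ('k, 'l) free_alg" where
  "prel x = fgen x ^ p - fgen (pmap L x) - fconst (\<chi> x ^ p)"

lemma FA_power: "f \<in> carrier FA \<Longrightarrow> f ^ n \<in> carrier FA"
  using FA.nat_pow_closed[of f n] by (simp add: FA_pow)

lemma prel_closed: "x \<in> lcarrier L \<Longrightarrow> prel x \<in> carrier FA"
  by (auto simp: prel_def lie_closed intro!: FA_diff FA_power FA_fgen FA_fconst)

lemma env_class_diff:
  "f \<in> carrier FA \<Longrightarrow> g \<in> carrier FA \<Longrightarrow> env_class L (f - g) = env_class L f \<ominus>\<^bsub>EA\<^esub> env_class L g"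
  using env_class.hom_add[of f "- g"] env_class.hom_a_inv[of g] by (simp add: a_minus_def FA_uminus FA_a_inv del: env_class.hom_a_inv)

lemma env_class_power: "f \<in> carrier FA \<Longrightarrow> env_class L (f ^ n) = env_class L f [^]\<^bsub>EA\<^esub> (n::nat)"
proof (induction n)
  case (Suc n)
  thus ?case using env_class.hom_mult[of "f ^ n" f]
    by (simp add: FA_power power_Suc2 del: power_Suc)
qed (use env_class.hom_one in simp)

lemma red_ideal_eq: "red_ideal p L \<chi> = Idl\<^bsub>EA\<^esub> ((\<lambda>x. env_class L (prel x)) ` lcarrier L)"
proof -
  have "env_class L (prel x) = env_class L (fgen x) [^]\<^bsub>EA\<^esub> p
        \<ominus>\<^bsub>EA\<^esub> env_class L (fgen (pmap L x)) \<ominus>\<^bsub>EA\<^esub> env_class L (fconst (\<chi> x ^ p))"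
    if "x \<in> lcarrier L" for x
    using that by (simp add: prel_def env_class_diff FA_diff FA_power FA_fgen FA_fconst lie_closed env_class_power)
  thus ?thesis unfolding red_ideal_def by (intro arg_cong[where f = "genideal EA"]) auto
qed

lemma ideal_red: "ideal (red_ideal p L \<chi>) EA"
  unfolding red_ideal_eq by (intro EA.genideal_ideal) (auto simp: prel_closed)

lemma ring_UA: "ring UA"
  unfolding red_env_algebra_def by (rule ideal.quotient_is_ring[OF ideal_red])

sublocale UA: ring UA by (rule ring_UA)

definition pr :: "('k, 'l) free_alg \<Rightarrow> ('k, 'l) red_env" where
  "pr f = red_ideal p L \<chi> +>\<^bsub>EA\<^esub> env_class L f"

lemma pr_hom: "pr \<in> ring_hom FA UA"
proof -
  have "(+>\<^bsub>EA\<^esub>) (red_ideal p L \<chi>) \<in> ring_hom EA UA"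
    using ideal.rcos_ring_hom[OF ideal_red] by (simp add: red_env_algebra_def)
  from ring_hom_trans[OF env_class_hom this] show ?thesis
    by (simp add: pr_def[abs_def] comp_def)
qed

sublocale pr: ring_hom_ring FA UA pr
  using pr_hom ring_FA ring_UA by (simp add: ring_hom_ring_def ring_hom_ring_axioms_def)

lemma UA_carrier: "carrier UA = pr ` carrier FA"
  by (auto simp: red_env_algebra_def FactRing_def A_RCOSETS_def' EA_carrier pr_def)

lemma pr_power: "f \<in> carrier FA \<Longrightarrow> pr (f ^ n) = pr f [^]\<^bsub>UA\<^esub> (n::nat)"
proof (induction n)
  case (Suc n)
  thus ?case using pr.hom_mult[of "f ^ n" f]
    by (simp add: FA_power power_Suc2 del: power_Suc)
qed (use pr.hom_one in simp)

lemma pr_eq_iff: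
  assumes "f \<in> carrier FA" "g \<in> carrier FA"
  shows "pr f = pr g \<longleftrightarrow> env_class L (f - g) \<in> red_ideal p L \<chi>"
  using EA.quotient_eq_iff_same_a_r_cos[OF ideal_red, of "env_class L f" "env_class L g"] assms
  by (simp add: pr_def env_class_diff)

lemma pr_eq_0_iff:
  assumes "f \<in> carrier FA"
  shows "pr f = \<zero>\<^bsub>UA\<^esub> \<longleftrightarrow> env_class L f \<in> red_ideal p L \<chi>"
  using pr_eq_iff[OF assms FA.zero_closed] pr.hom_zero by simp

lemma pr_eqI:
  assumes "f \<in> carrier FA" "g \<in> carrier FA" "pr (f - g) = \<zero>\<^bsub>UA\<^esub>"
  shows "pr f = pr g"
  using assms pr_eq_0_iff[OF FA_diff[OF assms(1,2)]] by (simp add: pr_eq_iff)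

lemma pr_env_rels: "f \<in> env_rels L \<Longrightarrow> pr f = \<zero>\<^bsub>UA\<^esub>"
proof -
  assume f: "f \<in> env_rels L"
  hence fF: "f \<in> carrier FA" using env_rels_subset by blast
  have "f \<in> env_ideal L" using f FA.genideal_self[OF env_rels_subset] by (auto simp: env_ideal_def)
  hence "env_class L f = env_class L 0" using fF FA.zero_closed by (simp add: env_class_eq_iff)
  also have "\<dots> = \<zero>\<^bsub>EA\<^esub>" using env_class.hom_zero by simp
  finally show ?thesis using fF ideal.axioms(1)[OF ideal_red]
    by (simp add: pr_eq_0_iff additive_subgroup.zero_closed)
qed

lemma pr_prel: "x \<in> lcarrier L \<Longrightarrow> pr (prel x) = \<zero>\<^bsub>UA\<^esub>"
proof -
  assume x: "x \<in> lcarrier L"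
  have "(\<lambda>x. env_class L (prel x)) ` lcarrier L \<subseteq> carrier EA"
    by (auto simp: prel_closed)
  from EA.genideal_self[OF this] x show ?thesis
    by (auto simp: pr_eq_0_iff prel_closed red_ideal_eq)
qed

text \<open>The two successive quotients act as one: every ideal of the free algebra containing both
  kinds of relations contains the kernel of \<open>pr\<close>, because its image in the enveloping
  algebra is an ideal containing the generators of \<open>red_ideal\<close>.\<close>

lemma pr_kernel:
  assumes J: "ideal J FA" "env_rels L \<subseteq> J" "\<And>x. x \<in> lcarrier L \<Longrightarrow> prel x \<in> J"
    and f: "f \<in> carrier FA" "pr f = \<zero>\<^bsub>UA\<^esub>"
  shows "f \<in> J"
proof -
  have EJ: "env_ideal L \<subseteq> J"
    unfolding env_ideal_def by (rule FA.genideal_minimal[OF J(1,2)])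
  have "ideal (env_class L ` J) EA"
    using FA.ring_ideal_imp_quot_ideal[OF ideal_env J(1)]
    by (simp add: env_algebra_def env_class_def[abs_def])
  hence "red_ideal p L \<chi> \<subseteq> env_class L ` J"
    unfolding red_ideal_eq by (rule EA.genideal_minimal) (use J(3) in auto)
  then obtain j where j: "j \<in> J" "env_class L f = env_class L j"
    using f by (auto simp: pr_eq_0_iff)
  have jF: "j \<in> carrier FA" using j(1) ideal.Icarr[OF J(1)] by simp
  hence "f - j \<in> J" using j(2) f(1) EJ by (auto simp: env_class_eq_iff)
  hence "(f - j) + j \<in> J"
    using additive_subgroup.a_closed[OF ideal.axioms(1)[OF J(1)], of "f - j" j] j(1) by simp
  thus ?thesis by simp
qed

text \<open>Elements of the algebra are sets of cosets. This gives access to their members, through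
  which \<open>red_env_char\<close> and \<open>red_env_incl\<close> are defined.\<close>

lemma pr_coset:
  assumes f: "f \<in> carrier FA"
  shows "pr f \<noteq> {}" and "X \<in> pr f \<Longrightarrow> X \<noteq> {}"
    and "X \<in> pr f \<Longrightarrow> g \<in> X \<Longrightarrow> g \<in> carrier FA \<and> pr g = pr f \<and> X = env_class L g"
proof -
  interpret I: ideal "env_ideal L" FA by (rule ideal_env)
  interpret R: ideal "red_ideal p L \<chi>" EA by (rule ideal_red)
  have fE: "env_class L f \<in> carrier EA" using f by simp
  show "pr f \<noteq> {}" using R.a_rcos_self[OF fE] by (auto simp: pr_def)
  assume X: "X \<in> pr f"
  hence "X \<in> carrier EA"
    using R.a_rcosets_carrier[of "pr f"] fE by (auto simp: pr_def A_RCOSETS_def')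
  then obtain h where h: "h \<in> carrier FA" "X = env_class L h" by (auto simp: EA_carrier)
  have "pr f = pr h"
    using R.a_repr_independence'[of X "env_class L f"] X fE h by (simp add: pr_def)
  show "X \<noteq> {}" using I.a_rcos_self[OF h(1)] h(2) by (auto simp: env_class_def)
  show "g \<in> carrier FA \<and> pr g = pr f \<and> X = env_class L g" if g: "g \<in> X"
  proof -
    have "g \<in> carrier FA"
      using g h I.a_rcosets_carrier[of X] by (auto simp: env_class_def A_RCOSETS_def')
    moreover have "env_class L h = env_class L g"
      using I.a_repr_independence'[of g h] g h by (simp add: env_class_def)
    ultimately show ?thesis using h(2) \<open>pr f = pr h\<close> by (simp add: pr_def)
  qed
qed

section \<open>Generators and relations of the reduced enveloping algebra\<close>

definition ug :: "'l \<Rightarrow> ('k, 'l) red_env" where "ug x = pr (fgen x)"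
definition uc :: "'k \<Rightarrow> ('k, 'l) red_env" where "uc c = pr (fconst c)"

lemma ug_closed [simp]: "x \<in> lcarrier L \<Longrightarrow> ug x \<in> carrier UA"
  by (simp add: ug_def FA_fgen)

lemma uc_closed [simp]: "uc c \<in> carrier UA"
  by (simp add: uc_def FA_fconst)

lemma uc_simps: "uc (c + d) = uc c \<oplus>\<^bsub>UA\<^esub> uc d" "uc (c * d) = uc c \<otimes>\<^bsub>UA\<^esub> uc d"
  "uc 1 = \<one>\<^bsub>UA\<^esub>" "uc 0 = \<zero>\<^bsub>UA\<^esub>"
  using pr.hom_add[OF FA_fconst[of c] FA_fconst[of d]] pr.hom_mult[OF FA_fconst[of c] FA_fconst[of d]]
    pr.hom_one pr.hom_zero
  by (simp_all add: uc_def fconst_simps)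

lemma uc_commute:
  assumes "a \<in> carrier UA"
  shows "uc c \<otimes>\<^bsub>UA\<^esub> a = a \<otimes>\<^bsub>UA\<^esub> uc c"
proof -
  obtain f where "a = pr f" "f \<in> carrier FA" using assms by (auto simp: UA_carrier)
  thus ?thesis using pr.hom_mult[OF FA_fconst[of c], of f] pr.hom_mult[of f, OF _ FA_fconst[of c]]
    by (simp add: uc_def fconst_commute)
qed

lemma ug_add:
  assumes "x \<in> lcarrier L" "y \<in> lcarrier L"
  shows "ug (x + y) = ug x \<oplus>\<^bsub>UA\<^esub> ug y"
proof -
  have F: "fgen (x + y) \<in> carrier FA" "fgen x \<in> carrier FA" "fgen y \<in> carrier FA"
    using assms by (auto intro!: FA_fgen lie_closed)
  have "fgen (x + y) - fgen x - fgen y \<in> env_rels L"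
    using assms unfolding env_rels_def by blast
  hence "pr (fgen (x + y) - (fgen x + fgen y)) = \<zero>\<^bsub>UA\<^esub>"
    using pr_env_rels by (simp add: diff_diff_eq)
  from pr_eqI[OF F(1) FA_add[OF F(2,3)] this] show ?thesis
    using F pr.hom_add[OF F(2,3)]
    by (simp add: ug_def)
qed

lemma ug_scale:
  assumes "x \<in> lcarrier L"
  shows "ug (lscale L c x) = uc c \<otimes>\<^bsub>UA\<^esub> ug x"
proof -
  have F: "fgen (lscale L c x) \<in> carrier FA" "fgen x \<in> carrier FA"
    using assms by (auto intro!: FA_fgen lie_closed)
  have "fgen (lscale L c x) - fconst c * fgen x \<in> env_rels L"
    using assms unfolding env_rels_def by blast
  hence "pr (fgen (lscale L c x) - fconst c * fgen x) = \<zero>\<^bsub>UA\<^esub>"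
    by (rule pr_env_rels)
  from pr_eqI[OF F(1) FA_mult[OF FA_fconst F(2)] this] show ?thesis
    using F pr.hom_mult[OF FA_fconst F(2), of c]
    by (simp add: ug_def uc_def)
qed

lemma ug_br:
  assumes "x \<in> lcarrier L" "y \<in> lcarrier L"
  shows "ug x \<otimes>\<^bsub>UA\<^esub> ug y = ug y \<otimes>\<^bsub>UA\<^esub> ug x \<oplus>\<^bsub>UA\<^esub> ug (lbracket L x y)"
proof -
  have F: "fgen (lbracket L x y) \<in> carrier FA" "fgen x \<in> carrier FA" "fgen y \<in> carrier FA"
    using assms by (auto intro!: FA_fgen lie_closed)
  have "fgen x * fgen y - fgen y * fgen x - fgen (lbracket L x y) \<in> env_rels L"
    using assms unfolding env_rels_def by blast
  hence "pr (fgen x * fgen y - (fgen y * fgen x + fgen (lbracket L x y))) = \<zero>\<^bsub>UA\<^esub>"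
    using pr_env_rels by (simp add: diff_diff_eq)
  from pr_eqI[OF FA_mult[OF F(2,3)] FA_add[OF FA_mult[OF F(3,2)] F(1)] this] show ?thesis
    using F pr.hom_mult[OF F(2,3)] pr.hom_mult[OF F(3,2)] pr.hom_add[OF FA_mult[OF F(3,2)] F(1)]
    by (simp add: ug_def)
qed

lemma ug_pow:
  assumes "x \<in> lcarrier L"
  shows "ug x [^]\<^bsub>UA\<^esub> p = ug (pmap L x) \<oplus>\<^bsub>UA\<^esub> uc (\<chi> x ^ p)"
proof -
  have F: "fgen x \<in> carrier FA" "fgen (pmap L x) \<in> carrier FA"
    using assms by (auto intro!: FA_fgen lie_closed)
  have "pr (fgen x ^ p - (fgen (pmap L x) + fconst (\<chi> x ^ p))) = \<zero>\<^bsub>UA\<^esub>"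
    using pr_prel[OF assms] by (simp add: prel_def diff_diff_eq)
  from pr_eqI[OF FA_power[OF F(1)] FA_add[OF F(2) FA_fconst] this] show ?thesis
    using F pr.hom_add[OF F(2) FA_fconst]
    by (simp add: ug_def uc_def pr_power)
qed

lemma UA_induct [consumes 1, case_names const gen add mult]:
  assumes "a \<in> carrier UA" "\<And>c. P (uc c)" "\<And>x. x \<in> lcarrier L \<Longrightarrow> P (ug x)"
    and "\<And>a b. a \<in> carrier UA \<Longrightarrow> b \<in> carrier UA \<Longrightarrow> P a \<Longrightarrow> P b \<Longrightarrow> P (a \<oplus>\<^bsub>UA\<^esub> b)"
    and "\<And>a b. a \<in> carrier UA \<Longrightarrow> b \<in> carrier UA \<Longrightarrow> P a \<Longrightarrow> P b \<Longrightarrow> P (a \<otimes>\<^bsub>UA\<^esub> b)"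
  shows "P a"
proof -
  obtain f where f: "a = pr f" "f \<in> carrier FA" using assms(1) by (auto simp: UA_carrier)
  have "P (pr f)"
    using f(2)
  proof (induction f rule: FA_induct)
    case (add f g)
    thus ?case using assms(4)[of "pr f" "pr g"] pr.hom_add[of f g] by simp
  next
    case (mult f g)
    thus ?case using assms(5)[of "pr f" "pr g"] pr.hom_mult[of f g] by simp
  qed (use assms(2,3) in \<open>auto simp: uc_def ug_def\<close>)
  thus ?thesis using f by simp
qed

end

section \<open>Actions of the free algebra that factor through the reduced enveloping
  algebra\<close>

locale alg_action =
  fixes \<kappa> :: "'k::field \<Rightarrow> 'b::comm_ring_1" and \<rho> :: "'l \<Rightarrow> 'b \<Rightarrow> 'b"
  assumes \<kappa>_add: "\<kappa> (c + d) = \<kappa> c + \<kappa> d" and \<kappa>_mult: "\<kappa> (c * d) = \<kappa> c * \<kappa> d" and \<kappa>_1: "\<kappa> 1 = 1"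
    and \<rho>_add: "\<rho> x (a + b) = \<rho> x a + \<rho> x b" and \<rho>_\<kappa>: "\<rho> x (\<kappa> c * b) = \<kappa> c * \<rho> x b"
begin

definition wact :: "('k, 'l) free_alg \<Rightarrow> 'b \<Rightarrow> 'b" where
  "wact f b = (\<Sum>w\<in>keys f. \<kappa> (lookup f w) * foldr \<rho> (letters w) b)"

lemma \<kappa>_0: "\<kappa> 0 = 0"
  using \<kappa>_add[of 0 0] by simp

lemma wact_superset:
  assumes "finite A" "keys f \<subseteq> A"
  shows "wact f b = (\<Sum>w\<in>A. \<kappa> (lookup f w) * foldr \<rho> (letters w) b)"
  unfolding wact_def using assms by (intro sum.mono_neutral_left) (auto simp: in_keys_iff \<kappa>_0)

lemma wact_add: "wact (f + g) b = wact f b + wact g b"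
proof -
  let ?A = "keys f \<union> keys g"
  have "wact h b = (\<Sum>w\<in>?A. \<kappa> (lookup h w) * foldr \<rho> (letters w) b)"
    if "h \<in> {f, g, f + g}" for h
    using that keys_add[of f g] by (intro wact_superset) auto
  thus ?thesis
    by (simp add: lookup_add \<kappa>_add distrib_right sum.distrib)
qed

lemma wact_0 [simp]: "wact 0 b = 0"
  by (simp add: wact_def)

lemma wact_uminus: "wact (- f) b = - wact f b"
  using wact_add[of f "- f" b] by (simp add: eq_neg_iff_add_eq_0 add.commute)

lemma wact_diff: "wact (f - g) b = wact f b - wact g b"
  using wact_add[of f "- g" b] by (simp add: wact_uminus)

lemma wact_single: "wact (single w c) b = \<kappa> c * foldr \<rho> (letters w) b"
  by (subst wact_superset[of "{w}"]) auto

lemma foldr_\<rho>_add: "foldr \<rho> ws (a + b) = foldr \<rho> ws a + foldr \<rho> ws b"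
  by (induction ws) (auto simp: \<rho>_add)

lemma foldr_\<rho>_\<kappa>: "foldr \<rho> ws (\<kappa> c * b) = \<kappa> c * foldr \<rho> ws b"
  by (induction ws) (auto simp: \<rho>_\<kappa>)

lemma wact_right_add: "wact f (a + b) = wact f a + wact f b"
  by (simp add: wact_def foldr_\<rho>_add distrib_left sum.distrib)

lemma wact_right_0 [simp]: "wact f 0 = 0"
  using wact_right_add[of f 0 0] by simp

lemma wact_mult: "wact (f * g) b = wact f (wact g b)"
proof (induction f rule: poly_mapping_single_induct)
  case (single v c)
  show ?case
  proof (induction g rule: poly_mapping_single_induct)
    case (single w d)
    show ?case
      by (simp add: mult_single wact_single plus_fmonoid_def \<kappa>_mult foldr_\<rho>_\<kappa> mult.assoc)
  qed (auto simp: ring_distribs wact_add wact_right_add)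
qed (auto simp: ring_distribs wact_add)

lemma wact_gens: "wact (fgen x) b = \<rho> x b" "wact (fconst c) b = \<kappa> c * b" "wact 1 b = b"
proof -
  show "wact (fgen x) b = \<rho> x b" "wact (fconst c) b = \<kappa> c * b"
    by (simp_all add: fgen_def fconst_def wact_single zero_fmonoid_def \<kappa>_1)
  have "wact (single 0 1) b = b"
    by (simp only: wact_single) (simp add: zero_fmonoid_def \<kappa>_1)
  thus "wact 1 b = b" by simp
qed

lemma wact_gen_power: "wact (fgen x ^ n) b = (\<rho> x ^^ n) b"
  by (induction n) (auto simp: wact_mult wact_gens)

end

text \<open>The relations are asked for on an invariant subset B of the ring, as vector fields on
  the group algebra are shown to satisfy them on \<open>modset\<close>.\<close>

locale enveloping_action = closed_lie p L \<chi> + alg_action \<kappa> \<rho>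
  for p and L :: "('k::field, 'l::ab_group_add) restricted_lie" and \<chi>
    and \<kappa> :: "'k \<Rightarrow> 'b::comm_ring_1" and \<rho> :: "'l \<Rightarrow> 'b \<Rightarrow> 'b" +
  fixes B :: "'b set"
  assumes B_closed: "a \<in> B \<Longrightarrow> b \<in> B \<Longrightarrow> a + b \<in> B" "b \<in> B \<Longrightarrow> \<kappa> c * b \<in> B"
    "x \<in> lcarrier L \<Longrightarrow> b \<in> B \<Longrightarrow> \<rho> x b \<in> B"
    and \<rho>_left_add: "x \<in> lcarrier L \<Longrightarrow> y \<in> lcarrier L \<Longrightarrow> b \<in> B \<Longrightarrow> \<rho> (x + y) b = \<rho> x b + \<rho> y b"
    and \<rho>_scale: "x \<in> lcarrier L \<Longrightarrow> b \<in> B \<Longrightarrow> \<rho> (lscale L c x) b = \<kappa> c * \<rho> x b"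
    and \<rho>_bracket: "x \<in> lcarrier L \<Longrightarrow> y \<in> lcarrier L \<Longrightarrow> b \<in> B \<Longrightarrow>
      \<rho> x (\<rho> y b) - \<rho> y (\<rho> x b) = \<rho> (lbracket L x y) b"
    and \<rho>_pmap: "x \<in> lcarrier L \<Longrightarrow> b \<in> B \<Longrightarrow> (\<rho> x ^^ p) b = \<rho> (pmap L x) b + \<kappa> (\<chi> x ^ p) * b"
begin

lemma wact_closed: "f \<in> carrier FA \<Longrightarrow> b \<in> B \<Longrightarrow> wact f b \<in> B"
  by (induction f arbitrary: b rule: FA_induct)
    (auto simp: wact_gens wact_add wact_mult B_closed)

lemma ideal_annihilator: "ideal {f \<in> carrier FA. \<forall>b\<in>B. wact f b = 0} FA" (is "ideal ?J FA")
proof (rule idealI[OF ring_FA])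
  have "0 \<in> carrier FA" using FA.zero_closed by simp
  thus "subgroup ?J (add_monoid FA)"
    by (intro FA.add.subgroupI)
      (auto simp: FA_uminus FA_add wact_add wact_uminus FA_a_inv simp flip: a_inv_def)
qed (auto simp: FA_mult wact_mult wact_closed)

lemma wact_eq_0:
  assumes "f \<in> carrier FA" "pr f = \<zero>\<^bsub>UA\<^esub>" "b \<in> B"
  shows "wact f b = 0"
proof -
  have "f \<in> {f \<in> carrier FA. \<forall>b\<in>B. wact f b = 0}"
  proof (rule pr_kernel[OF ideal_annihilator _ _ assms(1,2)])
    show "env_rels L \<subseteq> {f \<in> carrier FA. \<forall>b\<in>B. wact f b = 0}"
    proof
      fix f assume f: "f \<in> env_rels L"
      have "wact f b = 0" if "b \<in> B" for b
        using f that unfolding env_rels_def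
        by (auto simp: wact_diff wact_mult wact_gens \<rho>_left_add \<rho>_scale \<rho>_bracket)
      thus "f \<in> {f \<in> carrier FA. \<forall>b\<in>B. wact f b = 0}" using f env_rels_subset by auto
    qed
    show "prel x \<in> {f \<in> carrier FA. \<forall>b\<in>B. wact f b = 0}" if "x \<in> lcarrier L" for x
      using that prel_closed[OF that]
      by (auto simp: prel_def wact_diff wact_gen_power wact_gens \<rho>_pmap)
  qed
  thus ?thesis using assms(3) by blast
qed

end

context closed_lie
begin

text \<open>The assumptions make the field itself an enveloping action, x acting by \<theta> x, and
  \<open>free_char \<theta> f\<close> is the value of f at 1. It is therefore constant on cosets, so
  each \<open>the_elem\<close> is applied to a singleton.\<close>

lemma red_env_char_pr:
  assumes add: "\<And>x y. x \<in> lcarrier L \<Longrightarrow> y \<in> lcarrier L \<Longrightarrow> \<theta> (x + y) = \<theta> x + \<theta> y"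
    and scale: "\<And>c x. x \<in> lcarrier L \<Longrightarrow> \<theta> (lscale L c x) = c * \<theta> x"
    and bracket: "\<And>x y. x \<in> lcarrier L \<Longrightarrow> y \<in> lcarrier L \<Longrightarrow> \<theta> (lbracket L x y) = 0"
    and pmap: "\<And>x. x \<in> lcarrier L \<Longrightarrow> \<theta> x ^ p = \<theta> (pmap L x) + \<chi> x ^ p"
    and f: "f \<in> carrier FA"
  shows "red_env_char \<theta> (pr f) = free_char \<theta> f"
    and "g \<in> carrier FA \<Longrightarrow> free_char \<theta> (f * g) = free_char \<theta> f * free_char \<theta> g"
    and "free_char \<theta> (f + g) = free_char \<theta> f + free_char \<theta> g"
    and "free_char \<theta> (fgen x) = \<theta> x" and "free_char \<theta> (fconst c) = c"
proof -
  have pow: "((\<lambda>b. \<theta> x * b) ^^ n) b = \<theta> x ^ n * b" for x n b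
    by (induction n) auto
  interpret enveloping_action p L \<chi> "\<lambda>c. c" "\<lambda>x b. \<theta> x * b" UNIV
    by unfold_locales (auto simp: add scale bracket pow pmap distrib_left distrib_right mult.assoc mult.left_commute)
  have fold: "foldr (\<lambda>x b. \<theta> x * b) ws 1 = prod_list (map \<theta> ws)" for ws
    by (induction ws) auto
  have fc: "free_char \<theta> h = wact h 1" for h
    by (simp add: wact_def free_char_def fold)
  have fold': "foldr (\<lambda>x b. \<theta> x * b) ws b = foldr (\<lambda>x b. \<theta> x * b) ws 1 * b" for ws b
    by (induction ws) (auto simp: mult_ac)
  have wact: "wact h b = wact h 1 * b" for h b
    unfolding wact_def sum_distrib_right by (subst fold') (simp add: mult.assoc)
  show "free_char \<theta> (f * g) = free_char \<theta> f * free_char \<theta> g"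
    using wact[of f "wact g 1"] by (simp add: fc wact_mult)
  show "free_char \<theta> (f + g) = free_char \<theta> f + free_char \<theta> g" by (simp add: fc wact_add)
  show "free_char \<theta> (fgen x) = \<theta> x" "free_char \<theta> (fconst c) = c" by (simp_all add: fc wact_gens)
  have const: "free_char \<theta> g = free_char \<theta> f" if "g \<in> X" "X \<in> pr f" for g X
  proof -
    from pr_coset(3)[OF f that(2,1)] have g: "g \<in> carrier FA" "pr g = pr f" by auto
    have "pr (g - f) = \<zero>\<^bsub>UA\<^esub>"
      using g f FA_diff by (simp add: pr_eq_0_iff pr_eq_iff)
    from wact_eq_0[OF FA_diff[OF g(1) f] this, of 1] show ?thesis by (simp add: fc wact_diff)
  qed
  have "the_elem (free_char \<theta> ` X) = free_char \<theta> f" if X: "X \<in> pr f" for X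
  proof -
    have "free_char \<theta> ` X = {free_char \<theta> f}" using const[OF _ X] pr_coset(2)[OF f X] by auto
    thus ?thesis by simp
  qed
  hence "(\<lambda>X. the_elem (free_char \<theta> ` X)) ` pr f = {free_char \<theta> f}"
    using pr_coset(1)[OF f] by auto
  thus "red_env_char \<theta> (pr f) = free_char \<theta> f" by (simp add: red_env_char_def)
qed

end

section \<open>The canonical map for a restricted subalgebra\<close>

locale closed_lie_sub = closed_lie p L \<chi> + S: closed_lie p S \<chi>
  for p and L S :: "('k::field, 'l::ab_group_add) restricted_lie" and \<chi> +
  assumes sub: "lcarrier S \<subseteq> lcarrier L" "lscale S = lscale L" "lbracket S = lbracket L" "pmap S = pmap L"
begin

lemma sub_FA: "carrier S.FA \<subseteq> carrier FA"
  using sub(1) unfolding FA_carrier S.FA_carrier subset_iff by blast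

lemma sub_env_rels: "env_rels S \<subseteq> env_rels L"
  unfolding env_rels_def sub(2-4) by (intro Un_mono subsetI; use sub(1) in blast)

lemma ideal_restrict:
  assumes "ideal I FA"
  shows "ideal {f \<in> carrier S.FA. f \<in> I} S.FA" (is "ideal ?J S.FA")
proof (rule idealI[OF S.ring_FA])
  interpret I: ideal I FA by fact
  have z: "0 \<in> carrier S.FA" "0 \<in> I" using S.FA.zero_closed I.zero_closed by simp_all
  have neg: "- f \<in> I" if "f \<in> I" for f
    using I.a_inv_closed[OF that] FA_a_inv[OF I.Icarr[OF that]] by simp
  show "subgroup ?J (add_monoid S.FA)"
    using z neg I.a_closed
    by (intro S.FA.add.subgroupI) (auto simp: S.FA_uminus S.FA_add S.FA_a_inv simp flip: a_inv_def)
  show "x \<otimes>\<^bsub>S.FA\<^esub> a \<in> ?J" "a \<otimes>\<^bsub>S.FA\<^esub> x \<in> ?J" if "a \<in> ?J" "x \<in> carrier S.FA" for a x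
    using that I.I_l_closed[of a x] I.I_r_closed[of a x] sub_FA S.FA_mult by auto
qed

lemma sub_env_ideal: "env_ideal S \<subseteq> env_ideal L"
proof -
  have "env_ideal S \<subseteq> {f \<in> carrier S.FA. f \<in> env_ideal L}"
    unfolding env_ideal_def[of S]
    using S.env_rels_subset sub_env_rels FA.genideal_self[OF env_rels_subset]
    by (intro S.FA.genideal_minimal ideal_restrict ideal_env) (auto simp: env_ideal_def)
  thus ?thesis by blast
qed

lemma pr_ideal: "ideal {f \<in> carrier FA. pr f = \<zero>\<^bsub>UA\<^esub>} FA"
  using pr.kernel_is_ideal unfolding a_kernel_def' .

text \<open>The canonical map is well defined: the kernel of \<open>pr\<close>, restricted to the
  free algebra on the subalgebra, is an ideal containing the relations of the subalgebra.\<close>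

lemma pr_eq_sub:
  assumes "f \<in> carrier S.FA" "g \<in> carrier S.FA" "S.pr f = S.pr g"
  shows "pr f = pr g"
proof -
  define J where "J = {f \<in> carrier S.FA. f \<in> {f \<in> carrier FA. pr f = \<zero>\<^bsub>UA\<^esub>}}"
  have "f - g \<in> J"
  proof (rule S.pr_kernel)
    show "ideal J S.FA" unfolding J_def by (rule ideal_restrict[OF pr_ideal])
    show "env_rels S \<subseteq> J"
    proof
      fix h assume "h \<in> env_rels S"
      hence "h \<in> carrier S.FA" "h \<in> env_rels L" using S.env_rels_subset sub_env_rels by blast+
      thus "h \<in> J" using env_rels_subset pr_env_rels[of h] by (simp add: J_def subset_iff)
    qed
    show "S.prel x \<in> J" if "x \<in> lcarrier S" for x
    proof -
      have "S.prel x = prel x" by (simp add: prel_def S.prel_def sub)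
      moreover have "x \<in> lcarrier L" using that sub(1) by blast
      ultimately show ?thesis
        using S.prel_closed[OF that] prel_closed[of x] pr_prel[of x] by (simp add: J_def)
    qed
    show "f - g \<in> carrier S.FA" using assms by (simp add: S.FA_diff)
    thus "S.pr (f - g) = \<zero>\<^bsub>S.UA\<^esub>" using assms by (simp add: S.pr_eq_0_iff S.pr_eq_iff)
  qed
  hence "pr (f - g) = \<zero>\<^bsub>UA\<^esub>" by (simp add: J_def)
  thus ?thesis using assms sub_FA by (intro pr_eqI) auto
qed

lemma env_incl_env_class:
  assumes "g \<in> carrier S.FA"
  shows "env_incl L (env_class S g) = env_class L g"
proof -
  interpret I: ideal "env_ideal L" FA by (rule ideal_env)
  interpret SI: ideal "env_ideal S" S.FA by (rule S.ideal_env)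
  have "(\<exists>h\<in>env_ideal L. \<exists>i\<in>env_ideal S. x = h + (i + g)) \<longleftrightarrow> (\<exists>h\<in>env_ideal L. x = h + g)" for x
  proof
    assume "\<exists>h\<in>env_ideal L. \<exists>i\<in>env_ideal S. x = h + (i + g)"
    then obtain h i where hi: "h \<in> env_ideal L" "i \<in> env_ideal S" "x = h + (i + g)" by blast
    hence "h + i \<in> env_ideal L" using sub_env_ideal I.a_closed[of h i] by auto
    thus "\<exists>h\<in>env_ideal L. x = h + g" using hi(3) by (intro bexI[of _ "h + i"]) (simp_all add: add.assoc)
  next
    assume "\<exists>h\<in>env_ideal L. x = h + g"
    thus "\<exists>h\<in>env_ideal L. \<exists>i\<in>env_ideal S. x = h + (i + g)"
      using SI.zero_closed by (metis S.FA_simps(3) add_0)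
  qed
  moreover have "env_incl L (env_class S g) = {x. \<exists>h\<in>env_ideal L. \<exists>i\<in>env_ideal S. x = h + (i + g)}"
    unfolding env_incl_def env_class_def set_add_def' a_r_coset_def' FA_simps S.FA_simps by blast
  moreover have "env_class L g = {x. \<exists>h\<in>env_ideal L. x = h + g}"
    unfolding env_class_def a_r_coset_def' FA_simps by blast
  ultimately show ?thesis by simp
qed

lemma red_env_incl_pr:
  assumes "f \<in> carrier S.FA"
  shows "red_env_incl p L \<chi> (S.pr f) = pr f"
proof -
  interpret R: ideal "red_ideal p L \<chi>" EA by (rule ideal_red)
  have "red_ideal p L \<chi> +>\<^bsub>EA\<^esub> env_incl L X = pr f" if X: "X \<in> S.pr f" for X
  proof -
    obtain g where g: "g \<in> X" using S.pr_coset(2)[OF assms X] by blast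
    from S.pr_coset(3)[OF assms X g] have "g \<in> carrier S.FA" "S.pr g = S.pr f" "X = env_class S g" by auto
    thus ?thesis
      using pr_eq_sub[of g f] assms by (simp add: env_incl_env_class flip: pr_def)
  qed
  moreover have "red_env_incl p L \<chi> (S.pr f) = (\<Union>X\<in>S.pr f. red_ideal p L \<chi> +>\<^bsub>EA\<^esub> env_incl L X)"
    unfolding red_env_incl_def set_add_def' a_r_coset_def' by auto
  ultimately show ?thesis using S.pr_coset(1)[OF assms] by simp
qed

end

section \<open>The reduced enveloping algebras of \<open>W\<close> and \<open>W0\<close>, and the
  weight character\<close>

context witt_height_0
begin

sublocale U: closed_lie p "witt p ell pm" \<chi>
  by unfold_locales auto

sublocale V: closed_lie_sub p "witt p ell pm" "witt0 p ell pm" \<chi>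
  using witt_filt_bracket[of _ p ell 0 _ 0] W0_subset by unfold_locales (auto simp: pm_in_W0)

abbreviation "inc \<equiv> red_env_incl p (witt p ell pm) \<chi>"
abbreviation "rc lam \<equiv> red_env_char (verma_weight p ell \<chi> lam)"

text \<open>The twisted module is nonzero, as it contains the unit \<open>uexp 1\<close>, and 1 acts
  on it as the identity.\<close>

lemma one_not_zero_UA: "\<one>\<^bsub>U.UA\<^esub> \<noteq> \<zero>\<^bsub>U.UA\<^esub>"
proof
  assume eq: "\<one>\<^bsub>U.UA\<^esub> = \<zero>\<^bsub>U.UA\<^esub>"
  interpret enveloping_action p "witt p ell pm" \<chi> const_ga D modset
  proof unfold_locales
    show "a + b \<in> modset" if "a \<in> modset" "b \<in> modset" for a b
    proof -
      from that obtain f g where "a = f * uexp 1" "b = g * uexp 1" "f \<in> Rring" "g \<in> Rring"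
        by (auto simp: modset_def)
      hence "a + b = (f + g) * uexp 1" "f + g \<in> Rring" by (auto simp: distrib_right Rring.add)
      thus ?thesis by (auto simp: modset_def)
    qed
    show "const_ga c * b \<in> modset" if "b \<in> modset" for b c
    proof -
      from that obtain f where "b = f * uexp 1" "f \<in> Rring" by (auto simp: modset_def)
      hence "const_ga c * b = (const_ga c * f) * uexp 1" "const_ga c * f \<in> Rring"
        by (auto intro: Rring.mult Rring.const)
      thus ?thesis unfolding modset_def by blast
    qed
  qed (auto simp: const_ga_add const_ga_mult derivation_add[OF derivation_D] D_const_mult D_in_modset
      D_add D_scale D_br_modset Dp_modset)
  have "uexp 1 \<in> modset" using Rring_1 unfolding modset_def by force
  moreover have "U.pr 1 = \<zero>\<^bsub>U.UA\<^esub>" using U.pr.hom_one eq by simp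
  moreover have "1 \<in> carrier U.FA" using U.FA.one_closed by simp
  ultimately have "uexp 1 = 0" using wact_eq_0[of 1 "uexp 1"] by (simp add: wact_gens)
  thus False using uexp_inverse[of 1] by simp
qed

context
  fixes lam :: 'k
  assumes lam: "lam ^ p = lam"
begin

text \<open>The conditions for a one-dimensional module. The last combines lam^p = lam, the
  vanishing of \<chi> on \<open>W0\<close>, and the fact that \<open>pm\<close> raises the
  e_0-coefficient to its p-th power.\<close>

private lemma weight_facts:
  "x \<in> W0 \<Longrightarrow> y \<in> W0 \<Longrightarrow> verma_weight p ell \<chi> lam (x + y) = verma_weight p ell \<chi> lam x + verma_weight p ell \<chi> lam y"
  "verma_weight p ell \<chi> lam (witt_scale c x) = c * verma_weight p ell \<chi> lam x"
  "x \<in> W0 \<Longrightarrow> y \<in> W0 \<Longrightarrow> verma_weight p ell \<chi> lam (br x y) = 0"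
  "x \<in> W0 \<Longrightarrow> verma_weight p ell \<chi> lam x ^ p = verma_weight p ell \<chi> lam (pm x) + \<chi> x ^ p"
  using lam p_gt_3
  by (simp_all add: verma_weight_eq lookup_add distrib_left witt_filt_bracket_0_0 pm_lookup_0_0
      power_mult_distrib chi_W0 power_0_left)

lemma verma_char:
  shows verma_char_ug: "x \<in> W0 \<Longrightarrow> rc lam (V.S.ug x) = lam * lookup x (0, 0)"
    and verma_char_uc: "rc lam (V.S.uc c) = c"
    and verma_char_add: "a \<in> carrier V.S.UA \<Longrightarrow> b \<in> carrier V.S.UA \<Longrightarrow>
      rc lam (a \<oplus>\<^bsub>V.S.UA\<^esub> b) =
      rc lam a + rc lam b"
    and verma_char_mult: "a \<in> carrier V.S.UA \<Longrightarrow> b \<in> carrier V.S.UA \<Longrightarrow>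
      rc lam (a \<otimes>\<^bsub>V.S.UA\<^esub> b) =
      rc lam a * rc lam b"
proof -
  let ?\<theta> = "verma_weight p ell \<chi> lam"
  have char: "red_env_char ?\<theta> (V.S.pr f) = free_char ?\<theta> f" if "f \<in> carrier V.S.FA" for f
    by (rule V.S.red_env_char_pr(1)) (use that in \<open>simp_all add: weight_facts\<close>)
  have mult: "free_char ?\<theta> (f * g) = free_char ?\<theta> f * free_char ?\<theta> g"
    if "f \<in> carrier V.S.FA" "g \<in> carrier V.S.FA" for f g
    by (rule V.S.red_env_char_pr(2)) (use that in \<open>simp_all add: weight_facts\<close>)
  have add: "free_char ?\<theta> (f + g) = free_char ?\<theta> f + free_char ?\<theta> g"
    if "f \<in> carrier V.S.FA" "g \<in> carrier V.S.FA" for f g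
    by (rule V.S.red_env_char_pr(3)) (use that in \<open>simp_all add: weight_facts\<close>)
  have gen: "free_char ?\<theta> (fgen x) = ?\<theta> x" for x
    by (rule V.S.red_env_char_pr(4)[OF _ _ _ _ V.S.FA_fconst]) (simp_all add: weight_facts)
  have const: "free_char ?\<theta> (fconst c) = c" for c
    by (rule V.S.red_env_char_pr(5)[OF _ _ _ _ V.S.FA_fconst]) (simp_all add: weight_facts)
  show "red_env_char ?\<theta> (V.S.ug x) = lam * lookup x (0, 0)" if "x \<in> W0" for x
    using that by (simp add: char gen V.S.ug_def V.S.FA_fgen verma_weight_eq)
  show "red_env_char ?\<theta> (V.S.uc c) = c"
    by (simp add: char const V.S.uc_def V.S.FA_fconst)
  fix a b assume "a \<in> carrier V.S.UA" "b \<in> carrier V.S.UA"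
  then obtain f g where fg: "f \<in> carrier V.S.FA" "g \<in> carrier V.S.FA" "a = V.S.pr f" "b = V.S.pr g"
    by (auto simp: V.S.UA_carrier)
  show "red_env_char ?\<theta> (a \<oplus>\<^bsub>V.S.UA\<^esub> b) = red_env_char ?\<theta> a + red_env_char ?\<theta> b"
    using fg V.S.pr.hom_add[of f g] char[of "f + g"] add[of f g] V.S.FA_add[of f g] by (simp add: char)
  show "red_env_char ?\<theta> (a \<otimes>\<^bsub>V.S.UA\<^esub> b) = red_env_char ?\<theta> a * red_env_char ?\<theta> b"
    using fg V.S.pr.hom_mult[of f g] char[of "f * g"] mult[of f g] V.S.FA_mult[of f g] by (simp add: char)
qed

end

lemma incl_ug: "x \<in> W0 \<Longrightarrow> inc (V.S.ug x) = U.ug x"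
  and incl_uc: "inc (V.S.uc c) = U.uc c"
  by (simp_all add: V.S.ug_def U.ug_def V.S.uc_def U.uc_def V.red_env_incl_pr V.S.FA_fgen V.S.FA_fconst)

lemma incl_closed: "a \<in> carrier V.S.UA \<Longrightarrow> inc a \<in> carrier U.UA"
  using V.sub_FA by (auto simp: V.S.UA_carrier V.red_env_incl_pr)

lemma incl_hom:
  assumes "a \<in> carrier V.S.UA" "b \<in> carrier V.S.UA"
  shows "inc (a \<oplus>\<^bsub>V.S.UA\<^esub> b) =
      inc a \<oplus>\<^bsub>U.UA\<^esub> inc b"
    and "inc (a \<otimes>\<^bsub>V.S.UA\<^esub> b) =
      inc a \<otimes>\<^bsub>U.UA\<^esub> inc b"
proof -
  obtain f g where fg: "f \<in> carrier V.S.FA" "g \<in> carrier V.S.FA" "a = V.S.pr f" "b = V.S.pr g"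
    using assms by (auto simp: V.S.UA_carrier)
  have fgU: "f \<in> carrier U.FA" "g \<in> carrier U.FA" using fg V.sub_FA by auto
  show "inc (a \<oplus>\<^bsub>V.S.UA\<^esub> b) =
      inc a \<oplus>\<^bsub>U.UA\<^esub> inc b"
    using fg fgU V.S.pr.hom_add[of f g] U.pr.hom_add[of f g] V.S.FA_add[of f g]
    by (simp add: V.red_env_incl_pr) (simp flip: V.red_env_incl_pr)
  show "inc (a \<otimes>\<^bsub>V.S.UA\<^esub> b) =
      inc a \<otimes>\<^bsub>U.UA\<^esub> inc b"
    using fg fgU V.S.pr.hom_mult[of f g] U.pr.hom_mult[of f g] V.S.FA_mult[of f g]
    by (simp add: V.red_env_incl_pr) (simp flip: V.red_env_incl_pr)
qed

lemma chi_module_of_left_module: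
  assumes "left_module U.UA M"
  shows "chi_module p ell \<chi> pm M (\<lambda>c w. U.uc c \<odot>\<^bsub>M\<^esub> w) (\<lambda>x w. U.ug x \<odot>\<^bsub>M\<^esub> w)"
proof -
  interpret M: left_module U.UA M by fact
  interpret vector_operators M "\<lambda>c w. U.uc c \<odot>\<^bsub>M\<^esub> w"
    by unfold_locales
      (simp_all add: M.smult_closed M.smult_r_distr M.smult_l_distr U.uc_simps M.smult_assoc M.smult_one)
  have ug: "x \<in> W \<Longrightarrow> U.ug x \<in> carrier U.UA" for x by simp
  have pow: "((\<lambda>w. U.ug x \<odot>\<^bsub>M\<^esub> w) ^^ n) w = (U.ug x [^]\<^bsub>U.UA\<^esub> n) \<odot>\<^bsub>M\<^esub> w"
    if "x \<in> W" "w \<in> carrier M" for x n w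
  proof (induction n)
    case (Suc n)
    have "U.ug x [^]\<^bsub>U.UA\<^esub> Suc n = U.ug x \<otimes>\<^bsub>U.UA\<^esub> U.ug x [^]\<^bsub>U.UA\<^esub> n"
      using that by (intro U.UA.nat_pow_Suc2) simp
    thus ?case using Suc that by (simp add: M.smult_assoc)
  qed (use that in \<open>simp add: M.smult_one\<close>)
  show ?thesis
  proof unfold_locales
    fix x assume x: "x \<in> W"
    show "lin (\<lambda>w. U.ug x \<odot>\<^bsub>M\<^esub> w)"
      using ug[OF x] by (auto simp: lin_def M.smult_closed M.smult_r_distr U.uc_commute simp flip: M.smult_assoc)
    fix w assume w: "w \<in> carrier M"
    show "U.ug (witt_scale c x) \<odot>\<^bsub>M\<^esub> w = U.uc c \<odot>\<^bsub>M\<^esub> (U.ug x \<odot>\<^bsub>M\<^esub> w)" for c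
      using x w U.ug_scale[of x c] by (simp add: M.smult_assoc)
    show "((\<lambda>w. U.ug x \<odot>\<^bsub>M\<^esub> w) ^^ p) w = U.ug (pm x) \<odot>\<^bsub>M\<^esub> w \<oplus>\<^bsub>M\<^esub> U.uc (\<chi> x ^ p) \<odot>\<^bsub>M\<^esub> w"
      using x w U.ug_pow[of x] by (simp add: pow M.smult_l_distr)
    fix y assume y: "y \<in> W"
    show "U.ug (x + y) \<odot>\<^bsub>M\<^esub> w = U.ug x \<odot>\<^bsub>M\<^esub> w \<oplus>\<^bsub>M\<^esub> U.ug y \<odot>\<^bsub>M\<^esub> w"
      using x y w U.ug_add[of x y] by (simp add: M.smult_l_distr)
    show "U.ug x \<odot>\<^bsub>M\<^esub> (U.ug y \<odot>\<^bsub>M\<^esub> w) =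
        U.ug y \<odot>\<^bsub>M\<^esub> (U.ug x \<odot>\<^bsub>M\<^esub> w) \<oplus>\<^bsub>M\<^esub> U.ug (br x y) \<odot>\<^bsub>M\<^esub> w"
      using x y w U.ug_br[of x y] by (simp add: M.smult_l_distr flip: M.smult_assoc)
  qed
qed

end

section \<open>Left modules\<close>

context left_module
begin

lemma smult_zero: "x \<in> carrier M \<Longrightarrow> \<zero>\<^bsub>R\<^esub> \<odot>\<^bsub>M\<^esub> x = \<zero>\<^bsub>M\<^esub>"
  using smult_l_distr[of "\<zero>\<^bsub>R\<^esub>" "\<zero>\<^bsub>R\<^esub>" x] smult_closed[of "\<zero>\<^bsub>R\<^esub>" x]
    M.add.l_cancel_one[of "\<zero>\<^bsub>R\<^esub> \<odot>\<^bsub>M\<^esub> x" "\<zero>\<^bsub>R\<^esub> \<odot>\<^bsub>M\<^esub> x"] by simp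

lemma smult_minus: "a \<in> carrier R \<Longrightarrow> x \<in> carrier M \<Longrightarrow> (\<ominus>\<^bsub>R\<^esub> a) \<odot>\<^bsub>M\<^esub> x = \<ominus>\<^bsub>M\<^esub> (a \<odot>\<^bsub>M\<^esub> x)"
  using smult_l_distr[of "\<ominus>\<^bsub>R\<^esub> a" a x]
  by (intro M.minus_equality[symmetric]) (simp_all add: smult_closed smult_zero R.l_neg)

lemma smult_diff_eq_0_iff:
  assumes "a \<in> carrier R" "b \<in> carrier R" "x \<in> carrier M"
  shows "(a \<oplus>\<^bsub>R\<^esub> \<ominus>\<^bsub>R\<^esub> b) \<odot>\<^bsub>M\<^esub> x = \<zero>\<^bsub>M\<^esub> \<longleftrightarrow> a \<odot>\<^bsub>M\<^esub> x = b \<odot>\<^bsub>M\<^esub> x"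
proof -
  have c: "a \<odot>\<^bsub>M\<^esub> x \<in> carrier M" "b \<odot>\<^bsub>M\<^esub> x \<in> carrier M" using assms by (simp_all add: smult_closed)
  have "(a \<oplus>\<^bsub>R\<^esub> \<ominus>\<^bsub>R\<^esub> b) \<odot>\<^bsub>M\<^esub> x = a \<odot>\<^bsub>M\<^esub> x \<oplus>\<^bsub>M\<^esub> \<ominus>\<^bsub>M\<^esub> (b \<odot>\<^bsub>M\<^esub> x)"
    using assms by (simp add: smult_l_distr smult_minus)
  thus ?thesis using c M.minus_equality[of "a \<odot>\<^bsub>M\<^esub> x" "\<ominus>\<^bsub>M\<^esub> (b \<odot>\<^bsub>M\<^esub> x)"] M.r_neg by auto
qed

lemma submoduleI':
  assumes "H \<subseteq> carrier M" "\<zero>\<^bsub>M\<^esub> \<in> H" "\<And>x y. x \<in> H \<Longrightarrow> y \<in> H \<Longrightarrow> x \<oplus>\<^bsub>M\<^esub> y \<in> H"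
    and "\<And>a x. a \<in> carrier R \<Longrightarrow> x \<in> H \<Longrightarrow> a \<odot>\<^bsub>M\<^esub> x \<in> H"
  shows "submodule H R M"
proof (intro submodule.intro submodule_axioms.intro)
  have "\<ominus>\<^bsub>M\<^esub> x \<in> H" if "x \<in> H" for x
    using assms(4)[of "\<ominus>\<^bsub>R\<^esub> \<one>\<^bsub>R\<^esub>" x] that assms(1) by (auto simp: smult_minus smult_one)
  thus "subgroup H (add_monoid M)"
    using assms by (intro M.add.subgroupI) (auto simp flip: a_inv_def)
qed (use assms in auto)

definition orbit :: "'b \<Rightarrow> 'b set" where
  "orbit v = (\<lambda>a. a \<odot>\<^bsub>M\<^esub> v) ` carrier R"

lemma orbit_props:
  assumes "v \<in> carrier M"
  shows orbit_subset: "orbit v \<subseteq> carrier M" and zero_in_orbit: "\<zero>\<^bsub>M\<^esub> \<in> orbit v"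
    and self_in_orbit: "v \<in> orbit v"
    and orbit_add: "x \<in> orbit v \<Longrightarrow> y \<in> orbit v \<Longrightarrow> x \<oplus>\<^bsub>M\<^esub> y \<in> orbit v"
    and orbit_smult: "a \<in> carrier R \<Longrightarrow> x \<in> orbit v \<Longrightarrow> a \<odot>\<^bsub>M\<^esub> x \<in> orbit v"
proof -
  show "orbit v \<subseteq> carrier M" using assms by (auto simp: orbit_def smult_closed)
  show "\<zero>\<^bsub>M\<^esub> \<in> orbit v" using smult_zero[OF assms] by (force simp: orbit_def)
  show "v \<in> orbit v" using smult_one[OF assms] by (force simp: orbit_def)
  show "x \<oplus>\<^bsub>M\<^esub> y \<in> orbit v" if "x \<in> orbit v" "y \<in> orbit v"
    using that assms by (auto simp: orbit_def simp flip: smult_l_distr)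
  show "a \<odot>\<^bsub>M\<^esub> x \<in> orbit v" if "a \<in> carrier R" "x \<in> orbit v"
    using that assms by (auto simp: orbit_def simp flip: smult_assoc)
qed

end

text \<open>A cyclic module is R modulo the annihilator of its generator; with equal annihilators, a
  v \<mapsto> a w is well defined and injective.\<close>

lemma left_module_iso_cyclic:
  assumes M: "left_module R M" and N: "left_module R N"
    and v: "v \<in> carrier M" "carrier M = left_module.orbit R M v"
    and w: "w \<in> carrier N" "carrier N = left_module.orbit R N w"
    and ann: "\<And>a. a \<in> carrier R \<Longrightarrow> a \<odot>\<^bsub>M\<^esub> v = \<zero>\<^bsub>M\<^esub> \<longleftrightarrow> a \<odot>\<^bsub>N\<^esub> w = \<zero>\<^bsub>N\<^esub>"
  shows "left_module_iso R M N"
proof -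
  interpret M: left_module R M by fact
  interpret N: left_module R N by fact
  have eq: "a \<odot>\<^bsub>M\<^esub> v = b \<odot>\<^bsub>M\<^esub> v \<longleftrightarrow> a \<odot>\<^bsub>N\<^esub> w = b \<odot>\<^bsub>N\<^esub> w" if "a \<in> carrier R" "b \<in> carrier R" for a b
    using that ann[of "a \<oplus>\<^bsub>R\<^esub> \<ominus>\<^bsub>R\<^esub> b"] v(1) w(1) by (simp add: M.smult_diff_eq_0_iff N.smult_diff_eq_0_iff)
  define f where "f x = (SOME a. a \<in> carrier R \<and> x = a \<odot>\<^bsub>M\<^esub> v) \<odot>\<^bsub>N\<^esub> w" for x
  have f: "f (a \<odot>\<^bsub>M\<^esub> v) = a \<odot>\<^bsub>N\<^esub> w" if a: "a \<in> carrier R" for a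
  proof -
    let ?b = "SOME b. b \<in> carrier R \<and> a \<odot>\<^bsub>M\<^esub> v = b \<odot>\<^bsub>M\<^esub> v"
    have "?b \<in> carrier R \<and> a \<odot>\<^bsub>M\<^esub> v = ?b \<odot>\<^bsub>M\<^esub> v" by (rule someI_ex) (use a in blast)
    thus ?thesis using eq[OF a, of ?b] by (simp add: f_def)
  qed
  have car: "carrier M = (\<lambda>a. a \<odot>\<^bsub>M\<^esub> v) ` carrier R" "carrier N = (\<lambda>a. a \<odot>\<^bsub>N\<^esub> w) ` carrier R"
    using v(2) w(2) by (simp_all add: M.orbit_def N.orbit_def)
  have "bij_betw f (carrier M) (carrier N)"
    unfolding bij_betw_def
  proof
    show "inj_on f (carrier M)" unfolding car(1) by (auto simp: inj_on_def f eq)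
    show "f ` carrier M = carrier N" unfolding car image_image by (auto simp: f)
  qed
  moreover have "f (x \<oplus>\<^bsub>M\<^esub> y) = f x \<oplus>\<^bsub>N\<^esub> f y" if "x \<in> carrier M" "y \<in> carrier M" for x y
  proof -
    from that obtain a b where "a \<in> carrier R" "b \<in> carrier R" "x = a \<odot>\<^bsub>M\<^esub> v" "y = b \<odot>\<^bsub>M\<^esub> v"
      unfolding car(1) by blast
    thus ?thesis using v(1) w(1) f[of "a \<oplus>\<^bsub>R\<^esub> b"] by (simp add: f M.smult_l_distr N.smult_l_distr)
  qed
  moreover have "f (a \<odot>\<^bsub>M\<^esub> x) = a \<odot>\<^bsub>N\<^esub> f x" if "a \<in> carrier R" "x \<in> carrier M" for a x
  proof -
    from that obtain b where "b \<in> carrier R" "x = b \<odot>\<^bsub>M\<^esub> v" unfolding car(1) by blast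
    thus ?thesis using that v(1) w(1) f[of "a \<otimes>\<^bsub>R\<^esub> b"] by (simp add: f M.smult_assoc N.smult_assoc)
  qed
  ultimately show ?thesis
    using M N unfolding left_module_iso_def by blast
qed

definition prod_module :: "('a, 'm) module \<Rightarrow> ('a, 'n) module \<Rightarrow> ('a, 'm \<times> 'n) module" where
  "prod_module M N =
     \<lparr>carrier = carrier M \<times> carrier N, monoid.mult = (\<lambda>_ _. undefined), one = undefined,
      ring.zero = (\<zero>\<^bsub>M\<^esub>, \<zero>\<^bsub>N\<^esub>), add = (\<lambda>x y. (fst x \<oplus>\<^bsub>M\<^esub> fst y, snd x \<oplus>\<^bsub>N\<^esub> snd y)),
      module.smult = (\<lambda>a x. (a \<odot>\<^bsub>M\<^esub> fst x, a \<odot>\<^bsub>N\<^esub> snd x))\<rparr>"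

lemma prod_module_simps [simp]:
  "carrier (prod_module M N) = carrier M \<times> carrier N" "\<zero>\<^bsub>prod_module M N\<^esub> = (\<zero>\<^bsub>M\<^esub>, \<zero>\<^bsub>N\<^esub>)"
  "x \<oplus>\<^bsub>prod_module M N\<^esub> y = (fst x \<oplus>\<^bsub>M\<^esub> fst y, snd x \<oplus>\<^bsub>N\<^esub> snd y)"
  "a \<odot>\<^bsub>prod_module M N\<^esub> x = (a \<odot>\<^bsub>M\<^esub> fst x, a \<odot>\<^bsub>N\<^esub> snd x)"
  by (simp_all add: prod_module_def)

lemma left_module_prod_module:
  assumes "left_module R M" "left_module R N"
  shows "left_module R (prod_module M N)"
proof -
  interpret M: left_module R M by fact
  interpret N: left_module R N by fact
  have "abelian_group (prod_module M N)"
  proof (rule abelian_groupI)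
    fix x assume "x \<in> carrier (prod_module M N)"
    thus "\<exists>y\<in>carrier (prod_module M N). y \<oplus>\<^bsub>prod_module M N\<^esub> x = \<zero>\<^bsub>prod_module M N\<^esub>"
      by (intro bexI[of _ "(\<ominus>\<^bsub>M\<^esub> fst x, \<ominus>\<^bsub>N\<^esub> snd x)"]) (auto simp: M.l_neg N.l_neg)
  qed (auto simp: M.a_ac N.a_ac)
  thus ?thesis
    by (intro left_module.intro left_module_axioms.intro left_module.axioms(1)[OF assms(1)])
      (auto simp: M.smult_closed N.smult_closed M.smult_l_distr N.smult_l_distr M.smult_r_distr
        N.smult_r_distr M.smult_assoc N.smult_assoc M.smult_one N.smult_one)
qed

section \<open>Simple modules\<close>

context witt_height_0
begin

abbreviation UW :: "('k, 'k current) red_env ring" where "UW \<equiv> U.UA"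

text \<open>Stated for a module record rather than inside \<open>chi_module\<close>, so that modules
  over different types and their products can be compared; likewise
  \<open>substable\<close>.\<close>

definition weight_vec :: "(('k, 'k current) red_env, 'm) module \<Rightarrow> 'k \<Rightarrow> 'm \<Rightarrow> bool" where
  "weight_vec M lam v \<longleftrightarrow> v \<in> carrier M \<and>
     (\<forall>x\<in>W0. U.ug x \<odot>\<^bsub>M\<^esub> v = U.uc (lam * lookup x (0, 0)) \<odot>\<^bsub>M\<^esub> v)"

definition substable :: "(('k, 'k current) red_env, 'm) module \<Rightarrow> 'm set \<Rightarrow> bool" where
  "substable M N \<longleftrightarrow> N \<subseteq> carrier M \<and> \<zero>\<^bsub>M\<^esub> \<in> N \<and> (\<forall>w\<in>N. \<forall>w'\<in>N. w \<oplus>\<^bsub>M\<^esub> w' \<in> N) \<and>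
     (\<forall>a\<in>carrier UW. \<forall>w\<in>N. a \<odot>\<^bsub>M\<^esub> w \<in> N)"

context
  fixes M :: "(('k, 'k current) red_env, 'm) module"
  assumes M: "left_module UW M"
begin

interpretation M: left_module UW M by (rule M)

interpretation C: chi_module p ell \<chi> pm M "\<lambda>c w. U.uc c \<odot>\<^bsub>M\<^esub> w" "\<lambda>x w. U.ug x \<odot>\<^bsub>M\<^esub> w"
  by (rule chi_module_of_left_module[OF M])

lemma weight_vec_eq: "weight_vec M = C.weight_vector"
  by (intro ext) (simp add: weight_vec_def C.weight_vector_def)

lemma substable_iff: "substable M N \<longleftrightarrow> C.stable N"
proof
  assume st: "C.stable N"
  have "a \<odot>\<^bsub>M\<^esub> w \<in> N" if "a \<in> carrier UW" "w \<in> N" for a w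
    using that st
  proof (induction a arbitrary: w rule: U.UA_induct)
    case (add a b)
    moreover from this have "w \<in> carrier M" by (auto simp: C.stable_def)
    ultimately show ?case by (auto simp: M.smult_l_distr C.stable_def)
  next
    case (mult a b)
    moreover from this have "w \<in> carrier M" by (auto simp: C.stable_def)
    ultimately show ?case by (simp add: M.smult_assoc)
  qed (auto simp: C.stable_def)
  thus "substable M N" using st by (auto simp: substable_def C.stable_def)
qed (auto simp: substable_def C.stable_def)

lemma substable_orbit: "v \<in> carrier M \<Longrightarrow> substable M (M.orbit v)"
  using M.orbit_props[of v] by (auto simp: substable_def)

lemma substable_ex_weight_vec:
  assumes "substable M N" "s \<in> N" "s \<noteq> \<zero>\<^bsub>M\<^esub>"
  obtains v where "v \<in> N" "v \<noteq> \<zero>\<^bsub>M\<^esub>" "weight_vec M 0 v"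
  using C.ex_highest_weight_vector[of N s] assms unfolding weight_vec_eq substable_iff by blast

text \<open>The \<open>yspan\<close> of v is a submodule containing v, hence contains the orbit, and
  there uniqueness applies.\<close>

lemma weight_vec_in_orbit:
  assumes "weight_vec M 0 v" "weight_vec M 0 f" "f \<in> M.orbit v"
  shows "\<exists>c. f = U.uc c \<odot>\<^bsub>M\<^esub> v"
proof -
  have v: "v \<in> carrier M" using assms(1) by (simp add: weight_vec_def)
  have "C.stable (C.yspan v 0)" using C.stable_yspan assms(1) unfolding weight_vec_eq .
  hence "substable M (C.yspan v 0)" by (simp add: substable_iff)
  moreover have "v \<in> C.yspan v 0" using C.yspan.scalar[of 1 v 0] v C.sc_1[OF v] by simp
  ultimately have "M.orbit v \<subseteq> C.yspan v 0" by (auto simp: M.orbit_def substable_def)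
  thus ?thesis using assms C.highest_weight_vector_unique[of v f] unfolding weight_vec_eq by blast
qed

lemma uc_smult_eq_0_iff: "w \<in> carrier M \<Longrightarrow> U.uc c \<odot>\<^bsub>M\<^esub> w = \<zero>\<^bsub>M\<^esub> \<longleftrightarrow> c = 0 \<or> w = \<zero>\<^bsub>M\<^esub>"
  by (rule C.sc_eq_0_iff)

text \<open>A nonzero submodule contains a nonzero vector of weight 0. This is a nonzero multiple of
  v, so the submodule contains the generator.\<close>

lemma simple_of_weight_vec:
  assumes v: "weight_vec M 0 v" "v \<noteq> \<zero>\<^bsub>M\<^esub>" "carrier M = M.orbit v"
  shows "simple_left_module UW M"
  unfolding simple_left_module_def
proof (intro conjI allI impI)
  have vM: "v \<in> carrier M" using v(1) by (simp add: weight_vec_def)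
  show "left_module UW M" by (rule M)
  show "carrier M \<noteq> {\<zero>\<^bsub>M\<^esub>}" using vM v(2) by auto
  fix H assume H: "submodule H UW M"
  interpret H: submodule H UW M by (rule H)
  have HM: "H \<subseteq> carrier M" using H.subset by simp
  have st: "substable M H"
    using H.one_closed H.m_closed HM H.smult_closed by (auto simp: substable_def)
  show "H = {\<zero>\<^bsub>M\<^esub>} \<or> H = carrier M"
  proof (rule disjCI)
    assume "H \<noteq> carrier M"
    show "H = {\<zero>\<^bsub>M\<^esub>}"
    proof (rule ccontr)
      assume "H \<noteq> {\<zero>\<^bsub>M\<^esub>}"
      then obtain s where "s \<in> H" "s \<noteq> \<zero>\<^bsub>M\<^esub>" using st by (auto simp: substable_def)
      then obtain w where w: "w \<in> H" "w \<noteq> \<zero>\<^bsub>M\<^esub>" "weight_vec M 0 w"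
        using substable_ex_weight_vec[OF st] by blast
      then obtain c where c: "w = U.uc c \<odot>\<^bsub>M\<^esub> v"
        using weight_vec_in_orbit[OF v(1)] v(3) HM by blast
      hence "c \<noteq> 0" using w(2) vM by (auto simp: uc_smult_eq_0_iff)
      hence "U.uc (inverse c) \<odot>\<^bsub>M\<^esub> w = v" using c vM C.sc_sc[of v "inverse c" c] C.sc_1[OF vM] by simp
      hence "v \<in> H" using st w(1) unfolding substable_def by (metis U.uc_closed)
      hence "M.orbit v \<subseteq> H" using st by (auto simp: M.orbit_def substable_def)
      thus False using v(3) HM \<open>H \<noteq> carrier M\<close> by blast
    qed
  qed
qed

lemma simple_ex_generator:
  assumes "simple_left_module UW M"
  obtains v where "weight_vec M 0 v" "v \<noteq> \<zero>\<^bsub>M\<^esub>" "carrier M = M.orbit v"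
proof -
  have "substable M (carrier M)" by (auto simp: substable_def M.smult_closed)
  moreover obtain s where "s \<in> carrier M" "s \<noteq> \<zero>\<^bsub>M\<^esub>"
    using assms by (auto simp: simple_left_module_def)
  ultimately obtain v where v: "v \<in> carrier M" "v \<noteq> \<zero>\<^bsub>M\<^esub>" "weight_vec M 0 v"
    using substable_ex_weight_vec by blast
  have "submodule (M.orbit v) UW M"
    using M.orbit_props[OF v(1)] by (intro M.submoduleI') auto
  hence "M.orbit v = {\<zero>\<^bsub>M\<^esub>} \<or> M.orbit v = carrier M"
    using assms by (auto simp: simple_left_module_def)
  hence "carrier M = M.orbit v" using M.self_in_orbit[OF v(1)] v(2) by auto
  thus thesis using v that by blast
qed

text \<open>Let E be the action of y_l. As E^p is a nonzero scalar, E^(p-m) takes E^m v back to a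
  nonzero multiple of v; for m \<le> p both vectors generate the same submodule.\<close>

lemma weight_vec_shift:
  assumes "weight_vec M lam v" "v \<noteq> \<zero>\<^bsub>M\<^esub>"
  obtains v' where "weight_vec M (lam - of_nat m) v'" "v' \<noteq> \<zero>\<^bsub>M\<^esub>" "v' \<in> M.orbit v" "m \<le> p \<Longrightarrow> v \<in> M.orbit v'"
proof -
  let ?E = "\<lambda>w. U.ug (e (-1) ell) \<odot>\<^bsub>M\<^esub> w"
  have v: "v \<in> carrier M" using assms(1) by (simp add: weight_vec_def)
  have closed: "(?E ^^ n) w \<in> M.orbit w" if "w \<in> carrier M" for n w
    using C.stable_funpow[of "M.orbit w" "e (-1) ell" w n] substable_orbit[OF that] M.self_in_orbit[OF that]
    by (simp add: substable_iff)
  let ?v' = "(?E ^^ m) v"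
  have v'M: "?v' \<in> carrier M" using closed[OF v, of m] M.orbit_subset[OF v] by blast
  have "v \<in> M.orbit ?v'" if "m \<le> p"
  proof -
    have "(?E ^^ (p - m)) ?v' = (?E ^^ p) v" using that by (simp flip: o_apply[of "?E ^^ (p - m)"] funpow_add)
    also have "\<dots> = U.uc (\<chi> (e (-1) ell) ^ p) \<odot>\<^bsub>M\<^esub> v" by (rule C.funpow_e_minus_1) (use v in auto)
    finally have "U.uc (\<chi> (e (-1) ell) ^ p) \<odot>\<^bsub>M\<^esub> v \<in> M.orbit ?v'" using closed[OF v'M, of "p - m"] by simp
    hence "U.uc (inverse (\<chi> (e (-1) ell) ^ p)) \<odot>\<^bsub>M\<^esub> (U.uc (\<chi> (e (-1) ell) ^ p) \<odot>\<^bsub>M\<^esub> v) \<in> M.orbit ?v'"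
      by (rule M.orbit_smult[OF v'M U.uc_closed])
    thus ?thesis using v chi_ell C.sc_sc[OF v] C.sc_1[OF v] by simp
  qed
  thus thesis
    using C.weight_vector_funpow[of lam v m] assms closed[OF v, of m]
    by (intro that[of ?v']) (auto simp: weight_vec_eq)
qed

end

text \<open>If a v = 0 but a w \<noteq> 0, the vectors with first component 0 form a nonzero
  submodule of the orbit of (v, w). It contains a nonzero vector of weight 0, which must be c (v,
  w); the first component forces c = 0.\<close>

lemma annihilator_subset:
  fixes M :: "(('k, 'k current) red_env, 'm) module" and N :: "(('k, 'k current) red_env, 'n) module"
  assumes M: "left_module UW M" "weight_vec M 0 v" "v \<noteq> \<zero>\<^bsub>M\<^esub>"
    and N: "left_module UW N" "weight_vec N 0 w"
    and a: "a \<in> carrier UW" "a \<odot>\<^bsub>M\<^esub> v = \<zero>\<^bsub>M\<^esub>"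
  shows "a \<odot>\<^bsub>N\<^esub> w = \<zero>\<^bsub>N\<^esub>"
proof (rule ccontr)
  assume nz: "a \<odot>\<^bsub>N\<^esub> w \<noteq> \<zero>\<^bsub>N\<^esub>"
  let ?P = "prod_module M N"
  have P: "left_module UW ?P" by (rule left_module_prod_module) fact+
  interpret M: left_module UW M by fact
  interpret P: left_module UW ?P by (rule P)
  have vw: "v \<in> carrier M" "w \<in> carrier N" using M N by (auto simp: weight_vec_def)
  have vwP: "weight_vec ?P 0 (v, w)"
    using M(2) N(2) by (simp add: weight_vec_def)
  have vwc: "(v, w) \<in> carrier ?P" using vw by simp
  define N' where "N' = {x \<in> P.orbit (v, w). fst x = \<zero>\<^bsub>M\<^esub>}"
  have zero: "b \<odot>\<^bsub>M\<^esub> \<zero>\<^bsub>M\<^esub> = \<zero>\<^bsub>M\<^esub>" if "b \<in> carrier UW" for b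
    using that M.smult_r_distr[of b "\<zero>\<^bsub>M\<^esub>" "\<zero>\<^bsub>M\<^esub>"] M.smult_closed[of b "\<zero>\<^bsub>M\<^esub>"]
      M.add.l_cancel_one[of "b \<odot>\<^bsub>M\<^esub> \<zero>\<^bsub>M\<^esub>" "b \<odot>\<^bsub>M\<^esub> \<zero>\<^bsub>M\<^esub>"] by simp
  have "substable ?P N'"
    unfolding substable_def
  proof (intro conjI ballI)
    show "N' \<subseteq> carrier ?P" using P.orbit_subset[OF vwc] by (auto simp: N'_def)
    show "\<zero>\<^bsub>?P\<^esub> \<in> N'" using P.zero_in_orbit[OF vwc] by (simp add: N'_def)
    show "x \<oplus>\<^bsub>?P\<^esub> y \<in> N'" if "x \<in> N'" "y \<in> N'" for x y
      using that P.orbit_add[OF vwc, of x y] by (simp add: N'_def)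
    show "b \<odot>\<^bsub>?P\<^esub> x \<in> N'" if "b \<in> carrier UW" "x \<in> N'" for b x
      using that P.orbit_smult[OF vwc, of b x] zero by (simp add: N'_def)
  qed
  moreover have "a \<odot>\<^bsub>?P\<^esub> (v, w) \<in> N'"
    using a P.orbit_smult[OF vwc a(1) P.self_in_orbit[OF vwc]] by (simp add: N'_def)
  moreover have "a \<odot>\<^bsub>?P\<^esub> (v, w) \<noteq> \<zero>\<^bsub>?P\<^esub>" using nz by simp
  ultimately obtain x where x: "x \<in> N'" "x \<noteq> \<zero>\<^bsub>?P\<^esub>" "weight_vec ?P 0 x"
    using substable_ex_weight_vec[OF P] by blast
  then obtain c where c: "x = U.uc c \<odot>\<^bsub>?P\<^esub> (v, w)"
    using weight_vec_in_orbit[OF P vwP, of x] by (auto simp: N'_def)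
  hence "U.uc c \<odot>\<^bsub>M\<^esub> v = \<zero>\<^bsub>M\<^esub>" using x(1) by (simp add: N'_def)
  hence "c = 0" using uc_smult_eq_0_iff[OF M(1) vw(1)] M(3) by blast
  thus False using c x(2) uc_smult_eq_0_iff[OF P vwc, of c] by blast
qed

lemma simple_modules_iso:
  fixes M :: "(('k, 'k current) red_env, 'm) module" and N :: "(('k, 'k current) red_env, 'n) module"
  assumes "simple_left_module UW M" "simple_left_module UW N"
  shows "left_module_iso UW M N"
proof -
  have M: "left_module UW M" and N: "left_module UW N"
    using assms by (auto simp: simple_left_module_def)
  obtain v where v: "weight_vec M 0 v" "v \<noteq> \<zero>\<^bsub>M\<^esub>" "carrier M = left_module.orbit UW M v"
    using simple_ex_generator[OF M assms(1)] by blast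
  obtain w where w: "weight_vec N 0 w" "w \<noteq> \<zero>\<^bsub>N\<^esub>" "carrier N = left_module.orbit UW N w"
    using simple_ex_generator[OF N assms(2)] by blast
  show ?thesis
  proof (rule left_module_iso_cyclic[OF M N _ v(3) _ w(3)])
    show "v \<in> carrier M" "w \<in> carrier N" using v(1) w(1) by (auto simp: weight_vec_def)
    show "a \<odot>\<^bsub>M\<^esub> v = \<zero>\<^bsub>M\<^esub> \<longleftrightarrow> a \<odot>\<^bsub>N\<^esub> w = \<zero>\<^bsub>N\<^esub>" if "a \<in> carrier UW" for a
      using annihilator_subset[OF M v(1,2) N w(1) that] annihilator_subset[OF N w(1,2) M v(1) that] by blast
  qed
qed

lemma simple_of_weight_vec_of_nat:
  assumes M: "left_module UW M" and v: "weight_vec M (of_nat m) v" "v \<noteq> \<zero>\<^bsub>M\<^esub>" "m \<le> p"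
    and car: "carrier M = left_module.orbit UW M v"
  shows "simple_left_module UW M"
proof -
  interpret M: left_module UW M by fact
  obtain v' where v': "weight_vec M (of_nat m - of_nat m) v'" "v' \<noteq> \<zero>\<^bsub>M\<^esub>" "v \<in> M.orbit v'"
    using weight_vec_shift[OF M v(1,2), of m] v(3) by blast
  have v'M: "v' \<in> carrier M" using v'(1) by (simp add: weight_vec_def)
  have "M.orbit v \<subseteq> M.orbit v'"
    using M.orbit_smult[OF v'M _ v'(3)] by (auto simp: M.orbit_def[of v])
  hence "carrier M = M.orbit v'" using car M.orbit_subset[OF v'M] by blast
  thus ?thesis using v' by (intro simple_of_weight_vec[OF M]) auto
qed

section \<open>Existence of a simple module\<close>

definition regular_module :: "(('k, 'k current) red_env, ('k, 'k current) red_env) module" where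
  "regular_module = \<lparr>carrier = carrier UW, monoid.mult = (\<lambda>_ _. undefined), one = undefined,
     ring.zero = \<zero>\<^bsub>UW\<^esub>, add = (\<oplus>\<^bsub>UW\<^esub>), module.smult = (\<otimes>\<^bsub>UW\<^esub>)\<rparr>"

lemma regular_module_simps [simp]:
  "carrier regular_module = carrier UW" "\<zero>\<^bsub>regular_module\<^esub> = \<zero>\<^bsub>UW\<^esub>"
  "a \<oplus>\<^bsub>regular_module\<^esub> b = a \<oplus>\<^bsub>UW\<^esub> b" "a \<odot>\<^bsub>regular_module\<^esub> b = a \<otimes>\<^bsub>UW\<^esub> b"
  by (simp_all add: regular_module_def)

lemma left_module_regular: "left_module UW regular_module"
proof (intro left_module.intro left_module_axioms.intro U.ring_UA)
  show "abelian_group regular_module"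
  proof (rule abelian_groupI)
    fix x assume "x \<in> carrier regular_module"
    thus "\<exists>y\<in>carrier regular_module. y \<oplus>\<^bsub>regular_module\<^esub> x = \<zero>\<^bsub>regular_module\<^esub>"
      by (intro bexI[of _ "\<ominus>\<^bsub>UW\<^esub> x"]) (auto simp: U.UA.l_neg)
  qed (auto simp: U.UA.a_ac)
qed (auto simp: U.UA.l_distr U.UA.r_distr U.UA.m_assoc)

lemma regular_ex_weight_vec:
  obtains u where "weight_vec regular_module 0 u" "u \<noteq> \<zero>\<^bsub>UW\<^esub>"
proof -
  have "substable regular_module (carrier UW)" by (auto simp: substable_def)
  from substable_ex_weight_vec[OF left_module_regular this, of "\<one>\<^bsub>UW\<^esub>"] that show thesis
    using one_not_zero_UA by auto
qed

text \<open>A minimal left ideal, with singletons as elements for the sake of the type.\<close>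

lemma ex_simple_module:
  "\<exists>S :: (('k, 'k current) red_env, ('k, 'k current) red_env set) module. simple_left_module UW S"
proof -
  obtain u where u: "weight_vec regular_module 0 u" "u \<noteq> \<zero>\<^bsub>UW\<^esub>"
    by (rule regular_ex_weight_vec)
  interpret R: left_module UW regular_module by (rule left_module_regular)
  have uU: "u \<in> carrier UW" using u(1) by (simp add: weight_vec_def)
  define I where "I = R.orbit u"
  have I: "I \<subseteq> carrier UW" "\<zero>\<^bsub>UW\<^esub> \<in> I" "u \<in> I"
    "\<And>x y. x \<in> I \<Longrightarrow> y \<in> I \<Longrightarrow> x \<oplus>\<^bsub>UW\<^esub> y \<in> I"
    "\<And>a x. a \<in> carrier UW \<Longrightarrow> x \<in> I \<Longrightarrow> a \<otimes>\<^bsub>UW\<^esub> x \<in> I"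
    using R.orbit_props[of u] uU by (simp_all add: I_def)
  have neg: "\<ominus>\<^bsub>UW\<^esub> x \<in> I" if "x \<in> I" for x
  proof -
    have "(\<ominus>\<^bsub>UW\<^esub> \<one>\<^bsub>UW\<^esub>) \<otimes>\<^bsub>UW\<^esub> x \<in> I" using that by (intro I(5)) auto
    moreover have "x \<in> carrier UW" using that I(1) by blast
    ultimately show ?thesis by (simp add: U.UA.l_minus)
  qed
  define S :: "(('k, 'k current) red_env, ('k, 'k current) red_env set) module" where
    "S = \<lparr>carrier = (\<lambda>x. {x}) ` I, monoid.mult = (\<lambda>_ _. undefined), one = undefined,
     ring.zero = {\<zero>\<^bsub>UW\<^esub>}, add = (\<lambda>X Y. {the_elem X \<oplus>\<^bsub>UW\<^esub> the_elem Y}),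
     module.smult = (\<lambda>a X. {a \<otimes>\<^bsub>UW\<^esub> the_elem X})\<rparr>"
  have S: "carrier S = (\<lambda>x. {x}) ` I" "\<zero>\<^bsub>S\<^esub> = {\<zero>\<^bsub>UW\<^esub>}" "{x} \<oplus>\<^bsub>S\<^esub> {y} = {x \<oplus>\<^bsub>UW\<^esub> y}"
    "a \<odot>\<^bsub>S\<^esub> {x} = {a \<otimes>\<^bsub>UW\<^esub> x}" for a x y
    by (simp_all add: S_def)
  have SM: "left_module UW S"
  proof (intro left_module.intro left_module_axioms.intro U.ring_UA)
    show "abelian_group S"
    proof (rule abelian_groupI)
      fix X assume "X \<in> carrier S"
      then obtain x where x: "X = {x}" "x \<in> I" by (auto simp: S)
      moreover from this have "x \<in> carrier UW" using I by blast
      ultimately show "\<exists>Y\<in>carrier S. Y \<oplus>\<^bsub>S\<^esub> X = \<zero>\<^bsub>S\<^esub>"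
        by (intro bexI[of _ "{\<ominus>\<^bsub>UW\<^esub> x}"]) (auto simp: S U.UA.l_neg neg)
    qed (use I in \<open>auto simp: S U.UA.a_ac subset_iff\<close>)
  qed (use I in \<open>auto simp: S U.UA.l_distr U.UA.r_distr U.UA.m_assoc subset_iff\<close>)
  have "simple_left_module UW S"
  proof (rule simple_of_weight_vec[OF SM])
    show "weight_vec S 0 {u}" using u(1) I(3) by (auto simp: weight_vec_def S)
    show "{u} \<noteq> \<zero>\<^bsub>S\<^esub>" using u(2) by (simp add: S)
    show "carrier S = left_module.orbit UW S {u}"
      by (auto simp: left_module.orbit_def[OF SM] S I_def R.orbit_def)
  qed
  thus ?thesis by blast
qed

end

section \<open>Induced modules\<close>

locale tensor_setup = A: ring A
  for A :: "'a ring" and \<phi> :: "'b \<Rightarrow> 'a" and B :: "'b ring" and N :: "('b, 'n) module" +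
  assumes \<phi>_closed: "b \<in> carrier B \<Longrightarrow> \<phi> b \<in> carrier A"
    and N_closed: "n \<in> carrier N \<Longrightarrow> n' \<in> carrier N \<Longrightarrow> n \<oplus>\<^bsub>N\<^esub> n' \<in> carrier N"
      "b \<in> carrier B \<Longrightarrow> n \<in> carrier N \<Longrightarrow> b \<odot>\<^bsub>N\<^esub> n \<in> carrier N"
begin

abbreviation F :: "(('a \<times> 'n) \<Rightarrow>\<^sub>0 int) monoid" where "F \<equiv> free_Abelian_group (carrier A \<times> carrier N)"
abbreviation rels :: "(('a \<times> 'n) \<Rightarrow>\<^sub>0 int) set" where "rels \<equiv> tensor_rels A \<phi> B N"
abbreviation Z :: "('a, (('a \<times> 'n) \<Rightarrow>\<^sub>0 int) set) module" where "Z \<equiv> tensor_module A \<phi> B N"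

definition H :: "(('a \<times> 'n) \<Rightarrow>\<^sub>0 int) set" where "H = generate F rels"

definition cl :: "(('a \<times> 'n) \<Rightarrow>\<^sub>0 int) \<Rightarrow> (('a \<times> 'n) \<Rightarrow>\<^sub>0 int) set" where
  "cl f = H #>\<^bsub>F\<^esub> f"

definition lact :: "'a \<Rightarrow> (('a \<times> 'n) \<Rightarrow>\<^sub>0 int) \<Rightarrow> (('a \<times> 'n) \<Rightarrow>\<^sub>0 int)" where
  "lact a = frag_extend (\<lambda>(a', n). frag_of (a \<otimes>\<^bsub>A\<^esub> a', n))"

definition tens :: "'a \<Rightarrow> 'n \<Rightarrow> (('a \<times> 'n) \<Rightarrow>\<^sub>0 int) set" where
  "tens a n = cl (frag_of (a, n))"

sublocale F: comm_group F by (rule abelian_free_Abelian_group)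

lemma rels_cases:
  assumes "r \<in> rels"
  obtains a a' n where "a \<in> carrier A" "a' \<in> carrier A" "n \<in> carrier N"
      "r = frag_of (a \<oplus>\<^bsub>A\<^esub> a', n) - frag_of (a, n) - frag_of (a', n)"
  | a n n' where "a \<in> carrier A" "n \<in> carrier N" "n' \<in> carrier N"
      "r = frag_of (a, n \<oplus>\<^bsub>N\<^esub> n') - frag_of (a, n) - frag_of (a, n')"
  | a b n where "a \<in> carrier A" "b \<in> carrier B" "n \<in> carrier N"
      "r = frag_of (a \<otimes>\<^bsub>A\<^esub> \<phi> b, n) - frag_of (a, b \<odot>\<^bsub>N\<^esub> n)"
  by (insert assms, unfold tensor_rels_def, elim UnE CollectE exE conjE, (rule that(1), assumption, assumption, assumption, assumption),
      (rule that(2), assumption, assumption, assumption, assumption),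
      (rule that(3), assumption, assumption, assumption, assumption))

lemma rels_intros:
  "a \<in> carrier A \<Longrightarrow> a' \<in> carrier A \<Longrightarrow> n \<in> carrier N \<Longrightarrow>
     frag_of (a \<oplus>\<^bsub>A\<^esub> a', n) - frag_of (a, n) - frag_of (a', n) \<in> rels"
  "a \<in> carrier A \<Longrightarrow> n \<in> carrier N \<Longrightarrow> n' \<in> carrier N \<Longrightarrow>
     frag_of (a, n \<oplus>\<^bsub>N\<^esub> n') - frag_of (a, n) - frag_of (a, n') \<in> rels"
  "a \<in> carrier A \<Longrightarrow> b \<in> carrier B \<Longrightarrow> n \<in> carrier N \<Longrightarrow>
     frag_of (a \<otimes>\<^bsub>A\<^esub> \<phi> b, n) - frag_of (a, b \<odot>\<^bsub>N\<^esub> n) \<in> rels"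
  unfolding tensor_rels_def by (rule UnI1, rule UnI1, blast) (rule UnI1, rule UnI2, blast, rule UnI2, blast)

lemma F_diff: "f \<in> carrier F \<Longrightarrow> g \<in> carrier F \<Longrightarrow> f - g \<in> carrier F"
  using keys_diff[of f g] by auto

lemma F_add: "f \<in> carrier F \<Longrightarrow> g \<in> carrier F \<Longrightarrow> f + g \<in> carrier F"
  using keys_add[of f g] by auto

lemma F_frag_of: "a \<in> carrier A \<Longrightarrow> n \<in> carrier N \<Longrightarrow> frag_of (a, n) \<in> carrier F"
  by simp

lemma rels_subset: "rels \<subseteq> carrier F"
proof
  fix r assume "r \<in> rels"
  thus "r \<in> carrier F"
    by (cases rule: rels_cases) (simp_all only: F_diff F_frag_of A.a_closed A.m_closed N_closed \<phi>_closed)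
qed

lemma subgroup_H: "subgroup H F"
  unfolding H_def by (rule F.generate_is_subgroup[OF rels_subset])

sublocale H: subgroup H F by (rule subgroup_H)

lemma normal_H: "H \<lhd> F"
  using subgroup_H by (rule F.subgroup_imp_normal)

lemma H_facts: "0 \<in> H" "h \<in> H \<Longrightarrow> h' \<in> H \<Longrightarrow> h + h' \<in> H" "h \<in> H \<Longrightarrow> - h \<in> H"
  "h \<in> H \<Longrightarrow> h' \<in> H \<Longrightarrow> h - h' \<in> H" "h \<in> H \<Longrightarrow> h \<in> carrier F" "r \<in> rels \<Longrightarrow> r \<in> H"
proof -
  show "0 \<in> H" using H.one_closed by simp
  show c: "h \<in> carrier F" if "h \<in> H" for h using that by (rule H.mem_carrier)
  show add: "h + h' \<in> H" if "h \<in> H" "h' \<in> H" for h h' using H.m_closed[OF that] by simp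
  show neg: "- h \<in> H" if "h \<in> H" for h using H.m_inv_closed[OF that] c[OF that] by simp
  show "h - h' \<in> H" if "h \<in> H" "h' \<in> H" for h h' using add[OF that(1) neg[OF that(2)]] by simp
  show "r \<in> H" if "r \<in> rels" for r unfolding H_def using that by (rule generate.incl)
qed

lemma H_induct:
  assumes "h \<in> H" "\<And>r. r \<in> rels \<Longrightarrow> P r" "P 0" "\<And>h h'. h \<in> H \<Longrightarrow> h' \<in> H \<Longrightarrow> P h \<Longrightarrow> P h' \<Longrightarrow> P (h + h')"
    and "\<And>h. h \<in> H \<Longrightarrow> P h \<Longrightarrow> P (- h)"
  shows "P h"
proof -
  have "h \<in> generate F rels" using assms(1) by (simp add: H_def)
  hence "h \<in> H \<and> P h"
  proof (induction rule: generate.induct)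
    case one
    thus ?case using assms(3) H_facts(1) by simp
  next
    case (incl r)
    thus ?case using assms(2) H_facts(6) by simp
  next
    case (inv r)
    hence "inv\<^bsub>F\<^esub> r = - r" using rels_subset by auto
    thus ?case using inv assms(2,5) H_facts(3,6) by simp
  next
    case (eng h h')
    thus ?case using assms(4) H_facts(2) by simp
  qed
  thus ?thesis by blast
qed

lemma cl_eq: "cl f = (\<lambda>h. h + f) ` H"
  by (auto simp: cl_def r_coset_def)

lemma cl_eq_iff: "cl f = cl g \<longleftrightarrow> f - g \<in> H"
proof
  assume "cl f = cl g"
  moreover have "f \<in> cl f" using H_facts(1) by (force simp: cl_eq)
  ultimately obtain h where "h \<in> H" "f = h + g" by (auto simp: cl_eq)
  thus "f - g \<in> H" by simp
next
  assume fg: "f - g \<in> H"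
  show "cl f = cl g"
  proof (intro Set.set_eqI iffI)
    fix x assume "x \<in> cl f"
    then obtain h where "h \<in> H" "x = h + f" by (auto simp: cl_eq)
    thus "x \<in> cl g" unfolding cl_eq using H_facts(2)[OF \<open>h \<in> H\<close> fg] by (intro image_eqI[of _ _ "h + (f - g)"]) auto
  next
    fix x assume "x \<in> cl g"
    then obtain h where "h \<in> H" "x = h + g" by (auto simp: cl_eq)
    thus "x \<in> cl f" unfolding cl_eq using H_facts(4)[OF \<open>h \<in> H\<close> fg] by (intro image_eqI[of _ _ "h - (f - g)"]) auto
  qed
qed

lemma lact_simps: "lact a 0 = 0" "lact a (f + g) = lact a f + lact a g" "lact a (f - g) = lact a f - lact a g"
  "lact a (- f) = - lact a f" "lact a (frag_of (a', n)) = frag_of (a \<otimes>\<^bsub>A\<^esub> a', n)"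
  by (simp_all add: lact_def frag_extend_add frag_extend_diff frag_extend_minus)

lemma F_induct [consumes 1, case_names zero frag diff]:
  assumes "f \<in> carrier F" "P 0" "\<And>a n. a \<in> carrier A \<Longrightarrow> n \<in> carrier N \<Longrightarrow> P (frag_of (a, n))"
    and "\<And>f g. P f \<Longrightarrow> P g \<Longrightarrow> P (f - g)"
  shows "P f"
proof -
  have "keys f \<subseteq> carrier A \<times> carrier N" using assms(1) by simp
  thus ?thesis by (induction f rule: frag_induction) (use assms in auto)
qed

lemma lact_closed:
  assumes "a \<in> carrier A" "f \<in> carrier F"
  shows "lact a f \<in> carrier F"
  using assms(2)
proof (induction f rule: F_induct)
  case zero
  thus ?case using H_facts(5)[OF H_facts(1)] by (simp only: lact_simps)
qed (simp_all only: lact_simps F_diff F_frag_of A.m_closed assms(1))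

lemma lact_H:
  assumes "a \<in> carrier A" "h \<in> H"
  shows "lact a h \<in> H"
  using assms(2)
proof (rule H_induct)
  fix r assume "r \<in> rels"
  hence "lact a r \<in> rels"
  proof (cases rule: rels_cases)
    case (1 b b' n)
    thus ?thesis using assms(1) rels_intros(1)[of "a \<otimes>\<^bsub>A\<^esub> b" "a \<otimes>\<^bsub>A\<^esub> b'" n]
      by (simp add: lact_simps A.r_distr)
  next
    case (2 b n n')
    thus ?thesis using assms(1) rels_intros(2)[of "a \<otimes>\<^bsub>A\<^esub> b" n n'] by (simp add: lact_simps)
  next
    case (3 b c n)
    thus ?thesis using assms(1) rels_intros(3)[of "a \<otimes>\<^bsub>A\<^esub> b" c n] \<phi>_closed
      by (simp add: lact_simps A.m_assoc)
  qed
  thus "lact a r \<in> H" by (rule H_facts(6))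
qed (simp_all only: lact_simps H_facts)

lemma Z_carrier: "carrier Z = cl ` carrier F"
  by (auto simp: tensor_module_def Let_def FactGroup_def RCOSETS_def cl_def H_def)

lemma Z_zero: "\<zero>\<^bsub>Z\<^esub> = cl 0"
  by (simp add: tensor_module_def Let_def FactGroup_def cl_eq flip: H_def)

lemma Z_add: "f \<in> carrier F \<Longrightarrow> g \<in> carrier F \<Longrightarrow> cl f \<oplus>\<^bsub>Z\<^esub> cl g = cl (f + g)"
  using normal.rcos_sum[OF normal_H, of f g]
  by (simp add: tensor_module_def Let_def FactGroup_def cl_def flip: H_def)

lemma Z_smult:
  assumes "a \<in> carrier A"
  shows "a \<odot>\<^bsub>Z\<^esub> cl f = cl (lact a f)"
proof -
  have "a \<odot>\<^bsub>Z\<^esub> cl f = H <#>\<^bsub>F\<^esub> (lact a ` cl f)"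
    by (simp add: tensor_module_def Let_def lact_def flip: H_def)
  also have "\<dots> = cl (lact a f)"
  proof (intro Set.set_eqI iffI)
    fix x assume "x \<in> H <#>\<^bsub>F\<^esub> (lact a ` cl f)"
    then obtain h h' where "h \<in> H" "h' \<in> H" "x = h + lact a (h' + f)"
      by (auto simp: set_mult_def cl_eq)
    hence "h + lact a h' \<in> H" "x = (h + lact a h') + lact a f"
      using assms lact_H H_facts(2) by (simp_all add: lact_simps)
    thus "x \<in> cl (lact a f)" unfolding cl_eq by blast
  next
    fix x assume "x \<in> cl (lact a f)"
    then obtain h where "h \<in> H" "x = h \<otimes>\<^bsub>F\<^esub> lact a f" by (auto simp: cl_eq)
    moreover have "f \<in> cl f" using H_facts(1) by (force simp: cl_eq)
    ultimately show "x \<in> H <#>\<^bsub>F\<^esub> (lact a ` cl f)" unfolding set_mult_def by blast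
  qed
  finally show ?thesis .
qed

lemma left_module_Z: "left_module A Z"
proof (intro left_module.intro left_module_axioms.intro A.ring_axioms)
  note c = F_add lact_closed H_facts(5)[OF H_facts(1)]
  show "abelian_group Z"
  proof (rule abelian_groupI)
    fix X assume "X \<in> carrier Z"
    then obtain f where f: "f \<in> carrier F" "X = cl f" by (auto simp: Z_carrier)
    have m: "0 - f \<in> carrier F" by (rule F_diff[OF c(3) f(1)])
    have "cl (0 - f) \<in> carrier Z" using m unfolding Z_carrier by blast
    moreover have "cl (0 - f) \<oplus>\<^bsub>Z\<^esub> X = \<zero>\<^bsub>Z\<^esub>"
      unfolding f(2) Z_add[OF m f(1)] Z_zero by simp
    ultimately show "\<exists>Y\<in>carrier Z. Y \<oplus>\<^bsub>Z\<^esub> X = \<zero>\<^bsub>Z\<^esub>" by blast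
  next
    show "X \<oplus>\<^bsub>Z\<^esub> Y \<in> carrier Z" if "X \<in> carrier Z" "Y \<in> carrier Z" for X Y
      using that c(1) unfolding Z_carrier by (auto simp only: Z_add image_iff; blast)
    show "\<zero>\<^bsub>Z\<^esub> \<in> carrier Z" using c(3) unfolding Z_carrier Z_zero by blast
    show "X \<oplus>\<^bsub>Z\<^esub> Y \<oplus>\<^bsub>Z\<^esub> V = X \<oplus>\<^bsub>Z\<^esub> (Y \<oplus>\<^bsub>Z\<^esub> V)"
      if "X \<in> carrier Z" "Y \<in> carrier Z" "V \<in> carrier Z" for X Y V
      using that unfolding Z_carrier by (elim imageE) (simp only: Z_add F_add add.assoc)
    show "X \<oplus>\<^bsub>Z\<^esub> Y = Y \<oplus>\<^bsub>Z\<^esub> X" if "X \<in> carrier Z" "Y \<in> carrier Z" for X Y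
      using that unfolding Z_carrier by (elim imageE) (simp only: Z_add F_add add.commute)
    show "\<zero>\<^bsub>Z\<^esub> \<oplus>\<^bsub>Z\<^esub> X = X" if "X \<in> carrier Z" for X
      using that c(3) unfolding Z_carrier Z_zero by (elim imageE) (simp only: Z_add add_0)
  qed
  show "a \<odot>\<^bsub>Z\<^esub> X \<in> carrier Z" if "a \<in> carrier A" "X \<in> carrier Z" for a X
    using that c(2) unfolding Z_carrier by (auto simp only: Z_smult)
  show "(a \<oplus>\<^bsub>A\<^esub> b) \<odot>\<^bsub>Z\<^esub> X = a \<odot>\<^bsub>Z\<^esub> X \<oplus>\<^bsub>Z\<^esub> b \<odot>\<^bsub>Z\<^esub> X"
    if ab: "a \<in> carrier A" "b \<in> carrier A" and "X \<in> carrier Z" for a b X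
  proof -
    from that obtain f where f: "f \<in> carrier F" "X = cl f" by (auto simp: Z_carrier)
    \<comment> \<open>Additivity in the scalar holds only modulo \<open>H\<close>, through the first
      family of relations; the other module laws hold already for representatives.\<close>
    have "lact (a \<oplus>\<^bsub>A\<^esub> b) f - lact a f - lact b f \<in> H"
      using f(1)
    proof (induction f rule: F_induct)
      case zero
      show ?case using H_facts(1) by (simp add: lact_simps)
    next
      case (frag a' n)
      thus ?case using ab H_facts(6)[OF rels_intros(1)[of "a \<otimes>\<^bsub>A\<^esub> a'" "b \<otimes>\<^bsub>A\<^esub> a'" n]]
        by (simp add: lact_simps A.l_distr)
    next
      case (diff f g)
      have "lact (a \<oplus>\<^bsub>A\<^esub> b) (f - g) - lact a (f - g) - lact b (f - g) =
         (lact (a \<oplus>\<^bsub>A\<^esub> b) f - lact a f - lact b f) - (lact (a \<oplus>\<^bsub>A\<^esub> b) g - lact a g - lact b g)"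
        by (simp add: lact_simps)
      thus ?case using H_facts(4)[OF diff] by simp
    qed
    thus ?thesis unfolding f(2) using ab f(1)
      by (simp add: Z_smult Z_add lact_closed cl_eq_iff diff_diff_eq del: carrier_free_Abelian_group_iff)
  qed
  show "a \<odot>\<^bsub>Z\<^esub> (X \<oplus>\<^bsub>Z\<^esub> Y) = a \<odot>\<^bsub>Z\<^esub> X \<oplus>\<^bsub>Z\<^esub> a \<odot>\<^bsub>Z\<^esub> Y"
    if "a \<in> carrier A" "X \<in> carrier Z" "Y \<in> carrier Z" for a X Y
    using that unfolding Z_carrier by (elim imageE) (simp only: Z_add Z_smult lact_closed F_add lact_simps)
  show "(a \<otimes>\<^bsub>A\<^esub> b) \<odot>\<^bsub>Z\<^esub> X = a \<odot>\<^bsub>Z\<^esub> (b \<odot>\<^bsub>Z\<^esub> X)"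
    if ab: "a \<in> carrier A" "b \<in> carrier A" and "X \<in> carrier Z" for a b X
  proof -
    from that obtain f where f: "f \<in> carrier F" "X = cl f" by (auto simp: Z_carrier)
    have "lact (a \<otimes>\<^bsub>A\<^esub> b) f = lact a (lact b f)"
      using f(1) by (induction f rule: F_induct) (simp_all add: lact_simps A.m_assoc ab)
    thus ?thesis unfolding f(2) using ab by (simp add: Z_smult)
  qed
  show "\<one>\<^bsub>A\<^esub> \<odot>\<^bsub>Z\<^esub> X = X" if "X \<in> carrier Z" for X
  proof -
    from that obtain f where f: "f \<in> carrier F" "X = cl f" by (auto simp: Z_carrier)
    have "lact \<one>\<^bsub>A\<^esub> f = f"
      using f(1) by (induction f rule: F_induct) (simp_all add: lact_simps)
    thus ?thesis unfolding f(2) by (simp add: Z_smult)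
  qed
qed

lemma tens_closed: "a \<in> carrier A \<Longrightarrow> n \<in> carrier N \<Longrightarrow> tens a n \<in> carrier Z"
  unfolding Z_carrier tens_def using F_frag_of by blast

lemma tens_\<phi>: "a \<in> carrier A \<Longrightarrow> b \<in> carrier B \<Longrightarrow> n \<in> carrier N \<Longrightarrow> tens (a \<otimes>\<^bsub>A\<^esub> \<phi> b) n = tens a (b \<odot>\<^bsub>N\<^esub> n)"
  unfolding tens_def cl_eq_iff by (intro H_facts(6) rels_intros)

lemma smult_tens: "a \<in> carrier A \<Longrightarrow> a \<odot>\<^bsub>Z\<^esub> tens a' n = tens (a \<otimes>\<^bsub>A\<^esub> a') n"
  by (simp add: tens_def Z_smult lact_simps)

text \<open>The universal property in contrapositive form: a homomorphism killing the relations
  kills \<open>H\<close>, so it detects nonzero tensors.\<close>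

lemma tens_nonzero:
  assumes K: "comm_group K" and h: "h \<in> hom F K" "\<And>r. r \<in> rels \<Longrightarrow> h r = \<one>\<^bsub>K\<^esub>"
    and "h (frag_of (a, n)) \<noteq> \<one>\<^bsub>K\<^esub>"
  shows "tens a n \<noteq> \<zero>\<^bsub>Z\<^esub>"
proof
  interpret K: comm_group K by fact
  interpret h: group_hom F K h by unfold_locales (rule h(1))
  have kernel: "subgroup (kernel F K h) F" by (rule h.subgroup_kernel)
  assume "tens a n = \<zero>\<^bsub>Z\<^esub>"
  hence "frag_of (a, n) \<in> H" by (simp add: tens_def Z_zero cl_eq_iff)
  moreover have "rels \<subseteq> kernel F K h"
    unfolding kernel_def using h(2) rels_subset by blast
  hence "H \<subseteq> kernel F K h"
    unfolding H_def by (rule F.generate_subgroup_incl[OF _ kernel])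
  ultimately show False using assms(4) by (auto simp: kernel_def)
qed

end

section \<open>Verma modules\<close>

lemma (in abelian_group) add_minus_minus:
  assumes "x \<in> carrier G" "y \<in> carrier G"
  shows "(x \<oplus> y) \<ominus> x \<ominus> y = \<zero>"
proof -
  have "(x \<oplus> y) \<ominus> x = y \<oplus> (x \<oplus> \<ominus> x)"
    using assms by (simp add: a_minus_def a_ac)
  thus ?thesis using assms by (simp add: a_minus_def r_neg)
qed

context witt_height_0
begin

lemma Lambda_cases:
  assumes "lam \<in> Lambda p ell \<chi>"
  obtains m where "m < p" "lam = of_nat m" "lam ^ p = lam"
  using assms frobenius_fixed_imp_of_nat[OF prime_p char, of lam] by (auto simp: Lambda_eq)

context
  fixes lam :: 'k and m :: nat
  assumes lam: "lam = of_nat m" "m < p" "lam ^ p = lam"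
begin

interpretation T: tensor_setup UW inc V.S.UA "one_dim_module (verma_weight p ell \<chi> lam)"
  by unfold_locales (auto simp: incl_closed one_dim_module_def)

lemma N_simps: "carrier (one_dim_module \<theta>) = UNIV" "c \<oplus>\<^bsub>one_dim_module \<theta>\<^esub> d = c + d"
  "b \<odot>\<^bsub>one_dim_module \<theta>\<^esub> c = red_env_char \<theta> b * c"
  by (simp_all add: one_dim_module_def)

lemma verma_eq: "verma p ell pm \<chi> lam = T.Z"
  by (simp add: verma_def)

text \<open>The scalar c is the character of its own class in the algebra of \<open>W0\<close> and
  may be moved across the tensor sign, so a \<otimes> c is a multiple of 1 \<otimes> 1.\<close>

lemma verma_generated: "carrier T.Z = left_module.orbit UW T.Z (T.tens \<one>\<^bsub>UW\<^esub> 1)"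
proof -
  interpret Z: left_module UW T.Z by (rule T.left_module_Z)
  let ?v = "T.tens \<one>\<^bsub>UW\<^esub> 1"
  have v: "?v \<in> carrier T.Z" by (intro T.tens_closed) (auto simp: N_simps)
  note O = Z.orbit_props[OF v]
  have tens: "T.tens a c \<in> Z.orbit ?v" if a: "a \<in> carrier UW" for a c
  proof -
    have "(a \<otimes>\<^bsub>UW\<^esub> U.uc c) \<odot>\<^bsub>T.Z\<^esub> ?v = T.tens (a \<otimes>\<^bsub>UW\<^esub> inc (V.S.uc c)) 1"
      using a by (simp add: T.smult_tens incl_uc)
    also have "\<dots> = T.tens a c"
      using a by (subst T.tens_\<phi>) (simp_all add: N_simps verma_char_uc[OF lam(3)])
    finally have "T.tens a c = (a \<otimes>\<^bsub>UW\<^esub> U.uc c) \<odot>\<^bsub>T.Z\<^esub> ?v" ..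
    moreover have "a \<otimes>\<^bsub>UW\<^esub> U.uc c \<in> carrier UW" using a by simp
    ultimately show ?thesis unfolding Z.orbit_def by blast
  qed
  have "T.cl f \<in> Z.orbit ?v \<and> f \<in> carrier T.F" if "f \<in> carrier T.F" for f
    using that
  proof (induction f rule: T.F_induct)
    case zero
    thus ?case using O(2) by (simp add: T.Z_zero)
  next
    case (frag a n)
    thus ?case using tens[of a n] by (simp add: T.tens_def)
  next
    case (diff f g)
    hence c: "f - g \<in> carrier T.F" by (intro T.F_diff) auto
    have mg: "0 - g \<in> carrier T.F" using diff T.H_facts(5)[OF T.H_facts(1)] by (intro T.F_diff) auto
    have gZ: "T.cl g \<in> carrier T.Z" "T.cl (0 - g) \<in> carrier T.Z"
      using diff mg unfolding T.Z_carrier by auto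
    have "T.cl (0 - g) \<oplus>\<^bsub>T.Z\<^esub> T.cl g = \<zero>\<^bsub>T.Z\<^esub>"
      using T.Z_add[OF mg conjunct2[OF diff(2)]] by (simp add: T.Z_zero)
    hence "\<ominus>\<^bsub>T.Z\<^esub> T.cl g = T.cl (0 - g)"
      using gZ by (intro Z.M.minus_equality) auto
    moreover have "\<ominus>\<^bsub>T.Z\<^esub> T.cl g = (\<ominus>\<^bsub>UW\<^esub> \<one>\<^bsub>UW\<^esub>) \<odot>\<^bsub>T.Z\<^esub> T.cl g"
      using gZ by (simp add: Z.smult_minus Z.smult_one)
    ultimately have "T.cl (0 - g) \<in> Z.orbit ?v"
      using O(5)[of "\<ominus>\<^bsub>UW\<^esub> \<one>\<^bsub>UW\<^esub>" "T.cl g"] diff by simp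
    hence "T.cl f \<oplus>\<^bsub>T.Z\<^esub> T.cl (0 - g) \<in> Z.orbit ?v" using diff by (intro O(4)) auto
    thus ?case using c T.Z_add[OF conjunct2[OF diff(1)] mg] by simp
  qed
  thus ?thesis using O(1) unfolding T.Z_carrier by blast
qed

lemma verma_weight_vec: "weight_vec T.Z lam (T.tens \<one>\<^bsub>UW\<^esub> 1)"
  unfolding weight_vec_def
proof (intro conjI ballI)
  show "T.tens \<one>\<^bsub>UW\<^esub> 1 \<in> carrier T.Z" by (intro T.tens_closed) (auto simp: N_simps)
  fix x :: "'k current" assume x: "x \<in> W0"
  have xW: "x \<in> W" using x W0_subset by blast
  have "U.ug x \<odot>\<^bsub>T.Z\<^esub> T.tens \<one>\<^bsub>UW\<^esub> 1 = T.tens (\<one>\<^bsub>UW\<^esub> \<otimes>\<^bsub>UW\<^esub> inc (V.S.ug x)) 1"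
    using x xW by (simp add: T.smult_tens incl_ug)
  also have "\<dots> = T.tens \<one>\<^bsub>UW\<^esub> (lam * lookup x (0, 0))"
    using x by (subst T.tens_\<phi>) (simp_all add: N_simps verma_char_ug[OF lam(3)])
  also have "\<dots> = T.tens (\<one>\<^bsub>UW\<^esub> \<otimes>\<^bsub>UW\<^esub> inc (V.S.uc (lam * lookup x (0, 0)))) 1"
    by (subst T.tens_\<phi>) (simp_all add: N_simps verma_char_uc[OF lam(3)])
  also have "\<dots> = U.uc (lam * lookup x (0, 0)) \<odot>\<^bsub>T.Z\<^esub> T.tens \<one>\<^bsub>UW\<^esub> 1"
    by (simp add: T.smult_tens incl_uc)
  finally show "U.ug x \<odot>\<^bsub>T.Z\<^esub> T.tens \<one>\<^bsub>UW\<^esub> 1 =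
    U.uc (lam * lookup x (0, 0)) \<odot>\<^bsub>T.Z\<^esub> T.tens \<one>\<^bsub>UW\<^esub> 1" .
qed

text \<open>Sending \<open>a \<otimes> c\<close> to \<open>c a w\<close>, for a weight vector \<open>w\<close> of \<open>U\<^sub>\<chi>(W\<^sub>\<ell>)\<close> itself, shows that
  \<open>1 \<otimes> 1\<close> does not vanish.\<close>

lemma verma_nonzero: "T.tens \<one>\<^bsub>UW\<^esub> 1 \<noteq> \<zero>\<^bsub>T.Z\<^esub>"
proof -
  obtain u where u: "weight_vec regular_module 0 u" "u \<noteq> \<zero>\<^bsub>UW\<^esub>"
    by (rule regular_ex_weight_vec)
  \<comment> \<open>Shifting only lowers weights; from 0 the weight m is reached modulo p after p -
    m steps.\<close>
  have "0 - of_nat (p - m) = lam"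
  proof -
    have "of_nat (p - m) + of_nat m = (of_nat p :: 'k)" using lam(2) by (simp flip: of_nat_add)
    also have "\<dots> = 0" using char of_nat_CHAR[where 'a = 'k] by simp
    finally show ?thesis using lam(1) by (simp add: minus_unique)
  qed
  then obtain w where w: "weight_vec regular_module lam w" "w \<noteq> \<zero>\<^bsub>UW\<^esub>"
    using weight_vec_shift[OF left_module_regular u(1), of "p - m"] u(2) by auto
  have wU: "w \<in> carrier UW" using w(1) by (simp add: weight_vec_def)
  \<comment> \<open>The algebra of \<open>W0\<close> acts on w by the character
    \<open>rc lam\<close>; this makes a \<otimes> c \<mapsto> a c w balanced.\<close>
  have inc_w: "inc b \<otimes>\<^bsub>UW\<^esub> w = U.uc (rc lam b) \<otimes>\<^bsub>UW\<^esub> w" if "b \<in> carrier V.S.UA" for b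
    using that
  proof (induction b rule: V.S.UA_induct)
    case (const c)
    show ?case by (simp add: incl_uc verma_char_uc[OF lam(3)])
  next
    case (gen x)
    hence x: "x \<in> W0" by simp
    hence "U.ug x \<otimes>\<^bsub>UW\<^esub> w = U.uc (lam * lookup x (0, 0)) \<otimes>\<^bsub>UW\<^esub> w"
      using w(1) by (simp add: weight_vec_def)
    thus ?case using x by (simp add: incl_ug verma_char_ug[OF lam(3)])
  next
    case (add a b)
    thus ?case using wU incl_closed
      by (simp add: incl_hom verma_char_add[OF lam(3)] U.uc_simps U.UA.l_distr)
  next
    case (mult a b)
    note ia = incl_closed[OF mult(1)] and ib = incl_closed[OF mult(2)]
    have "inc (a \<otimes>\<^bsub>V.S.UA\<^esub> b) \<otimes>\<^bsub>UW\<^esub> w = inc a \<otimes>\<^bsub>UW\<^esub> (U.uc (rc lam b) \<otimes>\<^bsub>UW\<^esub> w)"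
      using mult wU ia ib by (simp add: incl_hom U.UA.m_assoc)
    also have "\<dots> = (inc a \<otimes>\<^bsub>UW\<^esub> U.uc (rc lam b)) \<otimes>\<^bsub>UW\<^esub> w"
      using wU ia by (simp add: U.UA.m_assoc)
    also have "inc a \<otimes>\<^bsub>UW\<^esub> U.uc (rc lam b) = U.uc (rc lam b) \<otimes>\<^bsub>UW\<^esub> inc a"
      using U.uc_commute[OF ia, of "rc lam b"] by simp
    also have "(U.uc (rc lam b) \<otimes>\<^bsub>UW\<^esub> inc a) \<otimes>\<^bsub>UW\<^esub> w = U.uc (rc lam b) \<otimes>\<^bsub>UW\<^esub> (U.uc (rc lam a) \<otimes>\<^bsub>UW\<^esub> w)"
      using wU ia by (simp add: U.UA.m_assoc mult(3))
    also have "\<dots> = U.uc (rc lam b * rc lam a) \<otimes>\<^bsub>UW\<^esub> w"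
      using wU by (simp add: U.uc_simps U.UA.m_assoc)
    also have "rc lam b * rc lam a = rc lam (a \<otimes>\<^bsub>V.S.UA\<^esub> b)"
      using mult(1,2) by (simp add: verma_char_mult[OF lam(3)])
    finally show ?case .
  qed
  define g where "g = (\<lambda>(a, c). a \<otimes>\<^bsub>UW\<^esub> (U.uc c \<otimes>\<^bsub>UW\<^esub> w))"
  obtain h where h: "h \<in> hom T.F (add_monoid UW)"
    "\<And>x. x \<in> carrier UW \<times> carrier (one_dim_module (verma_weight p ell \<chi> lam)) \<Longrightarrow> h (frag_of x) = g x"
    by (rule comm_group.free_Abelian_group_universal[OF U.UA.a_comm_group, of g "carrier UW \<times> carrier (one_dim_module (verma_weight p ell \<chi> lam))"])
      (auto simp: g_def wU)
  have hg: "h (frag_of (a, c)) = a \<otimes>\<^bsub>UW\<^esub> (U.uc c \<otimes>\<^bsub>UW\<^esub> w)" if "a \<in> carrier UW" for a c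
    using h(2)[of "(a, c)"] that by (simp add: g_def N_simps)
  interpret h: group_hom T.F "add_monoid UW" h by unfold_locales (rule h(1))
  have hdiff: "h (x - y) = h x \<ominus>\<^bsub>UW\<^esub> h y" if "x \<in> carrier T.F" "y \<in> carrier T.F" for x y
  proof -
    have c: "- y \<in> carrier T.F" "inv\<^bsub>T.F\<^esub> y = - y" using that(2) by auto
    have "h (x + - y) = h x \<oplus>\<^bsub>UW\<^esub> h (- y)" using h.hom_mult[OF that(1) c(1)] by simp
    moreover have "h (- y) = \<ominus>\<^bsub>UW\<^esub> h y" using h.hom_inv[OF that(2)] c(2) by (simp add: a_inv_def)
    ultimately show ?thesis by (simp add: a_minus_def)
  qed
  have cF: "frag_of (a, c) \<in> carrier T.F" if "a \<in> carrier UW" for a c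
    using that by (intro T.F_frag_of) (auto simp: N_simps)
  show ?thesis
  proof (rule T.tens_nonzero[OF U.UA.a_comm_group h(1)])
    fix r assume "r \<in> T.rels"
    thus "h r = \<one>\<^bsub>add_monoid UW\<^esub>"
    proof (cases rule: T.rels_cases)
      case (1 a a' n)
      have "h r = (a \<otimes>\<^bsub>UW\<^esub> (U.uc n \<otimes>\<^bsub>UW\<^esub> w) \<oplus>\<^bsub>UW\<^esub> a' \<otimes>\<^bsub>UW\<^esub> (U.uc n \<otimes>\<^bsub>UW\<^esub> w))
          \<ominus>\<^bsub>UW\<^esub> a \<otimes>\<^bsub>UW\<^esub> (U.uc n \<otimes>\<^bsub>UW\<^esub> w) \<ominus>\<^bsub>UW\<^esub> a' \<otimes>\<^bsub>UW\<^esub> (U.uc n \<otimes>\<^bsub>UW\<^esub> w)"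
        using 1 wU by (simp only: hdiff hg cF T.F_diff U.UA.a_closed) (simp add: U.UA.l_distr)
      thus ?thesis using 1 wU by (simp add: U.UA.add_minus_minus)
    next
      case (2 a n n')
      have "h r = (a \<otimes>\<^bsub>UW\<^esub> (U.uc n \<otimes>\<^bsub>UW\<^esub> w) \<oplus>\<^bsub>UW\<^esub> a \<otimes>\<^bsub>UW\<^esub> (U.uc n' \<otimes>\<^bsub>UW\<^esub> w))
          \<ominus>\<^bsub>UW\<^esub> a \<otimes>\<^bsub>UW\<^esub> (U.uc n \<otimes>\<^bsub>UW\<^esub> w) \<ominus>\<^bsub>UW\<^esub> a \<otimes>\<^bsub>UW\<^esub> (U.uc n' \<otimes>\<^bsub>UW\<^esub> w)"
        using 2 wU by (simp only: hdiff hg cF T.F_diff N_simps(2))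
          (simp add: U.uc_simps U.UA.l_distr U.UA.r_distr)
      thus ?thesis using 2 wU by (simp add: U.UA.add_minus_minus)
    next
      case (3 a b n)
      note ib = incl_closed[OF 3(2)]
      have "(a \<otimes>\<^bsub>UW\<^esub> inc b) \<otimes>\<^bsub>UW\<^esub> (U.uc n \<otimes>\<^bsub>UW\<^esub> w) = a \<otimes>\<^bsub>UW\<^esub> ((inc b \<otimes>\<^bsub>UW\<^esub> U.uc n) \<otimes>\<^bsub>UW\<^esub> w)"
        using 3(1) wU ib by (simp add: U.UA.m_assoc)
      also have "inc b \<otimes>\<^bsub>UW\<^esub> U.uc n = U.uc n \<otimes>\<^bsub>UW\<^esub> inc b"
        using U.uc_commute[OF ib, of n] by simp
      also have "(U.uc n \<otimes>\<^bsub>UW\<^esub> inc b) \<otimes>\<^bsub>UW\<^esub> w = U.uc n \<otimes>\<^bsub>UW\<^esub> (U.uc (rc lam b) \<otimes>\<^bsub>UW\<^esub> w)"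
        using wU ib by (simp add: U.UA.m_assoc inc_w[OF 3(2)])
      also have "\<dots> = U.uc (rc lam b * n) \<otimes>\<^bsub>UW\<^esub> w"
        using wU by (simp add: mult.commute[of "rc lam b" n] U.uc_simps U.UA.m_assoc)
      finally have "h r = a \<otimes>\<^bsub>UW\<^esub> (U.uc (rc lam b * n) \<otimes>\<^bsub>UW\<^esub> w) \<ominus>\<^bsub>UW\<^esub> a \<otimes>\<^bsub>UW\<^esub> (U.uc (rc lam b * n) \<otimes>\<^bsub>UW\<^esub> w)"
        using 3(1,4) ib by (simp only: hdiff hg cF N_simps(3) U.UA.m_closed)
      thus ?thesis using 3(1) wU by (simp add: a_minus_def U.UA.r_neg)
    qed
  next
    show "h (frag_of (\<one>\<^bsub>UW\<^esub>, 1)) \<noteq> \<one>\<^bsub>add_monoid UW\<^esub>"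
      using w(2) wU by (simp add: hg U.uc_simps)
  qed
qed

lemma simple_verma: "simple_left_module UW (verma p ell pm \<chi> lam)"
  unfolding verma_eq
proof (rule simple_of_weight_vec_of_nat[OF T.left_module_Z _ verma_nonzero _ verma_generated])
  show "weight_vec T.Z (of_nat m) (T.tens \<one>\<^bsub>UW\<^esub> 1)"
    using verma_weight_vec by (simp only: lam(1)[symmetric])
  show "m \<le> p" using lam(2) by simp
qed

end

end

theorem theorem3p3:
  fixes p ell :: nat
    and \<chi> :: "'k::alg_closed_field current \<Rightarrow> 'k"
    and pm :: "'k current \<Rightarrow> 'k current"
  defines "U \<equiv> red_env_algebra p (witt p ell pm) \<chi>"
  assumes "CHAR('k) = p" and "p > 3" and "ell \<ge> 1"
    and "is_witt_p_map p ell pm"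
    and "linear_form (witt p ell pm) \<chi>"
    and "height p ell \<chi> = 0"
    and "\<chi> (witt_e p ell (-1) ell) \<noteq> 0"
  shows "(\<forall>lam\<in>Lambda p ell \<chi>. \<forall>mu\<in>Lambda p ell \<chi>.
            left_module_iso U (verma p ell pm \<chi> lam) (verma p ell pm \<chi> mu)) \<and>
         (\<exists>S :: (('k, 'k current) red_env, ('k, 'k current) red_env set) module.
            simple_left_module U S) \<and>
         (\<forall>(S :: (('k, 'k current) red_env, 'm) module) (T :: (('k, 'k current) red_env, 'n) module).
            simple_left_module U S \<longrightarrow> simple_left_module U T \<longrightarrow> left_module_iso U S T)"
proof -
  interpret witt_height_0 p ell \<chi> pm
    using assms(2-) by unfold_locales
  have verma: "simple_left_module U (verma p ell pm \<chi> lam)" if lam: "lam \<in> Lambda p ell \<chi>" for lam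
  proof -
    obtain m where "m < p" "lam = of_nat m" "lam ^ p = lam" by (rule Lambda_cases[OF lam])
    thus ?thesis unfolding U_def by (intro simple_verma)
  qed
  show ?thesis
  proof (intro conjI ballI allI impI)
    fix lam mu assume "lam \<in> Lambda p ell \<chi>" "mu \<in> Lambda p ell \<chi>"
    from verma[OF this(1)] verma[OF this(2)]
    show "left_module_iso U (verma p ell pm \<chi> lam) (verma p ell pm \<chi> mu)"
      unfolding U_def by (rule simple_modules_iso)
  next
    show "\<exists>S :: (('k, 'k current) red_env, ('k, 'k current) red_env set) module. simple_left_module U S"
      unfolding U_def by (rule ex_simple_module)
  next
    fix S :: "(('k, 'k current) red_env, 'm) module" and T :: "(('k, 'k current) red_env, 'n) module"
    assume "simple_left_module U S" "simple_left_module U T"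
    thus "left_module_iso U S T" unfolding U_def by (rule simple_modules_iso)
  qed
qed

end
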